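(* Let $1\le m\le\infty$ and let $L$ be an $L(m)$-algebra. Let $\delta:L\to L\times L$ be the homomorphism of $L(m)$-algebras $\delta(\xi)=\xi\oplus\xi$, and let $$\Delta:\mathcal U_m(L)\longrightarrow\mathcal U_m(L\times L)=\mathcal U_m(L)\,\Box\,\mathcal U_m(L)$$ be the homomorphism of unital $A(m)$-algebras induced by $\delta$ via the functoriality of $\mathcal U_m(-)$. Then $\Delta$ induces on $\mathcal U_m(L)$ the structure of a cocommutative coassociative coalgebra in the monoidal category $(\mathbf A(m),\Box,\mathbf 1)$, with counit given by the augmentation $\epsilon:\mathcal U_m(L)\to\mathbf 1$.
   Context: All objects are over a fixed field $\mathbf k$ of characteristic zero; graded means $\mathbb Z$-graded; the Koszul sign convention is used (commuting things of degrees $p$ and $q$ gives the sign $(-1)^{pq}$). Signs. For homogeneous $x_1,\ldots,x_n$ and $\sigma\in\mathcal S_n$ (symmetric group), the Koszul sign $\epsilon(\sigma;x_1,\ldots,x_n)$ is defined by $x_1\wedge\cdots\wedge x_n=\epsilon(\sigma)\,x_{\sigma(1)}\wedge\cdots\wedge x_{\sigma(n)}$ in the free graded commutative algebra on $x_1,\ldots,x_n$; and $\chi(\sigma)=\chi(\sigma;x_1,\ldots,x_n):=\mathrm{sgn}(\sigma)\,\epsilon(\sigma;x_1,\ldots,x_n)$. A permutation $\sigma\in\mathcal S_n$ is a $(j,n-j)$-unshuffle if $\sigma(1)<\cdots<\sigma(j)$ and $\sigma(j+1)<\cdots<\sigma(n)$. $A(m)$-structure on a graded vector space $V$: a collection of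 linear maps $\mu_k:\bigotimes^kV\to V$, $1\le k\le m$, $k<\infty$, of degree $k-2$, such that for all finite $n$ with $1\le n\le m$ and homogeneous $a_1,\ldots,a_n\in V$ $$\sum_{\lambda=0}^{n-1}\sum_{k=1}^{n-\lambda}(-1)^{k+\lambda+k\lambda+nk+k(|a_1|+\cdots+|a_\lambda|)}\mu_{n-k+1}(a_1,\ldots,a_\lambda,\mu_k(a_{\lambda+1},\ldots,a_{\lambda+k}),a_{\lambda+k+1},\ldots,a_n)=0.$$ It is unital if it is equipped with a degree $0$ element $1$ with $\mu_2(1,a)=a=\mu_2(a,1)$ and with $\mu_k$ vanishing for $k\ne2$ whenever one of its arguments is $1$. A morphism is a degree $0$ linear map $f$ preserving units with $f\circ\mu_n=\mu_n'\circ f^{\otimes n}$ for all $1\le n\le m$, $n<\infty$. $\mathbf A(m)$ is the category of unital $A(m)$-algebras. $\mathbf 1=(\mathbf k,\mu_i)$ is the unital $A(m)$-algebra with $\mu_2(1\otimes1)=1$ and $\mu_i=0$ for $i\ne2$. $L(m)$-algebra: a graded vector space $L$ with linear maps $l_k:\bigotimes^kL\to L$, $1\le k\le m$, $k<\infty$, of degree $k-2$, antisymmetric, $l_k(x_{\sigma(1)},\ldots,x_{\sigma(k)})=\chi(\sigma)\,l_k(x_1,\ldots,x_k)$ for $\sigma\in\mathcal S_k$, such that for all finite $n$ with $1\le n\le m$ $$\sum_{i+j=n+1}\sum_\sigma\chi(\sigma)(-1)^{i(j-1)}l_j(l_i(x_{\sigma(1)},\ldots,x_{\sigma(i)}),x_{\sigma(i+1)},\ldots,x_{\sigma(n)})=0,$$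 where $i,j\ge1$ and $\sigma$ runs over all $(i,n-i)$-unshuffles. Morphisms are degree $0$ linear maps commuting with all $l_k$. The direct product $L'\times L''$ of $(L',l'_n)$ and $(L'',l''_n)$ is $L'\oplus L''$ with $l_n(\xi_1,\ldots,\xi_n)$ equal to $l'_n(\xi_1,\ldots,\xi_n)$ if all $\xi_i\in L'$, to $l''_n(\xi_1,\ldots,\xi_n)$ if all $\xi_i\in L''$, and to $0$ if each $\xi_i$ lies in $L'$ or $L''$ and both occur. $\mathcal F_m(X)$ is the free unital $A(m)$-algebra generated by a graded vector space $X$. An ideal is a graded subspace such that every $\mu_n$ takes values in it as soon as one argument lies in it. The universal enveloping $A(m)$-algebra is $\mathcal U_m(L):=\mathcal F_m(L)/I$, with $I$ the ideal generated by the relations $\sum_{\sigma\in\mathcal S_n}\chi(\sigma)\mu_n(\xi_{\sigma(1)},\ldots,\xi_{\sigma(n)})=l_n(\xi_1,\ldots,\xi_n)$, $\xi_1,\ldots,\xi_n\in L$, $n\le m$, $n<\infty$; it is functorial in $L$. The augmentation $\epsilon:\mathcal U_m(L)\to\mathcal U_m(\mathbf 0)=\mathbf 1$ is induced by $L\to\mathbf 0$. The operation $\Box$: for free presentations $A=\mathcal F_m(X_A)/(R_A)$, $B=\mathcal F_m(X_B)/(R_B)$ ($X_A,X_B$ graded vector spaces, $R_A,R_B$ relations), $$A\,\Box\,B:=\mathcal F_m(X_A\oplus X_B)/(R_A,S_{A,B},R_B),$$ where $S_{A,B}$ is the ideal generated by the relations $\sum_{\sigma\in\mathcal S_n}\chi(\sigma;x_1,\ldots,x_n)\mu_n(x_{\sigma(1)},\ldots,x_{\sigma(n)})=0$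 for finite $n\le m$, with each $x_i$ in $X_A$ or in $X_B$ and both kinds occurring. For $\mathcal U_m(L)$ the presentation $\mathcal F_m(L)/I$ is used; $A\,\Box\,B$ has the displayed presentation. With these presentations $\mathcal U_m(L'\times L'')$ is identified with $\mathcal U_m(L')\,\Box\,\mathcal U_m(L'')$. The operation $\Box$ is regarded as giving a strict symmetric monoidal structure on $\mathbf A(m)$ with unit object $\mathbf 1$, the symmetry $A\,\Box\,B\to B\,\Box\,A$ coming from the interchange of $X_A$ and $X_B$. *)

theory Defs
  imports
    "HOL-Algebra.Module"
    "HOL-Algebra.AbelCoset"
    "HOL-Algebra.Algebraic_Closure_Type"
    "HOL-Combinatorics.Permutations"
    "HOL-Library.Poly_Mapping"
    "HOL-Library.FuncSet"
    "HOL-Library.Extended_Nat"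
begin

section \<open>Graded vector spaces\<close>

text \<open>
  The ground field is a type \<open>'k\<close> of class \<^class>\<open>field_char_0\<close>; as a ring record it is
  \<open>ring_of_type_algebra\<close>.  Spaces are carried by sets (quotients are needed), so they are modules
  in the sense of HOL-Algebra.  The field \<open>mult\<close>, which \<open>module\<close> inherits from \<open>ring\<close>, is never
  used; \<open>one\<close> is used only for the units of \<open>A(m)\<close>-algebras.
\<close>

record ('k, 'v) gspace = "('k, 'v) module" +
  homog :: "int \<Rightarrow> 'v set"

definition is_decomposition ::
  "('k, 'v, 'z) gspace_scheme \<Rightarrow> 'v \<Rightarrow> (int \<Rightarrow> 'v) \<Rightarrow> bool" where
  "is_decomposition V v c \<longleftrightarrow>
     (\<forall>d. c d \<in> homog V d) \<and> finite {d. c d \<noteq> \<zero>\<^bsub>V\<^esub>} \<and>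
     v = (\<Oplus>\<^bsub>V\<^esub>d\<in>{d. c d \<noteq> \<zero>\<^bsub>V\<^esub>}. c d)"

locale graded_space = module "ring_of_type_algebra :: 'k ring" V
  for V :: "('k::field_char_0, 'v, 'z) gspace_scheme" (structure) +
  assumes homog_submodule: "submodule (homog V d) (ring_of_type_algebra :: 'k ring) V"
    and decomposition: "v \<in> carrier V \<Longrightarrow> \<exists>!c. is_decomposition V v c"

definition component :: "('k, 'v, 'z) gspace_scheme \<Rightarrow> 'v \<Rightarrow> int \<Rightarrow> 'v" where
  "component V v = (THE c. is_decomposition V v c)"

definition graded_subspace :: "('k::field_char_0, 'v, 'z) gspace_scheme \<Rightarrow> 'v set \<Rightarrow> bool" where
  "graded_subspace V W \<longleftrightarrow>
     submodule W (ring_of_type_algebra :: 'k ring) V \<and> (\<forall>w\<in>W. \<forall>d. component V w d \<in> W)"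

text \<open>Elements \<open>xs\<close> homogeneous of the respective degrees \<open>ds\<close>.\<close>

definition has_degs :: "('k, 'v, 'z) gspace_scheme \<Rightarrow> int list \<Rightarrow> 'v list \<Rightarrow> bool" where
  "has_degs V ds xs \<longleftrightarrow> list_all2 (\<lambda>d x. x \<in> homog V d) ds xs"

definition linear0 ::
  "('k, 'v, 'y) gspace_scheme \<Rightarrow> ('k, 'w, 'z) gspace_scheme \<Rightarrow> ('v \<Rightarrow> 'w) \<Rightarrow> bool" where
  "linear0 V W f \<longleftrightarrow>
     f \<in> carrier V \<rightarrow>\<^sub>E carrier W \<and>
     (\<forall>x\<in>carrier V. \<forall>y\<in>carrier V. f (x \<oplus>\<^bsub>V\<^esub> y) = f x \<oplus>\<^bsub>W\<^esub> f y) \<and>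
     (\<forall>a. \<forall>x\<in>carrier V. f (a \<odot>\<^bsub>V\<^esub> x) = a \<odot>\<^bsub>W\<^esub> f x) \<and>
     (\<forall>d. f ` homog V d \<subseteq> homog W d)"

definition gsum ::
  "('k, 'v) gspace \<Rightarrow> ('k, 'w) gspace \<Rightarrow> ('k, 'v \<times> 'w) gspace" where
  "gsum V W =
     \<lparr>carrier = carrier V \<times> carrier W, monoid.mult = undefined, one = undefined,
      zero = (\<zero>\<^bsub>V\<^esub>, \<zero>\<^bsub>W\<^esub>),
      add = (\<lambda>(x, y) (x', y'). (x \<oplus>\<^bsub>V\<^esub> x', y \<oplus>\<^bsub>W\<^esub> y')),
      module.smult = (\<lambda>a (x, y). (a \<odot>\<^bsub>V\<^esub> x, a \<odot>\<^bsub>W\<^esub> y)),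
      homog = (\<lambda>d. homog V d \<times> homog W d)\<rparr>"


section \<open>Signs\<close>

text \<open>
  \<open>koszul_sign s ds\<close> is the sign \<open>\<epsilon>\<close> in
  \<open>x\<^sub>1 \<and> \<dots> \<and> x\<^sub>n = \<epsilon> x\<^bsub>s(1)\<^esub> \<and> \<dots> \<and> x\<^bsub>s(n)\<^esub>\<close>
  for \<open>x\<^sub>i\<close> of degree \<open>ds ! i\<close>: each pair of factors whose order is reversed contributes the sign
  of their exchange.  Indices start at \<open>0\<close>.  The two lemmas below say that \<open>\<epsilon>\<close> is \<open>1\<close> for the
  identity and is multiplied by \<open>(-1)\<^bsup>pq\<^esup>\<close> when adjacent factors of degrees \<open>p, q\<close> of
  \<open>x\<^bsub>s(1)\<^esub> \<and> \<dots> \<and> x\<^bsub>s(n)\<^esub>\<close> are exchanged, which determines it.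
\<close>

definition koszul_sign :: "(nat \<Rightarrow> nat) \<Rightarrow> int list \<Rightarrow> 'k::field_char_0" where
  "koszul_sign s ds =
     (\<Prod>(i, j)\<in>{(i, j). i < j \<and> j < length ds \<and> s j < s i}. (-1) powi (ds ! s i * ds ! s j))"

lemma koszul_sign_id: "koszul_sign id ds = 1"
  by (auto simp: koszul_sign_def intro!: prod.neutral)

lemma koszul_sign_swap:
  assumes s: "s permutes {..<length ds}" and i: "Suc i < length ds"
  shows "koszul_sign (s \<circ> transpose i (Suc i)) ds =
    (-1) powi (ds ! s i * ds ! s (Suc i)) * (koszul_sign s ds :: 'k::field_char_0)"
proof -
  define t where "t = transpose i (Suc i)"
  define S where "S = (\<lambda>s::nat \<Rightarrow> nat. {(a, b). a < b \<and> b < length ds \<and> s b < s a})"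
  define S' where "S' = (\<lambda>s. S s - {(i, Suc i)})"
  define f :: "(nat \<Rightarrow> nat) \<Rightarrow> nat \<times> nat \<Rightarrow> 'k"
    where "f = (\<lambda>s (a, b). (-1) powi (ds ! s a * ds ! s b))"
  define e :: 'k where "e = (-1) powi (ds ! s i * ds ! s (Suc i))"
  have fin: "finite (S r)" for r
    by (rule finite_subset[of _ "{..<length ds} \<times> {..<length ds}"]) (auto simp: S_def)
  have tt: "t (t a) = a" for a
    by (simp add: t_def)
  have td: "t a = (if a = i then Suc i else if a = Suc i then i else a)" for a
    by (simp add: t_def transpose_def)
  have tl: "t a < t b" if "a < b" "a \<noteq> i \<or> b \<noteq> Suc i" for a b
    using that by (auto simp: td)
  have tn: "t a < length ds" if "a < length ds" for a
    using that i by (simp add: td)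
  have tp: "t a \<noteq> i \<or> t b \<noteq> Suc i" if "a < b" for a b
    using that by (simp add: td)
  have bij: "prod (f (s \<circ> t)) (S' (s \<circ> t)) = prod (f s) (S' s)"
    by (rule prod.reindex_bij_witness[of _ "map_prod t t" "map_prod t t"])
      (use tp in \<open>auto simp: S'_def S_def f_def tt tl tn\<close>)
  have ne: "s i \<noteq> s (Suc i)"
    by (simp add: inj_eq[OF permutes_inj[OF s]])
  have ee: "e * e = 1"
    by (simp add: e_def power_int_minus_left)
  have fs: "f s (i, Suc i) = e" "f (s \<circ> t) (i, Suc i) = e"
    by (auto simp: f_def e_def t_def mult.commute)
  have split: "prod (f r) (S r) = (if r (Suc i) < r i then f r (i, Suc i) else 1) * prod (f r) (S' r)"
    for r
  proof (cases "(i, Suc i) \<in> S r")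
    case True
    then show ?thesis
      using prod.remove[OF fin True, of "f r"] by (simp add: S'_def S_def)
  next
    case False
    then show ?thesis
      using i by (simp add: S'_def S_def)
  qed
  have "prod (f (s \<circ> t)) (S (s \<circ> t)) = e * prod (f s) (S s)"
    unfolding split[of s] split[of "s \<circ> t"] bij fs using ne ee
    by (auto simp: t_def mult.assoc[symmetric])
  then show ?thesis
    by (simp add: koszul_sign_def S_def f_def e_def t_def)
qed

definition antisym_sign :: "(nat \<Rightarrow> nat) \<Rightarrow> int list \<Rightarrow> 'k::field_char_0" where
  "antisym_sign s ds = of_int (sign s) * koszul_sign s ds"

definition unshuffles :: "nat \<Rightarrow> nat \<Rightarrow> (nat \<Rightarrow> nat) set" where
  "unshuffles j n =
     {s. s permutes {..<n} \<and> strict_mono_on {..<j} s \<and> strict_mono_on {j..<n} s}"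


section \<open>Families of multilinear operations\<close>

definition arity :: "enat \<Rightarrow> nat \<Rightarrow> bool" where
  "arity m k \<longleftrightarrow> 1 \<le> k \<and> enat k \<le> m"

text \<open>
  A family of operations \<open>f\<^sub>k : V\<^bsup>\<otimes>k\<^esup> \<rightarrow> V\<close>, \<open>1 \<le> k \<le> m\<close>, is a single function on lists, the
  arity being the length of the argument; its values on lists of other lengths are irrelevant.
  The operation \<open>f\<^sub>k\<close> is multilinear of degree \<open>k - 2\<close>.
\<close>

definition graded_operations ::
  "enat \<Rightarrow> ('k, 'v, 'z) gspace_scheme \<Rightarrow> ('v list \<Rightarrow> 'v) \<Rightarrow> bool" where
  "graded_operations m V f \<longleftrightarrow>
     (\<forall>xs. set xs \<subseteq> carrier V \<and> arity m (length xs) \<longrightarrow> f xs \<in> carrier V) \<and>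
     (\<forall>xs x y zs. set xs \<union> {x, y} \<union> set zs \<subseteq> carrier V \<and> arity m (length xs + 1 + length zs) \<longrightarrow>
        f (xs @ (x \<oplus>\<^bsub>V\<^esub> y) # zs) = f (xs @ x # zs) \<oplus>\<^bsub>V\<^esub> f (xs @ y # zs)) \<and>
     (\<forall>xs a x zs. set xs \<union> {x} \<union> set zs \<subseteq> carrier V \<and> arity m (length xs + 1 + length zs) \<longrightarrow>
        f (xs @ (a \<odot>\<^bsub>V\<^esub> x) # zs) = a \<odot>\<^bsub>V\<^esub> f (xs @ x # zs)) \<and>
     (\<forall>ds xs. has_degs V ds xs \<and> arity m (length xs) \<longrightarrow>
        f xs \<in> homog V (sum_list ds + int (length xs) - 2))"


section \<open>Unital \<open>A(m)\<close>-algebras\<close>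

record ('k, 'v) amalg = "('k, 'v) gspace" +
  mu :: "'v list \<Rightarrow> 'v"

definition stasheff :: "('k::field_char_0, 'v, 'z) amalg_scheme \<Rightarrow> int list \<Rightarrow> 'v list \<Rightarrow> 'v" where
  "stasheff A ds as =
     (let n = length as in
      \<Oplus>\<^bsub>A\<^esub>l\<in>{0..<n}. \<Oplus>\<^bsub>A\<^esub>k\<in>{1..n - l}.
        ((-1) powi (int k + int l + int k * int l + int n * int k + int k * sum_list (take l ds)))
        \<odot>\<^bsub>A\<^esub> mu A (take l as @ mu A (take k (drop l as)) # drop (l + k) as))"

text \<open>For \<open>m = 1\<close> there is no product, and the unit is only required to be a cycle.\<close>

locale unital_am_algebra = graded_space A
  for m :: enat and A :: "('k::field_char_0, 'v, 'z) amalg_scheme" (structure) +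
  assumes operations: "graded_operations m A (mu A)"
    and stasheff_identity: "has_degs A ds as \<Longrightarrow> arity m (length as) \<Longrightarrow> stasheff A ds as = \<zero>"
    and one_degree: "\<one> \<in> homog A 0"
    and one_left: "arity m 2 \<Longrightarrow> a \<in> carrier A \<Longrightarrow> mu A [\<one>, a] = a"
    and one_right: "arity m 2 \<Longrightarrow> a \<in> carrier A \<Longrightarrow> mu A [a, \<one>] = a"
    and one_other: "arity m (length as) \<Longrightarrow> length as \<noteq> 2 \<Longrightarrow> set as \<subseteq> carrier A \<Longrightarrow>
      \<one> \<in> set as \<Longrightarrow> mu A as = \<zero>"

text \<open>Morphisms are extensional functions, so that equality of morphisms is equality in HOL.\<close>

definition am_hom ::
  "enat \<Rightarrow> ('k::field_char_0, 'v) amalg \<Rightarrow> ('k, 'w) amalg \<Rightarrow> ('v \<Rightarrow> 'w) \<Rightarrow> bool" where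
  "am_hom m A B f \<longleftrightarrow>
     unital_am_algebra m A \<and> unital_am_algebra m B \<and> linear0 A B f \<and> f \<one>\<^bsub>A\<^esub> = \<one>\<^bsub>B\<^esub> \<and>
     (\<forall>as. set as \<subseteq> carrier A \<and> arity m (length as) \<longrightarrow> f (mu A as) = mu B (map f as))"

definition am_iso ::
  "enat \<Rightarrow> ('k::field_char_0, 'v) amalg \<Rightarrow> ('k, 'w) amalg \<Rightarrow> ('v \<Rightarrow> 'w) \<Rightarrow> bool" where
  "am_iso m A B f \<longleftrightarrow> am_hom m A B f \<and> bij_betw f (carrier A) (carrier B)"

definition ground :: "('k::field_char_0, 'k) amalg" where
  "ground =
     \<lparr>carrier = UNIV, monoid.mult = undefined, one = 1, zero = 0, add = (+), module.smult = (*),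
      homog = (\<lambda>d. if d = 0 then UNIV else {0}),
      mu = (\<lambda>as. if length as = 2 then as ! 0 * as ! 1 else 0)\<rparr>"

definition am_ideal :: "enat \<Rightarrow> ('k::field_char_0, 'v) amalg \<Rightarrow> 'v set \<Rightarrow> bool" where
  "am_ideal m A I \<longleftrightarrow>
     graded_subspace A I \<and>
     (\<forall>as. arity m (length as) \<and> set as \<subseteq> carrier A \<and> set as \<inter> I \<noteq> {} \<longrightarrow> mu A as \<in> I)"

definition am_genideal :: "enat \<Rightarrow> ('k::field_char_0, 'v) amalg \<Rightarrow> 'v set \<Rightarrow> 'v set" where
  "am_genideal m A S = \<Inter>{I. am_ideal m A I \<and> S \<subseteq> I}"

definition am_quot :: "('k, 'v) amalg \<Rightarrow> 'v set \<Rightarrow> ('k, 'v set) amalg" where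
  "am_quot A I =
     \<lparr>carrier = (\<lambda>a. I +>\<^bsub>A\<^esub> a) ` carrier A, monoid.mult = undefined, one = I +>\<^bsub>A\<^esub> \<one>\<^bsub>A\<^esub>, zero = I,
      add = (\<lambda>C D. C <+>\<^bsub>A\<^esub> D),
      module.smult = (\<lambda>c C. \<Union>a\<in>C. I +>\<^bsub>A\<^esub> (c \<odot>\<^bsub>A\<^esub> a)),
      homog = (\<lambda>d. (\<lambda>a. I +>\<^bsub>A\<^esub> a) ` homog A d),
      mu = (\<lambda>Cs. \<Union>as\<in>listset Cs. I +>\<^bsub>A\<^esub> mu A as)\<rparr>"

definition antisymmetrization ::
  "('k::field_char_0, 'v) amalg \<Rightarrow> int list \<Rightarrow> 'v list \<Rightarrow> 'v" where
  "antisymmetrization A ds xs =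
     (\<Oplus>\<^bsub>A\<^esub>s\<in>{s. s permutes {..<length xs}}. antisym_sign s ds \<odot>\<^bsub>A\<^esub> mu A (permute_list s xs))"


section \<open>\<open>L(m)\<close>-algebras\<close>

record ('k, 'v) lalg = "('k, 'v) gspace" +
  br :: "'v list \<Rightarrow> 'v"

text \<open>In the last axiom \<open>j = n + 1 - i\<close>, hence \<open>i * (j - 1) = i * (n - i)\<close>.\<close>

locale lm_algebra = graded_space L
  for m :: enat and L :: "('k::field_char_0, 'v, 'z) lalg_scheme" (structure) +
  assumes operations: "graded_operations m L (br L)"
    and antisymmetric: "has_degs L ds xs \<Longrightarrow> arity m (length xs) \<Longrightarrow> s permutes {..<length xs} \<Longrightarrow>
      br L (permute_list s xs) = antisym_sign s ds \<odot> br L xs"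
    and jacobi: "has_degs L ds xs \<Longrightarrow> n = length xs \<Longrightarrow> arity m n \<Longrightarrow>
      (\<Oplus>i\<in>{1..n}. \<Oplus>s\<in>unshuffles i n.
         (antisym_sign s ds * (-1) ^ (i * (n - i))) \<odot>
         br L (br L (take i (permute_list s xs)) # drop i (permute_list s xs))) = \<zero>"

definition lm_hom ::
  "enat \<Rightarrow> ('k::field_char_0, 'v) lalg \<Rightarrow> ('k, 'w) lalg \<Rightarrow> ('v \<Rightarrow> 'w) \<Rightarrow> bool" where
  "lm_hom m L L' f \<longleftrightarrow>
     lm_algebra m L \<and> lm_algebra m L' \<and> linear0 L L' f \<and>
     (\<forall>xs. set xs \<subseteq> carrier L \<and> arity m (length xs) \<longrightarrow> f (br L xs) = br L' (map f xs))"

text \<open>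
  The bracket of the direct product is the multilinear map which is the given bracket on each
  summand and vanishes on mixed arguments: expanding \<open>\<xi>\<^sub>i = (x\<^sub>i, y\<^sub>i) = (x\<^sub>i, 0) + (0, y\<^sub>i)\<close>, only
  the two unmixed terms remain.
\<close>

definition lprod :: "('k, 'v) lalg \<Rightarrow> ('k, 'w) lalg \<Rightarrow> ('k, 'v \<times> 'w) lalg" where
  "lprod L L' =
     gspace.extend (gsum (gspace.truncate L) (gspace.truncate L'))
       \<lparr>br = (\<lambda>xs. (br L (map fst xs), br L' (map snd xs)))\<rparr>"

definition lzero :: "('k, unit) lalg" where
  "lzero =
     \<lparr>carrier = UNIV, monoid.mult = undefined, one = undefined, zero = (), add = (\<lambda>_ _. ()),
      module.smult = (\<lambda>_ _. ()), homog = (\<lambda>_. UNIV), br = (\<lambda>_. ())\<rparr>"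

definition diagonal :: "('k, 'v) lalg \<Rightarrow> 'v \<Rightarrow> 'v \<times> 'v" where
  "diagonal L = (\<lambda>\<xi>\<in>carrier L. (\<xi>, \<xi>))"

definition to_lzero :: "('k, 'v) lalg \<Rightarrow> 'v \<Rightarrow> unit" where
  "to_lzero L = (\<lambda>\<xi>\<in>carrier L. ())"


section \<open>Free unital \<open>A(m)\<close>-algebras\<close>

text \<open>
  \<open>tree_algebra m V\<close> is the space with basis the planar trees whose leaves are labelled by
  homogeneous elements of \<open>V\<close> (together with a degree) or by the formal unit, and whose vertices
  have between \<open>1\<close> and \<open>m\<close> inputs; \<open>\<mu>\<^sub>k\<close> is grafting onto a new root, extended multilinearly.
  The free unital \<open>A(m)\<close>-algebra is its quotient by the ideal which makes the labels linear and
  imposes the axioms of unital \<open>A(m)\<close>-algebras.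
\<close>

datatype 'x tree = Leaf int 'x | Unit | Node "'x tree list"

primrec tree_degree :: "'x tree \<Rightarrow> int" where
  "tree_degree (Leaf d x) = d"
| "tree_degree Unit = 0"
| "tree_degree (Node ts) = sum_list (map tree_degree ts) + int (length ts) - 2"

inductive_set trees :: "enat \<Rightarrow> ('k, 'x) gspace \<Rightarrow> 'x tree set"
  for m :: enat and V :: "('k, 'x) gspace" where
  Leaf: "x \<in> homog V d \<Longrightarrow> Leaf d x \<in> trees m V"
| Unit: "Unit \<in> trees m V"
| Node: "arity m (length ts) \<Longrightarrow> \<forall>t\<in>set ts. t \<in> trees m V \<Longrightarrow> Node ts \<in> trees m V"

definition tree_algebra ::
  "enat \<Rightarrow> ('k::field_char_0, 'x) gspace \<Rightarrow> ('k, 'x tree \<Rightarrow>\<^sub>0 'k) amalg" where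
  "tree_algebra m V =
     \<lparr>carrier = {p. Poly_Mapping.keys p \<subseteq> trees m V}, monoid.mult = undefined,
      one = Poly_Mapping.single Unit 1, zero = 0, add = (+),
      module.smult = (\<lambda>c. Poly_Mapping.map ((*) c)),
      homog = (\<lambda>d. {p. Poly_Mapping.keys p \<subseteq> {t \<in> trees m V. tree_degree t = d}}),
      mu = (\<lambda>ps. \<Sum>ts\<in>listset (map Poly_Mapping.keys ps).
              Poly_Mapping.single (Node ts) (prod_list (map2 Poly_Mapping.lookup ps ts)))\<rparr>"

definition leaf :: "int \<Rightarrow> 'x \<Rightarrow> 'x tree \<Rightarrow>\<^sub>0 'k::field_char_0" where
  "leaf d x = Poly_Mapping.single (Leaf d x) 1"

definition free_relations ::
  "enat \<Rightarrow> ('k::field_char_0, 'x) gspace \<Rightarrow> ('x tree \<Rightarrow>\<^sub>0 'k) set" where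
  "free_relations m V =
     (let T = tree_algebra m V in
      {leaf d (x \<oplus>\<^bsub>V\<^esub> y) - leaf d x - leaf d y | d x y. x \<in> homog V d \<and> y \<in> homog V d} \<union>
      {leaf d (c \<odot>\<^bsub>V\<^esub> x) - c \<odot>\<^bsub>T\<^esub> leaf d x | c d x. x \<in> homog V d} \<union>
      {stasheff T ds ps | ds ps. has_degs T ds ps \<and> arity m (length ps)} \<union>
      {mu T [\<one>\<^bsub>T\<^esub>, p] - p | p. p \<in> carrier T \<and> arity m 2} \<union>
      {mu T [p, \<one>\<^bsub>T\<^esub>] - p | p. p \<in> carrier T \<and> arity m 2} \<union>
      {mu T ps | ps. arity m (length ps) \<and> length ps \<noteq> 2 \<and> set ps \<subseteq> carrier T \<and> \<one>\<^bsub>T\<^esub> \<in> set ps})"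

definition free_ideal :: "enat \<Rightarrow> ('k::field_char_0, 'x) gspace \<Rightarrow> ('x tree \<Rightarrow>\<^sub>0 'k) set" where
  "free_ideal m V = am_genideal m (tree_algebra m V) (free_relations m V)"

type_synonym ('k, 'x) free = "('x tree \<Rightarrow>\<^sub>0 'k) set"

definition free_am ::
  "enat \<Rightarrow> ('k::field_char_0, 'x) gspace \<Rightarrow> ('k, ('k, 'x) free) amalg" where
  "free_am m V = am_quot (tree_algebra m V) (free_ideal m V)"

text \<open>The canonical map \<open>V \<rightarrow> \<F>\<^sub>m(V)\<close>.\<close>

definition free_gen ::
  "enat \<Rightarrow> ('k::field_char_0, 'x) gspace \<Rightarrow> 'x \<Rightarrow> ('k, 'x) free" where
  "free_gen m V x =
     (\<Oplus>\<^bsub>free_am m V\<^esub>d\<in>{d. component V x d \<noteq> \<zero>\<^bsub>V\<^esub>}.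
        free_ideal m V +>\<^bsub>tree_algebra m V\<^esub> leaf d (component V x d))"

definition free_map ::
  "enat \<Rightarrow> ('k::field_char_0, 'x) gspace \<Rightarrow> ('k, 'y) gspace \<Rightarrow> ('x \<Rightarrow> 'y) \<Rightarrow>
   ('k, 'x) free \<Rightarrow> ('k, 'y) free" where
  "free_map m V W \<phi> =
     (THE h. am_hom m (free_am m V) (free_am m W) h \<and>
             (\<forall>x\<in>carrier V. h (free_gen m V x) = free_gen m W (\<phi> x)))"


section \<open>Presentations\<close>

text \<open>
  A presentation consists of a graded space \<open>V\<close> of generators and a set \<open>R \<subseteq> \<F>\<^sub>m(V)\<close> of
  relations.  As \<open>\<box>\<close> depends on the presentations of its arguments, the objects of the monoidal
  category are presentations \<open>P\<close>, standing for the algebra \<open>alg m P\<close>; a morphism \<open>P \<rightarrow> Q\<close> is any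
  morphism \<open>alg m P \<rightarrow> alg m Q\<close> of unital \<open>A(m)\<close>-algebras.
\<close>

record (overloaded) ('k, 'x) presentation =
  gens :: "('k, 'x) gspace"
  rels :: "('k, 'x) free set"

type_synonym ('k, 'x) presented = "('k, 'x) free set"

definition rel_ideal ::
  "enat \<Rightarrow> ('k::field_char_0, 'x) presentation \<Rightarrow> ('k, 'x) free set" where
  "rel_ideal m P = am_genideal m (free_am m (gens P)) (rels P)"

definition alg ::
  "enat \<Rightarrow> ('k::field_char_0, 'x) presentation \<Rightarrow> ('k, ('k, 'x) presented) amalg" where
  "alg m P = am_quot (free_am m (gens P)) (rel_ideal m P)"

definition gen ::
  "enat \<Rightarrow> ('k::field_char_0, 'x) presentation \<Rightarrow> 'x \<Rightarrow> ('k, 'x) presented" where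
  "gen m P x = rel_ideal m P +>\<^bsub>free_am m (gens P)\<^esub> free_gen m (gens P) x"

text \<open>The morphism of presented algebras induced by a map of generators.\<close>

definition is_induced ::
  "enat \<Rightarrow> ('k::field_char_0, 'x) presentation \<Rightarrow> ('k, 'y) presentation \<Rightarrow> ('x \<Rightarrow> 'y) \<Rightarrow>
   (('k, 'x) presented \<Rightarrow> ('k, 'y) presented) \<Rightarrow> bool" where
  "is_induced m P Q \<phi> h \<longleftrightarrow>
     am_hom m (alg m P) (alg m Q) h \<and> (\<forall>x\<in>carrier (gens P). h (gen m P x) = gen m Q (\<phi> x))"

definition induces ::
  "enat \<Rightarrow> ('k::field_char_0, 'x) presentation \<Rightarrow> ('k, 'y) presentation \<Rightarrow> ('x \<Rightarrow> 'y) \<Rightarrow> bool" where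
  "induces m P Q \<phi> \<longleftrightarrow> (\<exists>!h. is_induced m P Q \<phi> h)"

definition induced ::
  "enat \<Rightarrow> ('k::field_char_0, 'x) presentation \<Rightarrow> ('k, 'y) presentation \<Rightarrow> ('x \<Rightarrow> 'y) \<Rightarrow>
   ('k, 'x) presented \<Rightarrow> ('k, 'y) presented" where
  "induced m P Q \<phi> = (THE h. is_induced m P Q \<phi> h)"

definition induces_iso ::
  "enat \<Rightarrow> ('k::field_char_0, 'x) presentation \<Rightarrow> ('k, 'y) presentation \<Rightarrow> ('x \<Rightarrow> 'y) \<Rightarrow> bool" where
  "induces_iso m P Q \<phi> \<longleftrightarrow> induces m P Q \<phi> \<and> am_iso m (alg m P) (alg m Q) (induced m P Q \<phi>)"


section \<open>The universal enveloping \<open>A(m)\<close>-algebra\<close>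

definition uea :: "enat \<Rightarrow> ('k::field_char_0, 'v) lalg \<Rightarrow> ('k, 'v) presentation" where
  "uea m L =
     (let V = gspace.truncate L; F = free_am m V in
      \<lparr>gens = V,
       rels = {antisymmetrization F ds (map (free_gen m V) xs) \<ominus>\<^bsub>F\<^esub> free_gen m V (br L xs) | ds xs.
                 has_degs L ds xs \<and> arity m (length xs)}\<rparr>)"

definition uea_map ::
  "enat \<Rightarrow> ('k::field_char_0, 'v) lalg \<Rightarrow> ('k, 'w) lalg \<Rightarrow> ('v \<Rightarrow> 'w) \<Rightarrow>
   ('k, 'v) presented \<Rightarrow> ('k, 'w) presented" where
  "uea_map m L L' \<phi> = induced m (uea m L) (uea m L') \<phi>"

text \<open>The unit object, as a presented algebra; \<open>alg m one_obj\<close> is identified with \<open>ground\<close>.\<close>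

abbreviation one_obj :: "enat \<Rightarrow> ('k::field_char_0, unit) presentation" where
  "one_obj m \<equiv> uea m lzero"

definition augmentation ::
  "enat \<Rightarrow> ('k::field_char_0, 'v) lalg \<Rightarrow> ('k, 'v) presented \<Rightarrow> ('k, unit) presented" where
  "augmentation m L = uea_map m L lzero (to_lzero L)"

definition comult ::
  "enat \<Rightarrow> ('k::field_char_0, 'v) lalg \<Rightarrow> ('k, 'v) presented \<Rightarrow> ('k, 'v \<times> 'v) presented" where
  "comult m L = uea_map m L (lprod L L) (diagonal L)"


section \<open>The operation \<open>\<box>\<close>\<close>

definition inl :: "('k, 'x) gspace \<Rightarrow> ('k, 'y) gspace \<Rightarrow> 'x \<Rightarrow> 'x \<times> 'y" where
  "inl V W x = (x, \<zero>\<^bsub>W\<^esub>)"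

definition inr :: "('k, 'x) gspace \<Rightarrow> ('k, 'y) gspace \<Rightarrow> 'y \<Rightarrow> 'x \<times> 'y" where
  "inr V W y = (\<zero>\<^bsub>V\<^esub>, y)"

definition mixed_relations ::
  "enat \<Rightarrow> ('k::field_char_0, 'x) gspace \<Rightarrow> ('k, 'y) gspace \<Rightarrow> ('k, 'x \<times> 'y) free set" where
  "mixed_relations m V W =
     (let VW = gsum V W; Vl = inl V W ` carrier V; Wr = inr V W ` carrier W in
      {antisymmetrization (free_am m VW) ds (map (free_gen m VW) zs) | ds zs.
         has_degs VW ds zs \<and> arity m (length zs) \<and>
         set zs \<subseteq> Vl \<union> Wr \<and> set zs \<inter> Vl \<noteq> {} \<and> set zs \<inter> Wr \<noteq> {}})"

definition box ::
  "enat \<Rightarrow> ('k::field_char_0, 'x) presentation \<Rightarrow> ('k, 'y) presentation \<Rightarrow>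
   ('k, 'x \<times> 'y) presentation" where
  "box m P Q =
     (let V = gens P; W = gens Q; VW = gsum V W in
      \<lparr>gens = VW,
       rels = free_map m V VW (inl V W) ` rels P \<union> mixed_relations m V W \<union>
              free_map m W VW (inr V W) ` rels Q\<rparr>)"

definition box_inl ::
  "enat \<Rightarrow> ('k::field_char_0, 'x) presentation \<Rightarrow> ('k, 'y) presentation \<Rightarrow>
   ('k, 'x) presented \<Rightarrow> ('k, 'x \<times> 'y) presented" where
  "box_inl m P Q = induced m P (box m P Q) (inl (gens P) (gens Q))"

definition box_inr ::
  "enat \<Rightarrow> ('k::field_char_0, 'x) presentation \<Rightarrow> ('k, 'y) presentation \<Rightarrow>
   ('k, 'y) presented \<Rightarrow> ('k, 'x \<times> 'y) presented" where
  "box_inr m P Q = induced m Q (box m P Q) (inr (gens P) (gens Q))"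

text \<open>
  \<open>f \<box> g : P \<box> Q \<rightarrow> P' \<box> Q'\<close> is the morphism which restricts to \<open>f\<close> and \<open>g\<close> along the canonical
  morphisms from the two factors.
\<close>

definition is_box_map ::
  "enat \<Rightarrow> ('k::field_char_0, 'x) presentation \<Rightarrow> ('k, 'x') presentation \<Rightarrow>
   ('k, 'y) presentation \<Rightarrow> ('k, 'y') presentation \<Rightarrow>
   (('k, 'x) presented \<Rightarrow> ('k, 'x') presented) \<Rightarrow> (('k, 'y) presented \<Rightarrow> ('k, 'y') presented) \<Rightarrow>
   (('k, 'x \<times> 'y) presented \<Rightarrow> ('k, 'x' \<times> 'y') presented) \<Rightarrow> bool" where
  "is_box_map m P P' Q Q' f g h \<longleftrightarrow>
     am_hom m (alg m (box m P Q)) (alg m (box m P' Q')) h \<and>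
     (\<forall>a\<in>carrier (alg m P). h (box_inl m P Q a) = box_inl m P' Q' (f a)) \<and>
     (\<forall>b\<in>carrier (alg m Q). h (box_inr m P Q b) = box_inr m P' Q' (g b))"

definition box_map_exists ::
  "enat \<Rightarrow> ('k::field_char_0, 'x) presentation \<Rightarrow> ('k, 'x') presentation \<Rightarrow>
   ('k, 'y) presentation \<Rightarrow> ('k, 'y') presentation \<Rightarrow>
   (('k, 'x) presented \<Rightarrow> ('k, 'x') presented) \<Rightarrow> (('k, 'y) presented \<Rightarrow> ('k, 'y') presented) \<Rightarrow>
   bool" where
  "box_map_exists m P P' Q Q' f g \<longleftrightarrow> (\<exists>!h. is_box_map m P P' Q Q' f g h)"

definition box_map ::
  "enat \<Rightarrow> ('k::field_char_0, 'x) presentation \<Rightarrow> ('k, 'x') presentation \<Rightarrow>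
   ('k, 'y) presentation \<Rightarrow> ('k, 'y') presentation \<Rightarrow>
   (('k, 'x) presented \<Rightarrow> ('k, 'x') presented) \<Rightarrow> (('k, 'y) presented \<Rightarrow> ('k, 'y') presented) \<Rightarrow>
   ('k, 'x \<times> 'y) presented \<Rightarrow> ('k, 'x' \<times> 'y') presented" where
  "box_map m P P' Q Q' f g = (THE h. is_box_map m P P' Q Q' f g h)"

text \<open>
  The identifications of the (strict) monoidal structure and the symmetry are induced by the
  evident isomorphisms of the spaces of generators.
\<close>

definition assoc_gens :: "('x \<times> 'y) \<times> 'z \<Rightarrow> 'x \<times> ('y \<times> 'z)" where
  "assoc_gens = (\<lambda>((x, y), z). (x, (y, z)))"

definition associator ::
  "enat \<Rightarrow> ('k::field_char_0, 'x) presentation \<Rightarrow> ('k, 'y) presentation \<Rightarrow>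
   ('k, 'z) presentation \<Rightarrow>
   ('k, ('x \<times> 'y) \<times> 'z) presented \<Rightarrow> ('k, 'x \<times> ('y \<times> 'z)) presented" where
  "associator m P Q R = induced m (box m (box m P Q) R) (box m P (box m Q R)) assoc_gens"

definition left_unitor ::
  "enat \<Rightarrow> ('k::field_char_0, 'x) presentation \<Rightarrow>
   ('k, unit \<times> 'x) presented \<Rightarrow> ('k, 'x) presented" where
  "left_unitor m P = induced m (box m (one_obj m) P) P snd"

definition right_unitor ::
  "enat \<Rightarrow> ('k::field_char_0, 'x) presentation \<Rightarrow>
   ('k, 'x \<times> unit) presented \<Rightarrow> ('k, 'x) presented" where
  "right_unitor m P = induced m (box m P (one_obj m)) P fst"

definition symmetry ::
  "enat \<Rightarrow> ('k::field_char_0, 'x) presentation \<Rightarrow> ('k, 'y) presentation \<Rightarrow>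
   ('k, 'x \<times> 'y) presented \<Rightarrow> ('k, 'y \<times> 'x) presented" where
  "symmetry m P Q = induced m (box m P Q) (box m Q P) prod.swap"

text \<open>
  All instances of \<open>\<box>\<close> on morphisms and of the structural isomorphisms that occur in the axioms
  are required to be well defined.
\<close>

definition cocommutative_coalgebra ::
  "enat \<Rightarrow> ('k::field_char_0, 'x) presentation \<Rightarrow>
   (('k, 'x) presented \<Rightarrow> ('k, 'x \<times> 'x) presented) \<Rightarrow>
   (('k, 'x) presented \<Rightarrow> ('k, unit) presented) \<Rightarrow> bool" where
  "cocommutative_coalgebra m C \<Delta> \<epsilon> \<longleftrightarrow>
     (let A = carrier (alg m C); C2 = box m C C; I = one_obj m; idC = (\<lambda>a\<in>A. a) in
        am_hom m (alg m C) (alg m C2) \<Delta> \<and> am_hom m (alg m C) (alg m I) \<epsilon> \<and>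
        induces_iso m (box m C2 C) (box m C C2) assoc_gens \<and>
        induces_iso m (box m I C) C snd \<and>
        induces_iso m (box m C I) C fst \<and>
        induces_iso m C2 C2 prod.swap \<and>
        box_map_exists m C C2 C C \<Delta> idC \<and> box_map_exists m C C C C2 idC \<Delta> \<and>
        box_map_exists m C I C C \<epsilon> idC \<and> box_map_exists m C C C I idC \<epsilon> \<and>
        compose A (associator m C C C) (compose A (box_map m C C2 C C \<Delta> idC) \<Delta>) =
          compose A (box_map m C C C C2 idC \<Delta>) \<Delta> \<and>
        compose A (left_unitor m C) (compose A (box_map m C I C C \<epsilon> idC) \<Delta>) = idC \<and>
        compose A (right_unitor m C) (compose A (box_map m C C C I idC \<epsilon>) \<Delta>) = idC \<and>
        compose A (symmetry m C C) \<Delta> = \<Delta>)"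

end

theory Submission
  imports Defs
begin

text \<open>
  A presentation enters \<open>\<box>\<close> only through its generators and the ideal spanned by its relations,
  because the preimage of an ideal under a morphism is an ideal.  Expanding the relations of
  \<open>\<U>\<^sub>m(L' \<times> L'')\<close> multilinearly along \<open>(x, y) = (x, 0) + (0, y)\<close> shows that they generate the same
  ideal as those of \<open>\<U>\<^sub>m(L') \<box> \<U>\<^sub>m(L'')\<close>.  Hence every \<open>\<box>\<close>-product in the coalgebra axioms is the
  enveloping algebra of a product of copies of \<open>L\<close> and \<open>0\<close>, every morphism in them is induced by a
  morphism of \<open>L(m)\<close>-algebras, and the axioms follow by functoriality from the evident identities
  for the diagonal of \<open>L\<close>.
\<close>

section \<open>Graded spaces\<close>

text \<open>Two obstacles shape the proof. The first is that an element need not determine its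
  degree: zero has every degree, so leaves, signs and relations carry explicit degree lists, and the
  expansion along the two summands has to run over pairs of a degree and an element, with the degree
  of each slot held fixed. The second is that \<open>box\<close> is not visibly functorial:
  \<open>is_box_map\<close> asks for a morphism with prescribed restrictions to the two factors, but
  an arbitrary morphism of algebras may send generators to non-generators, and then nothing forces
  the mixed relations to be respected. Existence of \<open>box_map\<close> is therefore proved for
  pairs of morphisms induced by maps of generators; the comultiplication, the counit and the
  identity are of this kind. Comparing ideals, instead of constructing isomorphisms, keeps the
  algebras literally equal, so a map into the enveloping algebra of the product already is a map
  into the box.\<close>

lemma ring_of_type_algebra_simps [simp]:
  "carrier (ring_of_type_algebra :: 'k::field_char_0 ring) = UNIV"
  "a \<oplus>\<^bsub>ring_of_type_algebra :: 'k ring\<^esub> b = a + b"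
  "a \<otimes>\<^bsub>ring_of_type_algebra :: 'k ring\<^esub> b = a * b"
  "\<zero>\<^bsub>ring_of_type_algebra :: 'k ring\<^esub> = 0"
  "\<one>\<^bsub>ring_of_type_algebra :: 'k ring\<^esub> = 1"
  by (auto simp: ring_of_type_algebra_def)

lemma a_inv_ring_of_type_algebra [simp]:
  "\<ominus>\<^bsub>ring_of_type_algebra :: 'k::field_char_0 ring\<^esub> a = - a"
proof -
  interpret cring "ring_of_type_algebra :: 'k ring"
    by (rule cring_from_type_algebra)
  show ?thesis
    by (rule minus_equality) auto
qed

text \<open>In a module negation is scaling by -1, so closure under negatives comes with closure
  under scalars.\<close>

lemma submodule_iff:
  assumes "module (ring_of_type_algebra :: 'k::field_char_0 ring) V"
  shows "submodule W (ring_of_type_algebra :: 'k ring) V \<longleftrightarrow>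
    W \<subseteq> carrier V \<and> \<zero>\<^bsub>V\<^esub> \<in> W \<and> (\<forall>x\<in>W. \<forall>y\<in>W. x \<oplus>\<^bsub>V\<^esub> y \<in> W) \<and> (\<forall>c. \<forall>x\<in>W. c \<odot>\<^bsub>V\<^esub> x \<in> W)"
proof -
  interpret module "ring_of_type_algebra :: 'k ring" V
    by fact
  have neg: "\<ominus>\<^bsub>V\<^esub> x = (- 1) \<odot>\<^bsub>V\<^esub> x" if "x \<in> carrier V" for x
    using smult_l_minus[of 1 x] smult_one[of x] that by simp
  show ?thesis
  proof
    assume W: "submodule W ring_of_type_algebra V"
    interpret submodule W "ring_of_type_algebra :: 'k ring" V
      by fact
    show "W \<subseteq> carrier V \<and> \<zero>\<^bsub>V\<^esub> \<in> W \<and> (\<forall>x\<in>W. \<forall>y\<in>W. x \<oplus>\<^bsub>V\<^esub> y \<in> W) \<and> (\<forall>c. \<forall>x\<in>W. c \<odot>\<^bsub>V\<^esub> x \<in> W)"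
      using subset m_closed one_closed submodule.smult_closed[OF W] by simp
  next
    assume W: "W \<subseteq> carrier V \<and> \<zero>\<^bsub>V\<^esub> \<in> W \<and> (\<forall>x\<in>W. \<forall>y\<in>W. x \<oplus>\<^bsub>V\<^esub> y \<in> W) \<and>
      (\<forall>c. \<forall>x\<in>W. c \<odot>\<^bsub>V\<^esub> x \<in> W)"
    then show "submodule W ring_of_type_algebra V"
      by (intro submoduleI) (auto simp: neg subset_iff)
  qed
qed

text \<open>Inverses come from the scalars: distributivity gives (-1) x + 1 x = 0 x, which
  \<open>null\<close> makes zero, so (-1) x is the inverse of x.\<close>

lemma module_ring_of_typeI:
  fixes V :: "('k::field_char_0, 'v, 'z) module_scheme" (structure)
  assumes "\<And>x y. x \<in> carrier V \<Longrightarrow> y \<in> carrier V \<Longrightarrow> x \<oplus> y \<in> carrier V" "\<zero> \<in> carrier V"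
    and "\<And>x y z. x \<in> carrier V \<Longrightarrow> y \<in> carrier V \<Longrightarrow> z \<in> carrier V \<Longrightarrow> (x \<oplus> y) \<oplus> z = x \<oplus> (y \<oplus> z)"
    and "\<And>x y. x \<in> carrier V \<Longrightarrow> y \<in> carrier V \<Longrightarrow> x \<oplus> y = y \<oplus> x"
    and "\<And>x. x \<in> carrier V \<Longrightarrow> \<zero> \<oplus> x = x"
    and "\<And>c x. x \<in> carrier V \<Longrightarrow> c \<odot> x \<in> carrier V"
    and distl: "\<And>a b x. x \<in> carrier V \<Longrightarrow> (a + b) \<odot> x = a \<odot> x \<oplus> b \<odot> x"
    and "\<And>a x y. x \<in> carrier V \<Longrightarrow> y \<in> carrier V \<Longrightarrow> a \<odot> (x \<oplus> y) = a \<odot> x \<oplus> a \<odot> y"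
    and "\<And>a b x. x \<in> carrier V \<Longrightarrow> (a * b) \<odot> x = a \<odot> (b \<odot> x)"
    and one: "\<And>x. x \<in> carrier V \<Longrightarrow> 1 \<odot> x = x"
    and null: "\<And>x. x \<in> carrier V \<Longrightarrow> 0 \<odot> x = \<zero>"
  shows "module (ring_of_type_algebra :: 'k ring) V"
proof (rule moduleI)
  show "cring (ring_of_type_algebra :: 'k ring)"
    by (rule cring_from_type_algebra)
  show "abelian_group V"
  proof (rule abelian_groupI)
    fix x assume "x \<in> carrier V"
    then show "\<exists>y\<in>carrier V. y \<oplus> x = \<zero>"
      using distl[of x "- 1" 1] one null assms(6) by (intro bexI[of _ "(- 1) \<odot> x"]) auto
  qed (use assms in auto)
qed (use assms in auto)

text \<open>\<open>is_decomposition\<close> sums over the exact support of the family. Combining two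
  decompositions needs a common index set, so any finite set containing the support is allowed to
  serve.\<close>

lemma is_decomposition_iff:
  assumes "abelian_monoid V" and "\<And>d. homog V d \<subseteq> carrier V"
    and "finite D" and "\<And>d. d \<notin> D \<Longrightarrow> c d = \<zero>\<^bsub>V\<^esub>"
  shows "is_decomposition V v c \<longleftrightarrow> (\<forall>d. c d \<in> homog V d) \<and> v = (\<Oplus>\<^bsub>V\<^esub>d\<in>D. c d)"
proof -
  interpret abelian_monoid V by fact
  have sub: "{d. c d \<noteq> \<zero>\<^bsub>V\<^esub>} \<subseteq> D"
    using assms(4) by auto
  have "(\<Oplus>\<^bsub>V\<^esub>d\<in>{d. c d \<noteq> \<zero>\<^bsub>V\<^esub>}. c d) = (\<Oplus>\<^bsub>V\<^esub>d\<in>D. c d)" if "\<forall>d. c d \<in> homog V d"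
    by (rule add.finprod_mono_neutral_cong_left[OF assms(3) sub]) (use that assms(2) in auto)
  then show ?thesis
    unfolding is_decomposition_def using finite_subset[OF sub assms(3)] by auto
qed

text \<open>A family of linear projections onto the homogeneous parts gives existence and uniqueness of
  decompositions at once.\<close>

lemma graded_spaceI:
  fixes V :: "('k::field_char_0, 'v, 'z) gspace_scheme" (structure)
  assumes V: "module (ring_of_type_algebra :: 'k ring) V"
    and sub: "\<And>d. homog V d \<subseteq> carrier V" and zero_homog: "\<And>d. \<zero> \<in> homog V d"
    and "\<And>d x y. x \<in> homog V d \<Longrightarrow> y \<in> homog V d \<Longrightarrow> x \<oplus> y \<in> homog V d"
    and "\<And>d c x. x \<in> homog V d \<Longrightarrow> c \<odot> x \<in> homog V d"
    and p_homog: "\<And>v d. v \<in> carrier V \<Longrightarrow> p v d \<in> homog V d"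
    and p_finite: "\<And>v. v \<in> carrier V \<Longrightarrow> finite {d. p v d \<noteq> \<zero>}"
    and p_sum: "\<And>v. v \<in> carrier V \<Longrightarrow> v = (\<Oplus>d\<in>{d. p v d \<noteq> \<zero>}. p v d)"
    and p_add: "\<And>x y d. x \<in> carrier V \<Longrightarrow> y \<in> carrier V \<Longrightarrow> p (x \<oplus> y) d = p x d \<oplus> p y d"
    and p_id: "\<And>x d e. x \<in> homog V d \<Longrightarrow> p x e = (if e = d then x else \<zero>)"
  shows "graded_space V"
proof -
  interpret module "ring_of_type_algebra :: 'k ring" V by fact
  have p_zero: "p \<zero> d = \<zero>" for d
    using p_id[OF zero_homog, of d d] by simp
  have p_finsum: "p (\<Oplus>e\<in>D. c e) d = (\<Oplus>e\<in>D. p (c e) d)" if "finite D" "c \<in> D \<rightarrow> carrier V" for D c d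
  proof -
    have "p v d \<in> carrier V" if "v \<in> carrier V" for v
      using p_homog sub that by auto
    with that show ?thesis
      by (induction D) (auto simp: p_zero p_add Pi_iff)
  qed
  have ex: "is_decomposition V v (p v)" if "v \<in> carrier V" for v
    using p_homog p_finite p_sum that unfolding is_decomposition_def by auto
  have uniq: "c = p v" if c: "is_decomposition V v c" for v c
  proof
    fix d
    \<comment> \<open>\<open>d\<close> is inserted so that it indexes a summand even when
      \<open>c d\<close> is zero; the sum of the projections then collapses to
      \<open>c d\<close>.\<close>
    define D where "D = insert d {d. c d \<noteq> \<zero>}"
    have D: "finite D" and ch: "c d \<in> homog V d" for d
      using c by (auto simp: D_def is_decomposition_def)
    have v: "v = (\<Oplus>d\<in>D. c d)"
      using c is_decomposition_iff[OF abelian_monoid_axioms sub D, of c v] by (auto simp: D_def)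
    have "p v d = (\<Oplus>e\<in>D. p (c e) d)"
      unfolding v by (rule p_finsum) (use D ch sub in auto)
    also have "\<dots> = (\<Oplus>e\<in>D. if d = e then c e else \<zero>)"
      using p_id[OF ch] subsetD[OF sub ch] by (intro finsum_cong') auto
    also have "\<dots> = c d"
      by (rule finsum_singleton) (use D ch sub in \<open>auto simp: D_def\<close>)
    finally show "c d = p v d" by simp
  qed
  show "graded_space V"
  proof (intro graded_space.intro[OF V] graded_space_axioms.intro)
    show "submodule (homog V d) (ring_of_type_algebra :: 'k ring) V" for d
      unfolding submodule_iff[OF V] using assms by auto
    show "\<exists>!c. is_decomposition V v c" if "v \<in> carrier V" for v
      using ex[OF that] uniq by auto
  qed
qed

section \<open>Scalars, components and graded subspaces\<close>

context graded_space
begin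

lemma module_axiom: "module (ring_of_type_algebra :: 'k ring) V"
  by (rule module_axioms)

lemma smult_carrier [simp, intro]: "x \<in> carrier V \<Longrightarrow> c \<odot> x \<in> carrier V"
  by (rule smult_closed) auto

lemma smult_add_left: "x \<in> carrier V \<Longrightarrow> (a + b) \<odot> x = a \<odot> x \<oplus> b \<odot> x"
  using smult_l_distr[of a b x] by simp

lemma smult_add_right: "x \<in> carrier V \<Longrightarrow> y \<in> carrier V \<Longrightarrow> a \<odot> (x \<oplus> y) = a \<odot> x \<oplus> a \<odot> y"
  using smult_r_distr[of a x y] by simp

lemma smult_smult: "x \<in> carrier V \<Longrightarrow> a \<odot> (b \<odot> x) = (a * b) \<odot> x"
  using smult_assoc1[of a b x] by simp

lemma smult_1 [simp]: "x \<in> carrier V \<Longrightarrow> 1 \<odot> x = x"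
  using smult_one[of x] by simp

lemma smult_0 [simp]: "x \<in> carrier V \<Longrightarrow> 0 \<odot> x = \<zero>"
  using smult_l_null[of x] by simp

lemma smult_zero [simp]: "a \<odot> \<zero> = \<zero>"
  using smult_r_null[of a] by simp

lemma minus_eq_smult: "x \<in> carrier V \<Longrightarrow> \<ominus> x = (- 1) \<odot> x"
  using smult_l_minus[of 1 x] by simp

lemma homog_carrier: "x \<in> homog V d \<Longrightarrow> x \<in> carrier V"
  and homog_zero [simp, intro]: "\<zero> \<in> homog V d"
  and homog_add: "x \<in> homog V d \<Longrightarrow> y \<in> homog V d \<Longrightarrow> x \<oplus> y \<in> homog V d"
  and homog_smult: "x \<in> homog V d \<Longrightarrow> c \<odot> x \<in> homog V d"
  using homog_submodule[of d] by (auto simp: submodule_iff[OF module_axiom])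

lemma homog_subset: "homog V d \<subseteq> carrier V"
  using homog_carrier by auto

lemma finsum_smult:
  assumes "f \<in> D \<rightarrow> carrier V"
  shows "c \<odot> (\<Oplus>i\<in>D. f i) = (\<Oplus>i\<in>D. c \<odot> f i)"
proof (cases "finite D")
  case True
  then show ?thesis
    using finsum_smult_ldistr[of D c f] assms by simp
qed auto

lemma homog_finsum: "(\<And>i. i \<in> D \<Longrightarrow> f i \<in> homog V d) \<Longrightarrow> (\<Oplus>i\<in>D. f i) \<in> homog V d"
proof (induction D rule: infinite_finite_induct)
  case (insert x F)
  then have "f \<in> F \<rightarrow> carrier V" "f x \<in> carrier V"
    using homog_carrier by auto
  with insert show ?case
    by (simp add: homog_add)
qed auto

lemma component_decomposition:
  "v \<in> carrier V \<Longrightarrow> is_decomposition V v (component V v)"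
  unfolding component_def by (rule theI'[OF decomposition])

lemma component_homog: "v \<in> carrier V \<Longrightarrow> component V v d \<in> homog V d"
  and component_finite: "v \<in> carrier V \<Longrightarrow> finite {d. component V v d \<noteq> \<zero>}"
  and component_sum: "v \<in> carrier V \<Longrightarrow> (\<Oplus>d\<in>{d. component V v d \<noteq> \<zero>}. component V v d) = v"
  using component_decomposition[of v] by (auto simp: is_decomposition_def)

lemma component_carrier: "v \<in> carrier V \<Longrightarrow> component V v d \<in> carrier V"
  using component_homog homog_carrier by blast

lemma component_sum_superset:
  assumes "v \<in> carrier V" "finite D" "{d. component V v d \<noteq> \<zero>} \<subseteq> D"
  shows "(\<Oplus>d\<in>D. component V v d) = v"
proof -
  have "component V v d = \<zero>" if "d \<notin> D" for d
    using assms(3) that by auto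
  then show ?thesis
    using is_decomposition_iff[OF abelian_monoid_axioms homog_subset assms(2), of "component V v" v]
      component_decomposition[OF assms(1)] by auto
qed

text \<open>By uniqueness of decompositions, any finite homogeneous expansion is the family of
  components. Additivity, homogeneity and compatibility with maps are all obtained by exhibiting
  such an expansion.\<close>

lemma component_unique:
  assumes "finite D" "\<And>d. c d \<in> homog V d" "\<And>d. d \<notin> D \<Longrightarrow> c d = \<zero>"
  shows "component V (\<Oplus>d\<in>D. c d) = c"
proof -
  have "is_decomposition V (\<Oplus>d\<in>D. c d) c"
    using is_decomposition_iff[OF abelian_monoid_axioms homog_subset assms(1,3)] assms(2) by auto
  moreover have "(\<Oplus>d\<in>D. c d) \<in> carrier V"
    using assms(2) homog_carrier by (intro finsum_closed) auto
  ultimately show ?thesis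
    using decomposition component_decomposition by blast
qed

lemma component_homog_eq:
  assumes "x \<in> homog V d"
  shows "component V x = (\<lambda>e. if e = d then x else \<zero>)"
  using component_unique[of "{d}" "\<lambda>e. if e = d then x else \<zero>"] assms homog_carrier by auto

lemma component_add:
  assumes "x \<in> carrier V" "y \<in> carrier V"
  shows "component V (x \<oplus> y) d = component V x d \<oplus> component V y d"
proof -
  let ?D = "{d. component V x d \<noteq> \<zero>} \<union> {d. component V y d \<noteq> \<zero>}"
  have D: "finite ?D" using component_finite assms by auto
  have "x \<oplus> y = (\<Oplus>d\<in>?D. component V x d) \<oplus> (\<Oplus>d\<in>?D. component V y d)"
    using component_sum_superset[OF _ D] assms by auto
  also have "\<dots> = (\<Oplus>d\<in>?D. component V x d \<oplus> component V y d)"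
    using component_carrier assms by (intro finsum_addf[symmetric]) auto
  also have "component V \<dots> = (\<lambda>d. component V x d \<oplus> component V y d)"
    by (rule component_unique[OF D]) (use component_homog assms in \<open>auto intro: homog_add\<close>)
  finally show ?thesis by simp
qed

lemma component_smult:
  assumes "x \<in> carrier V"
  shows "component V (c \<odot> x) d = c \<odot> component V x d"
proof -
  let ?D = "{d. component V x d \<noteq> \<zero>}"
  have D: "finite ?D" using component_finite assms by auto
  have "c \<odot> x = (\<Oplus>d\<in>?D. c \<odot> component V x d)"
    using component_carrier assms by (subst finsum_smult[symmetric]) (auto simp: component_sum)
  also have "component V \<dots> = (\<lambda>d. c \<odot> component V x d)"
    by (rule component_unique[OF D]) (use component_homog assms in \<open>auto intro: homog_smult\<close>)
  finally show ?thesis by simp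
qed

lemma graded_subspace_iff:
  "graded_subspace V W \<longleftrightarrow>
    W \<subseteq> carrier V \<and> \<zero> \<in> W \<and> (\<forall>x\<in>W. \<forall>y\<in>W. x \<oplus> y \<in> W) \<and> (\<forall>c. \<forall>x\<in>W. c \<odot> x \<in> W) \<and>
    (\<forall>w\<in>W. \<forall>d. component V w d \<in> W)"
  unfolding graded_subspace_def submodule_iff[OF module_axiom] by auto

lemma graded_subspaceD:
  assumes "graded_subspace V W"
  shows "W \<subseteq> carrier V" "\<zero> \<in> W" "\<And>x y. x \<in> W \<Longrightarrow> y \<in> W \<Longrightarrow> x \<oplus> y \<in> W"
    "\<And>c x. x \<in> W \<Longrightarrow> c \<odot> x \<in> W" "\<And>x d. x \<in> W \<Longrightarrow> component V x d \<in> W"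
    "\<And>x. x \<in> W \<Longrightarrow> \<ominus> x \<in> W" "\<And>x y. x \<in> W \<Longrightarrow> y \<in> W \<Longrightarrow> x \<ominus> y \<in> W"
proof -
  note W = assms[unfolded graded_subspace_iff]
  show "W \<subseteq> carrier V" "\<zero> \<in> W" "\<And>x y. x \<in> W \<Longrightarrow> y \<in> W \<Longrightarrow> x \<oplus> y \<in> W"
    "\<And>c x. x \<in> W \<Longrightarrow> c \<odot> x \<in> W" "\<And>x d. x \<in> W \<Longrightarrow> component V x d \<in> W"
    using W by auto
  show neg: "\<ominus> x \<in> W" if "x \<in> W" for x
    using W that minus_eq_smult[of x] by auto
  show "x \<ominus> y \<in> W" if "x \<in> W" "y \<in> W" for x y
    using W neg that unfolding a_minus_def by auto
qed

lemma has_degs_carrier: "has_degs V ds xs \<Longrightarrow> set xs \<subseteq> carrier V"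
  unfolding has_degs_def by (induction rule: list_all2_induct) (auto simp: homog_carrier)

end

lemma has_degs_length: "has_degs V ds xs \<Longrightarrow> length ds = length xs"
  unfolding has_degs_def by (rule list_all2_lengthD)

lemma has_degs_simps [simp]:
  "has_degs V [] xs \<longleftrightarrow> xs = []" "has_degs V ds [] \<longleftrightarrow> ds = []"
  "has_degs V (d # ds) (x # xs) \<longleftrightarrow> x \<in> homog V d \<and> has_degs V ds xs"
  unfolding has_degs_def by auto

text \<open>The tree algebra and the ground field add by the addition of their types, and sums of a
  type are easier to evaluate.\<close>

lemma finsum_eq_sum:
  assumes "abelian_monoid G" "f \<in> D \<rightarrow> carrier G"
    and "\<zero>\<^bsub>G\<^esub> = 0" "\<And>x y. x \<oplus>\<^bsub>G\<^esub> y = x + y"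
  shows "finsum G f D = sum f D"
proof -
  interpret abelian_monoid G by fact
  show ?thesis
    using assms(2-) by (induction D rule: infinite_finite_induct) (auto simp: Pi_iff)
qed


section \<open>Linear maps of degree zero\<close>

locale graded_map = V: graded_space V + W: graded_space W
  for V :: "('k::field_char_0, 'v, 'y) gspace_scheme"
    and W :: "('k::field_char_0, 'w, 'z) gspace_scheme" and f +
  assumes linear0: "linear0 V W f"
begin

lemma closed [simp, intro]: "x \<in> carrier V \<Longrightarrow> f x \<in> carrier W"
  and extensional: "f \<in> extensional (carrier V)"
  and add: "x \<in> carrier V \<Longrightarrow> y \<in> carrier V \<Longrightarrow> f (x \<oplus>\<^bsub>V\<^esub> y) = f x \<oplus>\<^bsub>W\<^esub> f y"
  and smult: "x \<in> carrier V \<Longrightarrow> f (c \<odot>\<^bsub>V\<^esub> x) = c \<odot>\<^bsub>W\<^esub> f x"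
  and homog: "x \<in> homog V d \<Longrightarrow> f x \<in> homog W d"
  using linear0 by (auto simp: linear0_def PiE_def image_subset_iff)

lemma map_carrier: "set xs \<subseteq> carrier V \<Longrightarrow> set (map f xs) \<subseteq> carrier W"
  by auto

lemma zero [simp]: "f \<zero>\<^bsub>V\<^esub> = \<zero>\<^bsub>W\<^esub>"
  using smult[of "\<zero>\<^bsub>V\<^esub>" 0] by simp

lemma minus: "x \<in> carrier V \<Longrightarrow> f (\<ominus>\<^bsub>V\<^esub> x) = \<ominus>\<^bsub>W\<^esub> f x"
  by (simp add: V.minus_eq_smult W.minus_eq_smult smult)

lemma diff: "x \<in> carrier V \<Longrightarrow> y \<in> carrier V \<Longrightarrow> f (x \<ominus>\<^bsub>V\<^esub> y) = f x \<ominus>\<^bsub>W\<^esub> f y"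
  by (simp add: a_minus_def add minus)

lemma finsum: "g \<in> D \<rightarrow> carrier V \<Longrightarrow> f (finsum V g D) = finsum W (\<lambda>i. f (g i)) D"
  by (induction D rule: infinite_finite_induct) (auto simp: Pi_iff add)

text \<open>Applying f to the decomposition of x gives a decomposition of \<open>f x\<close>, since
  degrees are kept. This is what makes the preimage of a graded subspace graded.\<close>

lemma component:
  assumes "x \<in> carrier V"
  shows "component W (f x) d = f (component V x d)"
proof -
  let ?D = "{d. component V x d \<noteq> \<zero>\<^bsub>V\<^esub>}"
  have D: "finite ?D" using V.component_finite assms by auto
  have "f x = f (\<Oplus>\<^bsub>V\<^esub>d\<in>?D. component V x d)"
    using assms V.component_sum by simp
  also have "\<dots> = (\<Oplus>\<^bsub>W\<^esub>d\<in>?D. f (component V x d))"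
    by (rule finsum) (use V.component_carrier assms in auto)
  also have "component W \<dots> = (\<lambda>d. f (component V x d))"
    by (rule W.component_unique[OF D]) (use V.component_homog assms homog in auto)
  finally show ?thesis by simp
qed

lemma has_degs: "has_degs V ds xs \<Longrightarrow> has_degs W ds (map f xs)"
  unfolding has_degs_def by (auto simp: list_all2_conv_all_nth homog)

end

lemma linear0I:
  assumes "\<And>x. x \<in> carrier V \<Longrightarrow> f x \<in> carrier W" "f \<in> extensional (carrier V)"
    "\<And>x y. x \<in> carrier V \<Longrightarrow> y \<in> carrier V \<Longrightarrow> f (x \<oplus>\<^bsub>V\<^esub> y) = f x \<oplus>\<^bsub>W\<^esub> f y"
    "\<And>a x. x \<in> carrier V \<Longrightarrow> f (a \<odot>\<^bsub>V\<^esub> x) = a \<odot>\<^bsub>W\<^esub> f x"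
    "\<And>d x. x \<in> homog V d \<Longrightarrow> f x \<in> homog W d"
  shows "linear0 V W f"
  using assms unfolding linear0_def by (auto simp: PiE_iff)

lemma linear0_compose:
  assumes "graded_space U" "linear0 U V f" "linear0 V W g"
  shows "linear0 U W (compose (carrier U) g f)"
proof -
  interpret U: graded_space U by fact
  show ?thesis
    using assms(2,3) unfolding linear0_def
    by (auto simp: compose_def PiE_iff image_subset_iff U.homog_carrier)
qed

lemma linear0_id:
  assumes "graded_space V" shows "linear0 V V (\<lambda>x\<in>carrier V. x)"
proof -
  interpret graded_space V by fact
  show ?thesis
    by (rule linear0I) (auto simp: homog_carrier)
qed


section \<open>Lists of arguments\<close>

text \<open>Extension by multilinearity as an induction rule: what passes from S to C in any one
  slot passes from lists over S to lists over C. Slots to the left of the active one are arbitrary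
  and those to its right are still in S, so the proof peels the arbitrary prefix from its
  end.\<close>

lemma slotwise_induct:
  assumes base: "\<And>xs. set xs \<subseteq> S \<Longrightarrow> length xs = n \<Longrightarrow> Q xs"
    and step: "\<And>xs x ys. set xs \<subseteq> C \<Longrightarrow> x \<in> C \<Longrightarrow> set ys \<subseteq> S \<Longrightarrow> length xs + 1 + length ys = n \<Longrightarrow>
      (\<And>s. s \<in> S \<Longrightarrow> Q (xs @ s # ys)) \<Longrightarrow> Q (xs @ x # ys)"
    and "set xs \<subseteq> C" "length xs = n"
  shows "Q xs"
proof -
  have "Q (xs @ ys)" if "set xs \<subseteq> C" "set ys \<subseteq> S" "length xs + length ys = n" for xs ys
    using that
  proof (induction xs arbitrary: ys rule: rev_induct)
    case Nil
    then show ?case using base by simp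
  next
    case (snoc x xs)
    have "Q (xs @ x # ys)"
    proof (rule step)
      fix s assume "s \<in> S"
      then show "Q (xs @ s # ys)"
        using snoc.IH[of "s # ys"] snoc.prems by simp
    qed (use snoc.prems in auto)
    then show ?case by simp
  qed
  from this[of xs "[]"] show ?thesis using assms by simp
qed

text \<open>Wherever a permutation takes the slot of x, the other entries of the permuted list do
  not depend on x. This lets one-slot linearity of \<open>mu\<close> pass to
  antisymmetrizations.\<close>

lemma permute_list_slot:
  assumes s: "s permutes {..<length xs + 1 + length ys}"
  obtains us vs where "\<And>x. permute_list s (xs @ x # ys) = us @ x # vs"
    "set us \<union> set vs \<subseteq> set xs \<union> set ys" "length us + 1 + length vs = length xs + 1 + length ys"
proof -
  let ?n = "length xs + 1 + length ys"
  \<comment> \<open>The new position of x: \<open>permute_list\<close> puts entry \<open>s i\<close>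
    at place i, so j is the preimage of \<open>length xs\<close>.\<close>
  define j where "j = inv_into UNIV s (length xs)"
  have sj: "s j = length xs"
    unfolding j_def by (rule permutes_inverses[OF s])
  have j: "j < ?n"
    using sj permutes_in_image[OF s, of j] by auto
  have ne: "s i \<noteq> length xs" if "i \<noteq> j" for i
    using that sj permutes_inj[OF s] by (metis injD)
  \<comment> \<open>The entry at a place i other than j. Indices beyond x are shifted by one because
    x sits at \<open>length xs\<close>.\<close>
  define e where "e = (\<lambda>i. if s i < length xs then xs ! s i else ys ! (s i - Suc (length xs)))"
  define us vs where "us = map e [0..<j]" and "vs = map e [Suc j..<?n]"
  have split: "[0..<?n] = [0..<j] @ j # [Suc j..<?n]"
    using j by (metis less_imp_le_nat upt_add_eq_append upt_conv_Cons zero_le le_add_diff_inverse)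
  have e: "(xs @ x # ys) ! s i = e i" if "i \<noteq> j" for x i
    using ne[OF that] by (auto simp: e_def nth_append nth_Cons' )
  have perm: "permute_list s (xs @ x # ys) = us @ x # vs" for x
  proof -
    have "permute_list s (xs @ x # ys) = map (\<lambda>i. (xs @ x # ys) ! s i) [0..<?n]"
      by (simp add: permute_list_def)
    also have "\<dots> = us @ x # vs"
      unfolding split us_def vs_def using e by (auto simp: sj)
    finally show ?thesis .
  qed
  have mem: "e i \<in> set xs \<union> set ys" if "i < ?n" "i \<noteq> j" for i
  proof -
    have "s i < ?n" "s i \<noteq> length xs"
      using ne[OF that(2)] permutes_in_image[OF s, of i] that(1) by auto
    then show ?thesis by (auto simp: e_def intro!: nth_mem)
  qed
  show thesis
  proof
    show "permute_list s (xs @ x # ys) = us @ x # vs" for x by (rule perm)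
    show "set us \<union> set vs \<subseteq> set xs \<union> set ys"
    proof -
      have "set us \<union> set vs = e ` ({..<j} \<union> {Suc j..<?n})"
        by (auto simp: us_def vs_def simp del: upt_Suc)
      moreover have "e i \<in> set xs \<union> set ys" if "i \<in> {..<j} \<union> {Suc j..<?n}" for i
        using that j by (intro mem) auto
      ultimately show ?thesis
        by (simp only: image_subset_iff) blast
    qed
    show "length us + 1 + length vs = ?n"
      using j by (auto simp: us_def vs_def)
  qed
qed

context graded_space
begin

lemma operations_closed:
  "graded_operations m V f \<Longrightarrow> set xs \<subseteq> carrier V \<Longrightarrow> arity m (length xs) \<Longrightarrow> f xs \<in> carrier V"
  unfolding graded_operations_def by blast

lemma operations_add:
  "graded_operations m V f \<Longrightarrow> set xs \<subseteq> carrier V \<Longrightarrow> set zs \<subseteq> carrier V \<Longrightarrow> x \<in> carrier V \<Longrightarrow>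
    y \<in> carrier V \<Longrightarrow> arity m (length xs + 1 + length zs) \<Longrightarrow>
    f (xs @ (x \<oplus> y) # zs) = f (xs @ x # zs) \<oplus> f (xs @ y # zs)"
  unfolding graded_operations_def by auto

lemma operations_smult:
  "graded_operations m V f \<Longrightarrow> set xs \<subseteq> carrier V \<Longrightarrow> set zs \<subseteq> carrier V \<Longrightarrow> x \<in> carrier V \<Longrightarrow>
    arity m (length xs + 1 + length zs) \<Longrightarrow> f (xs @ (a \<odot> x) # zs) = a \<odot> f (xs @ x # zs)"
  unfolding graded_operations_def by auto

lemma operations_homog:
  "graded_operations m V f \<Longrightarrow> has_degs V ds xs \<Longrightarrow> arity m (length xs) \<Longrightarrow>
    f xs \<in> homog V (sum_list ds + int (length xs) - 2)"
  unfolding graded_operations_def by auto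

lemma operations_zero:
  assumes f: "graded_operations m V f" and xs: "set xs \<subseteq> carrier V" "\<zero> \<in> set xs" "arity m (length xs)"
  shows "f xs = \<zero>"
proof -
  obtain us vs where x: "xs = us @ \<zero> # vs"
    using split_list[OF xs(2)] by auto
  have "f (us @ (0 \<odot> \<zero>) # vs) = 0 \<odot> f (us @ \<zero> # vs)"
    by (rule operations_smult[OF f]) (use xs x in auto)
  moreover have "f (us @ \<zero> # vs) \<in> carrier V"
    by (rule operations_closed[OF f]) (use xs x in auto)
  ultimately show ?thesis using x by simp
qed

end


section \<open>Direct sums and truncation\<close>

lemma gsum_simps [simp]:
  "carrier (gsum V W) = carrier V \<times> carrier W" "\<zero>\<^bsub>gsum V W\<^esub> = (\<zero>\<^bsub>V\<^esub>, \<zero>\<^bsub>W\<^esub>)"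
  "(x, y) \<oplus>\<^bsub>gsum V W\<^esub> (x', y') = (x \<oplus>\<^bsub>V\<^esub> x', y \<oplus>\<^bsub>W\<^esub> y')"
  "c \<odot>\<^bsub>gsum V W\<^esub> (x, y) = (c \<odot>\<^bsub>V\<^esub> x, c \<odot>\<^bsub>W\<^esub> y)"
  "homog (gsum V W) d = homog V d \<times> homog W d"
  by (auto simp: gsum_def)

lemma module_gsum:
  assumes "graded_space V" "graded_space W"
  shows "module ring_of_type_algebra (gsum V W)"
proof -
  interpret V: graded_space V by fact
  interpret W: graded_space W by fact
  show ?thesis
    by (rule module_ring_of_typeI)
      (auto simp: V.a_assoc W.a_assoc V.smult_add_left W.smult_add_left V.smult_add_right
        W.smult_add_right V.smult_smult W.smult_smult intro: V.a_comm W.a_comm)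
qed

lemma finsum_gsum:
  assumes "graded_space V" "graded_space W" "f \<in> D \<rightarrow> carrier V \<times> carrier W"
  shows "finsum (gsum V W) f D = (finsum V (\<lambda>i. fst (f i)) D, finsum W (\<lambda>i. snd (f i)) D)"
proof -
  interpret V: graded_space V by fact
  interpret W: graded_space W by fact
  interpret VW: module ring_of_type_algebra "gsum V W"
    by (rule module_gsum) fact+
  show ?thesis
    using assms(3)
  proof (induction D rule: infinite_finite_induct)
    case (insert x F)
    obtain a b where "f x = (a, b)" by fastforce
    with insert show ?case
      by (subst VW.finsum_insert) (auto simp: Pi_iff mem_Times_iff)
  qed auto
qed

lemma graded_space_gsum:
  assumes "graded_space V" "graded_space W"
  shows "graded_space (gsum V W)"
proof -
  interpret V: graded_space V by fact
  interpret W: graded_space W by fact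
  let ?p = "\<lambda>z d. (component V (fst z) d, component W (snd z) d)"
  have fin: "finite {d. ?p z d \<noteq> \<zero>\<^bsub>gsum V W\<^esub>}" if "z \<in> carrier (gsum V W)" for z
    by (rule finite_subset[of _ "{d. component V (fst z) d \<noteq> \<zero>\<^bsub>V\<^esub>} \<union> {d. component W (snd z) d \<noteq> \<zero>\<^bsub>W\<^esub>}"])
      (use that V.component_finite W.component_finite in auto)
  have sum: "z = (\<Oplus>\<^bsub>gsum V W\<^esub>d\<in>{d. ?p z d \<noteq> \<zero>\<^bsub>gsum V W\<^esub>}. ?p z d)" if z: "z \<in> carrier (gsum V W)" for z
  proof -
    have "(\<Oplus>\<^bsub>V\<^esub>d\<in>{d. ?p z d \<noteq> \<zero>\<^bsub>gsum V W\<^esub>}. component V (fst z) d) = fst z"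
      by (rule V.component_sum_superset) (use z fin[OF z] in auto)
    moreover have "(\<Oplus>\<^bsub>W\<^esub>d\<in>{d. ?p z d \<noteq> \<zero>\<^bsub>gsum V W\<^esub>}. component W (snd z) d) = snd z"
      by (rule W.component_sum_superset) (use z fin[OF z] in auto)
    ultimately show ?thesis
      using z by (subst finsum_gsum[OF assms])
        (auto simp: V.component_carrier W.component_carrier)
  qed
  show ?thesis
    by (rule graded_spaceI[OF module_gsum[OF assms], where p = ?p, OF _ _ _ _ _ fin sum])
      (auto simp: V.homog_carrier W.homog_carrier V.homog_add W.homog_add V.homog_smult
        W.homog_smult V.component_homog W.component_homog V.component_add W.component_add
        V.component_homog_eq W.component_homog_eq)
qed

lemma truncate_simps [simp]:
  "carrier (gspace.truncate V) = carrier V" "\<zero>\<^bsub>gspace.truncate V\<^esub> = \<zero>\<^bsub>V\<^esub>"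
  "add (gspace.truncate V) = add V" "module.smult (gspace.truncate V) = module.smult V"
  "homog (gspace.truncate V) = homog V"
  by (auto simp: gspace.truncate_def)

lemma finsum_cong_structure:
  assumes "carrier G = carrier H" "\<zero>\<^bsub>G\<^esub> = \<zero>\<^bsub>H\<^esub>" "add G = add H"
  shows "finsum G = finsum H"
  using assms by (intro ext) (simp add: finsum_def finprod_def)

text \<open>G and V may be records of different types, as with truncations and algebras viewed as
  graded spaces, so they cannot be compared by an equation. \<open>is_decomposition\<close> reads
  only the listed fields, and so the grading is transported.\<close>

lemma
  assumes eq: "carrier G = carrier V" "\<zero>\<^bsub>G\<^esub> = \<zero>\<^bsub>V\<^esub>" "add G = add V" "module.smult G = module.smult V"
    "homog G = homog V"
  shows has_degs_cong_structure: "has_degs G = has_degs V"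
    and graded_space_cong_structure: "graded_space V \<Longrightarrow> graded_space G"
proof -
  have d: "is_decomposition G = is_decomposition V"
    by (intro ext) (simp add: is_decomposition_def eq finsum_cong_structure[OF eq(1-3)])
  show "has_degs G = has_degs V"
    by (intro ext) (simp add: has_degs_def eq)
  assume "graded_space V"
  then interpret graded_space V .
  have M: "module ring_of_type_algebra G"
    by (rule module_ring_of_typeI)
      (auto simp: eq a_assoc smult_add_left smult_add_right smult_smult intro: a_comm)
  show "graded_space G"
  proof (intro graded_space.intro[OF M] graded_space_axioms.intro)
    show "submodule (homog G e) ring_of_type_algebra G" for e
      unfolding submodule_iff[OF M] by (auto simp: eq homog_carrier homog_add homog_smult)
    show "\<exists>!c. is_decomposition G v c" if "v \<in> carrier G" for v
      using decomposition that by (simp add: d eq)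
  qed
qed

section \<open>Algebras with operations\<close>

text \<open>
  The tree algebra satisfies none of the identities of an \<open>A(m)\<close>-algebra, so ideals and quotients are
  treated for graded spaces with multilinear operations and a marked element of degree \<open>0\<close>.
\<close>

locale pre_am_algebra = graded_space A
  for m :: enat and A :: "('k::field_char_0, 'v) amalg" (structure) +
  assumes operations: "graded_operations m A (mu A)"
    and one_degree: "\<one> \<in> homog A 0"

locale pre_am_hom = A: pre_am_algebra m A + B: pre_am_algebra m B + graded_map A B f
  for m :: enat and A :: "('k::field_char_0, 'v) amalg" and B :: "('k, 'w) amalg" and f +
  assumes one: "f \<one>\<^bsub>A\<^esub> = \<one>\<^bsub>B\<^esub>"
    and mu: "set as \<subseteq> carrier A \<Longrightarrow> arity m (length as) \<Longrightarrow> f (mu A as) = mu B (map f as)"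

lemma unital_am_algebra_pre: "unital_am_algebra m A \<Longrightarrow> pre_am_algebra m A"
  unfolding unital_am_algebra_def unital_am_algebra_axioms_def pre_am_algebra_def
    pre_am_algebra_axioms_def by auto

lemma am_hom_iff:
  "am_hom m A B f \<longleftrightarrow> unital_am_algebra m A \<and> unital_am_algebra m B \<and> pre_am_hom m A B f"
  unfolding am_hom_def pre_am_hom_def pre_am_hom_axioms_def graded_map_def graded_map_axioms_def
  by (auto dest: unital_am_algebra_pre simp: pre_am_algebra_def)

lemma arity_mono: "arity m n \<Longrightarrow> 1 \<le> k \<Longrightarrow> k \<le> n \<Longrightarrow> arity m k"
  unfolding arity_def by (metis enat_ord_simps(1) order_trans)

text \<open>The summands are named so that closure and naturality can be settled term by term before
  the two nested sums are handled.\<close>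

definition stasheff_term where
  "stasheff_term A ds as l k =
     ((-1) powi (int k + int l + int k * int l + int (length as) * int k + int k * sum_list (take l ds)))
     \<odot>\<^bsub>A\<^esub> mu A (take l as @ mu A (take k (drop l as)) # drop (l + k) as)"

lemma stasheff_eq_terms:
  "stasheff A ds as = (\<Oplus>\<^bsub>A\<^esub>l\<in>{0..<length as}. \<Oplus>\<^bsub>A\<^esub>k\<in>{1..length as - l}. stasheff_term A ds as l k)"
  by (simp add: stasheff_def stasheff_term_def Let_def)

lemma (in graded_space) diff_eq_zero_iff:
  assumes "x \<in> carrier V" "y \<in> carrier V"
  shows "x \<ominus> y = \<zero> \<longleftrightarrow> x = y"
proof
  assume "x \<ominus> y = \<zero>"
  moreover have "(x \<ominus> y) \<oplus> y = x"
    using assms by (simp add: a_minus_def a_assoc l_neg)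
  ultimately show "x = y"
    using assms by simp
qed (use assms in \<open>simp add: a_minus_def r_neg\<close>)

context pre_am_algebra
begin

lemma one_carrier [simp]: "\<one> \<in> carrier A"
  using one_degree homog_carrier by blast

lemmas mu_carrier = operations_closed[OF operations]
  and mu_add = operations_add[OF operations]
  and mu_smult = operations_smult[OF operations]
  and mu_homog = operations_homog[OF operations]
  and mu_zero = operations_zero[OF operations]

lemma mu_permute_carrier:
  "set xs \<subseteq> carrier A \<Longrightarrow> arity m (length xs) \<Longrightarrow> s permutes {..<length xs} \<Longrightarrow>
    mu A (permute_list s xs) \<in> carrier A"
  by (rule mu_carrier) auto

lemma antisymmetrization_carrier:
  "set xs \<subseteq> carrier A \<Longrightarrow> arity m (length xs) \<Longrightarrow> antisymmetrization A ds xs \<in> carrier A"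
  unfolding antisymmetrization_def by (rule finsum_closed) (auto simp: mu_permute_carrier)

lemma stasheff_inner_carrier:
  assumes "set as \<subseteq> carrier A" "arity m (length as)" "l < length as" "1 \<le> k" "k \<le> length as - l"
  shows "mu A (take k (drop l as)) \<in> carrier A"
  by (rule mu_carrier) (use assms in \<open>auto dest!: in_set_takeD in_set_dropD intro: arity_mono\<close>)

text \<open>The outer list has n - k + 1 entries, at most n because k is at least 1, so the outer
  arity stays within m whenever n does.\<close>

lemma stasheff_outer_carrier:
  assumes "set as \<subseteq> carrier A" "arity m (length as)" "l < length as" "1 \<le> k" "k \<le> length as - l"
  shows "set (take l as @ mu A (take k (drop l as)) # drop (l + k) as) \<subseteq> carrier A"
    "arity m (length (take l as @ mu A (take k (drop l as)) # drop (l + k) as))"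
  using assms stasheff_inner_carrier[OF assms]
  by (auto dest!: in_set_takeD in_set_dropD intro: arity_mono)

lemma stasheff_term_carrier:
  assumes "set as \<subseteq> carrier A" "arity m (length as)" "l < length as" "1 \<le> k" "k \<le> length as - l"
  shows "stasheff_term A ds as l k \<in> carrier A"
  unfolding stasheff_term_def by (rule smult_carrier, rule mu_carrier[OF stasheff_outer_carrier[OF assms]])

lemma stasheff_carrier:
  assumes "set as \<subseteq> carrier A" "arity m (length as)"
  shows "stasheff A ds as \<in> carrier A"
  unfolding stasheff_eq_terms
  using stasheff_term_carrier[OF assms] by (auto intro!: finsum_closed)

end

context pre_am_hom
begin

lemma antisymmetrization:
  assumes "set xs \<subseteq> carrier A" "arity m (length xs)"
  shows "f (antisymmetrization A ds xs) = antisymmetrization B ds (map f xs)"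
proof -
  have "f (antisymmetrization A ds xs) =
    (\<Oplus>\<^bsub>B\<^esub>s\<in>{s. s permutes {..<length xs}}. f (antisym_sign s ds \<odot>\<^bsub>A\<^esub> mu A (permute_list s xs)))"
    unfolding antisymmetrization_def
    by (rule finsum) (use assms in \<open>auto simp: A.mu_permute_carrier\<close>)
  also have "\<dots> = antisymmetrization B ds (map f xs)"
    unfolding antisymmetrization_def length_map
  proof (intro B.finsum_cong' refl)
    show "(\<lambda>s. antisym_sign s ds \<odot>\<^bsub>B\<^esub> mu B (permute_list s (map f xs)))
      \<in> {s. s permutes {..<length xs}} \<rightarrow> carrier B"
      using B.mu_permute_carrier[of "map f xs"] assms map_carrier by auto
    show "f (antisym_sign s ds \<odot>\<^bsub>A\<^esub> mu A (permute_list s xs)) =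
        antisym_sign s ds \<odot>\<^bsub>B\<^esub> mu B (permute_list s (map f xs))"
      if "s \<in> {s. s permutes {..<length xs}}" for s
      using assms that by (simp add: smult mu A.mu_permute_carrier permute_list_map)
  qed
  finally show ?thesis .
qed

lemma stasheff:
  assumes "set as \<subseteq> carrier A" "arity m (length as)"
  shows "f (stasheff A ds as) = stasheff B ds (map f as)"
proof -
  let ?n = "length as"
  let ?t = "stasheff_term A ds as" and ?t' = "stasheff_term B ds (map f as)"
  have t: "?t l k \<in> carrier A" "f (?t l k) = ?t' l k" "?t' l k \<in> carrier B"
    if "l < ?n" "1 \<le> k" "k \<le> ?n - l" for l k
  proof -
    note o = A.stasheff_outer_carrier[OF assms that]
    show "?t l k \<in> carrier A"
      by (rule A.stasheff_term_carrier[OF assms that])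
    have "f (mu A (take k (drop l as))) = mu B (take k (drop l (map f as)))"
      by (subst mu) (use assms that in \<open>auto dest!: in_set_takeD in_set_dropD
        intro: arity_mono simp: take_map drop_map\<close>)
    then show "f (?t l k) = ?t' l k"
      using A.mu_carrier[OF o] mu[OF o] by (simp add: stasheff_term_def smult take_map drop_map)
    then show "?t' l k \<in> carrier B"
      using \<open>?t l k \<in> carrier A\<close> closed by metis
  qed
  have "f (stasheff A ds as) = f (\<Oplus>\<^bsub>A\<^esub>l\<in>{0..<?n}. \<Oplus>\<^bsub>A\<^esub>k\<in>{1..?n - l}. ?t l k)"
    by (simp add: stasheff_eq_terms)
  also have "\<dots> = (\<Oplus>\<^bsub>B\<^esub>l\<in>{0..<?n}. f (\<Oplus>\<^bsub>A\<^esub>k\<in>{1..?n - l}. ?t l k))"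
    by (rule finsum) (use t(1) in \<open>auto intro!: A.finsum_closed\<close>)
  also have "\<dots> = (\<Oplus>\<^bsub>B\<^esub>l\<in>{0..<?n}. \<Oplus>\<^bsub>B\<^esub>k\<in>{1..?n - l}. f (?t l k))"
    by (rule B.finsum_cong') (use t(1) in \<open>auto intro!: B.finsum_closed finsum closed\<close>)
  also have "\<dots> = (\<Oplus>\<^bsub>B\<^esub>l\<in>{0..<?n}. \<Oplus>\<^bsub>B\<^esub>k\<in>{1..?n - l}. ?t' l k)"
    by (intro B.finsum_cong' refl) (use t in \<open>auto intro!: B.finsum_closed\<close>)
  also have "\<dots> = stasheff B ds (map f as)"
    by (simp add: stasheff_eq_terms)
  finally show ?thesis .
qed

end

lemma pre_am_hom_compose:
  assumes "pre_am_hom m A B f" "pre_am_hom m B C g"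
  shows "pre_am_hom m A C (compose (carrier A) g f)"
proof -
  interpret f: pre_am_hom m A B f by fact
  interpret g: pre_am_hom m B C g by fact
  have l: "linear0 A C (compose (carrier A) g f)"
    using linear0_compose f.linear0 g.linear0 f.A.graded_space_axioms by blast
  show ?thesis
  proof (unfold_locales; (rule l)?)
    show "compose (carrier A) g f \<one>\<^bsub>A\<^esub> = \<one>\<^bsub>C\<^esub>"
      by (simp add: compose_def f.one g.one)
    fix as assume as: "set as \<subseteq> carrier A" "arity m (length as)"
    have "g (mu B (map f as)) = mu C (map g (map f as))"
      by (rule g.mu) (use as in auto)
    moreover have "map g (map f as) = map (compose (carrier A) g f) as"
      using as(1) by (auto simp: compose_eq)
    ultimately have "g (mu B (map f as)) = mu C (map (compose (carrier A) g f) as)"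
      by (simp only:)
    then show "compose (carrier A) g f (mu A as) = mu C (map (compose (carrier A) g f) as)"
      using as f.A.mu_carrier by (simp add: compose_eq f.mu)
  qed
qed

lemma am_hom_compose:
  "am_hom m A B f \<Longrightarrow> am_hom m B C g \<Longrightarrow> am_hom m A C (compose (carrier A) g f)"
  unfolding am_hom_iff using pre_am_hom_compose by blast

lemma am_hom_id:
  assumes "unital_am_algebra m A"
  shows "am_hom m A A (\<lambda>a\<in>carrier A. a)"
proof -
  interpret pre_am_algebra m A
    by (rule unital_am_algebra_pre) fact
  have "map (restrict (\<lambda>a. a) (carrier A)) as = as" if "set as \<subseteq> carrier A" for as
    using that by (intro map_idI) auto
  then show ?thesis
    unfolding am_hom_def using assms linear0_id[OF graded_space_axioms] mu_carrier by auto
qed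

lemma am_hom_mapsto: "am_hom m A B f \<Longrightarrow> x \<in> carrier A \<Longrightarrow> f x \<in> carrier B"
  unfolding am_hom_def linear0_def by auto

lemma am_hom_eqI:
  assumes "am_hom m A B f" "am_hom m A B g" "\<And>x. x \<in> carrier A \<Longrightarrow> f x = g x"
  shows "f = g"
  by (rule extensionalityI[of _ "carrier A"]) (use assms in \<open>auto simp: am_hom_def linear0_def PiE_def\<close>)


section \<open>Ideals and quotients\<close>

lemma am_idealD:
  assumes "am_ideal m A I"
  shows "graded_subspace A I"
    and "arity m (length as) \<Longrightarrow> set as \<subseteq> carrier A \<Longrightarrow> x \<in> set as \<Longrightarrow> x \<in> I \<Longrightarrow> mu A as \<in> I"
  using assms by (auto simp: am_ideal_def)

context pre_am_algebra
begin

lemma am_ideal_carrier: "am_ideal m A (carrier A)"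
  unfolding am_ideal_def graded_subspace_iff by (auto simp: component_carrier mu_carrier)

lemma am_ideal_zero: "am_ideal m A {\<zero>}"
  unfolding am_ideal_def graded_subspace_iff
  using component_homog_eq[OF homog_zero, of 0] by (auto simp: mu_zero)

text \<open>The carrier is an ideal containing S, so the intersection is over a nonempty family;
  over an empty one it would be the whole type.\<close>

lemma am_ideal_genideal:
  assumes "S \<subseteq> carrier A" shows "am_ideal m A (am_genideal m A S)"
proof -
  have "am_genideal m A S \<subseteq> carrier A"
    unfolding am_genideal_def using am_ideal_carrier assms by auto
  then show ?thesis
    unfolding am_genideal_def am_ideal_def graded_subspace_iff by blast
qed

lemma genideal_minimal: "am_ideal m A I \<Longrightarrow> S \<subseteq> I \<Longrightarrow> am_genideal m A S \<subseteq> I"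
  unfolding am_genideal_def by auto

lemma genideal_eqI:
  assumes "S \<subseteq> carrier A" "T \<subseteq> carrier A" "S \<subseteq> am_genideal m A T" "T \<subseteq> am_genideal m A S"
  shows "am_genideal m A S = am_genideal m A T"
  using assms genideal_minimal am_ideal_genideal by (metis subset_antisym)

end

lemma genideal_superset: "S \<subseteq> am_genideal m A S"
  unfolding am_genideal_def by auto

context pre_am_hom
begin

lemma am_ideal_preimage:
  assumes "am_ideal m B J" shows "am_ideal m A {a \<in> carrier A. f a \<in> J}"
proof -
  note J = B.graded_subspaceD[OF am_idealD(1)[OF assms]]
  have "f (mu A as) \<in> J" if "arity m (length as)" "set as \<subseteq> carrier A" "x \<in> set as" "f x \<in> J" for as x
    unfolding mu[OF that(2,1)] by (rule am_idealD(2)[OF assms, of _ "f x"]) (use that in auto)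
  then show ?thesis
    unfolding am_ideal_def A.graded_subspace_iff using J
    by (auto simp: add smult A.component_carrier A.mu_carrier simp flip: component)
qed

text \<open>The image of an ideal need not be an ideal, so minimality is applied to the preimage of
  J.\<close>

lemma image_genideal_subset:
  assumes "am_ideal m B J" "S \<subseteq> carrier A" "f ` S \<subseteq> J"
  shows "f ` am_genideal m A S \<subseteq> J"
  using A.genideal_minimal[OF am_ideal_preimage[OF assms(1)], of S] assms by auto

end

lemma in_listset_iff: "xs \<in> listset As \<longleftrightarrow> list_all2 (\<in>) xs As"
proof (induction As arbitrary: xs)
  case (Cons A As)
  then show ?case
    by (cases xs) (auto simp: set_Cons_def)
qed auto

section \<open>The quotient by an ideal\<close>

locale am_quotient = pre_am_algebra m A for m and A :: "('k::field_char_0, 'v) amalg" (structure) +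
  fixes I
  assumes ideal: "am_ideal m A I"
begin

lemmas subspace = graded_subspaceD[OF am_idealD(1)[OF ideal]]
lemmas ideal_mu = am_idealD(2)[OF ideal]

lemma ideal_carrier: "x \<in> I \<Longrightarrow> x \<in> carrier A"
  using subspace(1) by auto

lemma mem_coset_iff:
  assumes a: "a \<in> carrier A"
  shows "x \<in> I +> a \<longleftrightarrow> x \<in> carrier A \<and> x \<ominus> a \<in> I"
proof
  assume "x \<in> I +> a"
  then obtain h where h: "h \<in> I" "x = h \<oplus> a"
    by (auto simp: a_r_coset_def')
  then have "x \<ominus> a = h"
    using ideal_carrier[of h] a by (simp add: a_minus_def a_assoc r_neg)
  with h a show "x \<in> carrier A \<and> x \<ominus> a \<in> I"
    using ideal_carrier[of h] by simp
next
  assume x: "x \<in> carrier A \<and> x \<ominus> a \<in> I"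
  then have "x = (x \<ominus> a) \<oplus> a"
    using a by (simp add: a_minus_def a_assoc l_neg)
  with x show "x \<in> I +> a"
    by (auto simp: a_r_coset_def')
qed

lemma coset_eq_iff:
  assumes a: "a \<in> carrier A" and b: "b \<in> carrier A"
  shows "I +> a = I +> b \<longleftrightarrow> a \<ominus> b \<in> I"
proof
  assume "I +> a = I +> b"
  then show "a \<ominus> b \<in> I"
    using mem_coset_iff[OF a, of a] mem_coset_iff[OF b, of a] a subspace(2)
    by (simp add: a_minus_def r_neg)
next
  assume ab: "a \<ominus> b \<in> I"
  have *: "x \<ominus> b = (x \<ominus> a) \<oplus> (a \<ominus> b)" "x \<ominus> a = (x \<ominus> b) \<ominus> (a \<ominus> b)" if "x \<in> carrier A" for x
    using that a b a_comm[of "\<ominus> a" b] by (simp_all add: a_minus_def a_assoc r_neg1 minus_add)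
  have "x \<ominus> a \<in> I \<longleftrightarrow> x \<ominus> b \<in> I" if "x \<in> carrier A" for x
    using *[OF that] subspace(3)[OF _ ab] subspace(7)[OF _ ab] by metis
  then show "I +> a = I +> b"
    using mem_coset_iff[OF a] mem_coset_iff[OF b] by blast
qed

abbreviation (input) "Q \<equiv> am_quot A I"

lemma quot_carrier: "carrier Q = (\<lambda>a. I +> a) ` carrier A"
  and quot_homog: "homog Q d = (\<lambda>a. I +> a) ` homog A d"
  and quot_one: "\<one>\<^bsub>Q\<^esub> = I +> \<one>"
  by (auto simp: am_quot_def)

lemma quot_zero: "\<zero>\<^bsub>Q\<^esub> = I +> \<zero>"
  using subspace(1) by (simp add: am_quot_def)

lemma quot_add:
  assumes "a \<in> carrier A" "b \<in> carrier A"
  shows "(I +> a) \<oplus>\<^bsub>Q\<^esub> (I +> b) = I +> (a \<oplus> b)"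
proof -
  interpret abelian_subgroup I A
  proof (rule abelian_subgroupI3)
    show "additive_subgroup I A"
      using am_idealD(1)[OF ideal] submodule.axioms(1)
      unfolding additive_subgroup_def graded_subspace_def by blast
  qed (rule abelian_group_axioms)
  show ?thesis
    using a_rcos_sum[OF assms] by (simp add: am_quot_def)
qed

lemma smult_diff: "a \<in> carrier A \<Longrightarrow> b \<in> carrier A \<Longrightarrow> c \<odot> a \<ominus> c \<odot> b = c \<odot> (a \<ominus> b)"
  by (simp add: a_minus_def minus_eq_smult smult_add_right smult_smult mult.commute)

text \<open>\<open>am_quot\<close> takes the union over all representatives. They all give the same
  coset and at least one exists, so the union collapses to it. The operations \<open>mu\<close> are
  treated in the same way.\<close>

lemma quot_smult:
  assumes a: "a \<in> carrier A"
  shows "c \<odot>\<^bsub>Q\<^esub> (I +> a) = I +> (c \<odot> a)"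
proof -
  have "I +> (c \<odot> b) = I +> (c \<odot> a)" if "b \<in> I +> a" for b
    using that a subspace(4) by (simp add: mem_coset_iff coset_eq_iff smult_diff)
  moreover have "a \<in> I +> a"
    using a subspace(2) by (simp add: mem_coset_iff a_minus_def r_neg)
  ultimately have "(\<Union>b\<in>I +> a. I +> (c \<odot> b)) = I +> (c \<odot> a)"
    by (intro UN_constant_eq) blast+
  then show ?thesis
    by (simp add: am_quot_def)
qed

lemma mu_diff:
  assumes "set xs \<subseteq> carrier A" "set zs \<subseteq> carrier A" "x \<in> carrier A" "y \<in> carrier A"
    "arity m (length xs + 1 + length zs)"
  shows "mu A (xs @ (x \<ominus> y) # zs) = mu A (xs @ x # zs) \<ominus> mu A (xs @ y # zs)"
proof -
  have "mu A (xs @ y # zs) \<in> carrier A"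
    by (rule mu_carrier) (use assms in auto)
  then show ?thesis
    using mu_add[OF assms(1,2,3), of "(- 1) \<odot> y"] mu_smult[OF assms(1,2), of y "- 1"] assms
    by (simp add: a_minus_def minus_eq_smult)
qed

text \<open>The arguments are exchanged one at a time from the left, \<open>xs\<close> collecting
  those already replaced. Each exchange changes the value by an element of I, and the differences
  telescope.\<close>

lemma mu_cong_ideal:
  assumes "list_all2 (\<lambda>a b. a \<in> carrier A \<and> b \<in> carrier A \<and> a \<ominus> b \<in> I) as bs"
    "set xs \<subseteq> carrier A" "arity m (length xs + length as)"
  shows "mu A (xs @ as) \<ominus> mu A (xs @ bs) \<in> I"
  using assms
proof (induction arbitrary: xs rule: list_all2_induct)
  case Nil
  then show ?case
    using mu_carrier[of xs] subspace(2) by (simp add: a_minus_def r_neg)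
next
  case (Cons a as b bs)
  have as: "set as \<subseteq> carrier A" "set bs \<subseteq> carrier A" "length bs = length as"
    using Cons.hyps(2) by (auto simp: list_all2_conv_all_nth in_set_conv_nth)
  have c: "mu A (xs @ a # as) \<in> carrier A" "mu A (xs @ b # as) \<in> carrier A" "mu A (xs @ b # bs) \<in> carrier A"
    using Cons.hyps(1) Cons.prems as by (auto intro!: mu_carrier)
  have "mu A (xs @ a # as) \<ominus> mu A (xs @ b # as) \<in> I"
    using mu_diff[of xs as a b] ideal_mu[of "xs @ (a \<ominus> b) # as" "a \<ominus> b"] Cons.hyps(1) Cons.prems as
    by auto
  moreover have "mu A (xs @ b # as) \<ominus> mu A (xs @ b # bs) \<in> I"
    using Cons.IH[of "xs @ [b]"] Cons.hyps(1) Cons.prems by simp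
  ultimately have "(mu A (xs @ a # as) \<ominus> mu A (xs @ b # as)) \<oplus> (mu A (xs @ b # as) \<ominus> mu A (xs @ b # bs)) \<in> I"
    by (rule subspace(3))
  then show ?case
    using c by (simp add: a_minus_def a_assoc r_neg1)
qed

lemma quot_mu:
  assumes as: "set as \<subseteq> carrier A" "arity m (length as)"
  shows "mu Q (map (\<lambda>a. I +> a) as) = I +> mu A as"
proof -
  have "I +> mu A bs = I +> mu A as" if "bs \<in> listset (map (\<lambda>a. I +> a) as)" for bs
  proof -
    have l: "list_all2 (\<lambda>a b. a \<in> carrier A \<and> b \<in> carrier A \<and> a \<ominus> b \<in> I) bs as"
      using that as(1) unfolding in_listset_iff list_all2_conv_all_nth
      by (auto simp: subset_iff mem_coset_iff)
    then have "set bs \<subseteq> carrier A" "length bs = length as"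
      by (auto simp: list_all2_conv_all_nth in_set_conv_nth)
    then show ?thesis
      using mu_cong_ideal[OF l, of "[]"] as by (simp add: coset_eq_iff mu_carrier)
  qed
  moreover have "as \<in> listset (map (\<lambda>a. I +> a) as)"
    using as(1) subspace(2) unfolding in_listset_iff list_all2_conv_all_nth
    by (auto simp: subset_iff mem_coset_iff a_minus_def r_neg)
  ultimately have "(\<Union>bs\<in>listset (map (\<lambda>a. I +> a) as). I +> mu A bs) = I +> mu A as"
    by (intro UN_constant_eq) blast+
  then show ?thesis
    by (simp add: am_quot_def)
qed

lemma quot_carrierE:
  assumes "C \<in> carrier Q" obtains a where "a \<in> carrier A" "C = I +> a"
  using assms by (auto simp: quot_carrier)

lemma quot_list:
  assumes "set Cs \<subseteq> carrier Q" obtains as where "Cs = map (\<lambda>a. I +> a) as" "set as \<subseteq> carrier A"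
proof -
  have "Cs \<in> lists ((\<lambda>a. I +> a) ` carrier A)"
    using assms by (auto simp: quot_carrier)
  then show thesis
    using that unfolding lists_image by auto
qed

text \<open>Representatives can be chosen homogeneous of the same degrees, because
  \<open>homog\<close> of the quotient consists of cosets of homogeneous elements. The signs in the
  identities depend on these degrees, so arbitrary lifts would not do.\<close>

lemma quot_has_degs:
  assumes "has_degs Q ds Cs" obtains as where "Cs = map (\<lambda>a. I +> a) as" "has_degs A ds as"
proof -
  have "\<exists>as. Cs = map (\<lambda>a. I +> a) as \<and> has_degs A ds as"
    using assms unfolding has_degs_def
  proof (induction rule: list_all2_induct)
    case (Cons d ds C Cs)
    then obtain a as where "a \<in> homog A d" "C = I +> a" "Cs = map (\<lambda>a. I +> a) as"
      "list_all2 (\<lambda>d x. x \<in> homog A d) ds as"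
      by (auto simp: quot_homog)
    then show ?case by (intro exI[of _ "a # as"]) simp
  qed simp
  then show thesis using that by auto
qed

lemma module_quot: "module ring_of_type_algebra Q"
proof (rule module_ring_of_typeI)
  show "C \<oplus>\<^bsub>Q\<^esub> D = D \<oplus>\<^bsub>Q\<^esub> C" if "C \<in> carrier Q" "D \<in> carrier Q" for C D
    using that by (elim quot_carrierE) (simp add: quot_add a_comm)
  show "\<zero>\<^bsub>Q\<^esub> \<in> carrier Q"
    by (auto simp: quot_carrier quot_zero)
qed (auto elim!: quot_carrierE simp: quot_carrier quot_add quot_smult quot_zero a_assoc
    smult_add_left smult_add_right smult_smult)

lemma finsum_quot:
  assumes "f \<in> D \<rightarrow> carrier A"
  shows "(\<Oplus>\<^bsub>Q\<^esub>i\<in>D. I +> f i) = I +> (\<Oplus>i\<in>D. f i)"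
proof -
  interpret Q: module ring_of_type_algebra Q by (rule module_quot)
  show ?thesis
    using assms
  proof (induction D rule: infinite_finite_induct)
    case (insert x F)
    then show ?case
      by (subst Q.finsum_insert) (auto simp: quot_carrier quot_add Pi_iff)
  qed (auto simp: quot_zero)
qed

lemma component_diff:
  "a \<in> carrier A \<Longrightarrow> b \<in> carrier A \<Longrightarrow> component A (a \<ominus> b) d = component A a d \<ominus> component A b d"
  by (simp add: a_minus_def minus_eq_smult component_add component_smult component_carrier)

text \<open>Since I is graded, the components of congruent elements are congruent; so the
  projections of A descend to the cosets, independently of the chosen representative.\<close>

lemma graded_space_quot: "graded_space Q"
proof -
  define p where "p C d = I +> component A (SOME a. a \<in> carrier A \<and> C = I +> a) d" for C d
  have p: "p (I +> a) d = I +> component A a d" if a: "a \<in> carrier A" for a d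
  proof -
    let ?b = "SOME b. b \<in> carrier A \<and> I +> a = I +> b"
    have "?b \<in> carrier A \<and> I +> a = I +> ?b"
      by (rule someI[of _ a]) (use a in simp)
    then have b: "?b \<in> carrier A" "?b \<ominus> a \<in> I"
      using coset_eq_iff[of ?b a] a by auto
    have "component A (?b \<ominus> a) d \<in> I"
      using subspace(5) b by blast
    then show ?thesis
      using b(1) a by (simp add: p_def coset_eq_iff component_carrier component_diff)
  qed
  \<comment> \<open>Only an inclusion, as a nonzero component may lie in I.\<close>
  have sub: "{d. I +> component A a d \<noteq> \<zero>\<^bsub>Q\<^esub>} \<subseteq> {d. component A a d \<noteq> \<zero>}" for a
    by (auto simp: quot_zero)
  show ?thesis
  proof (rule graded_spaceI[OF module_quot, where p = p])
    show "homog Q d \<subseteq> carrier Q" for d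
      by (auto simp: quot_homog quot_carrier homog_carrier)
    show "\<zero>\<^bsub>Q\<^esub> \<in> homog Q d" for d
      by (auto simp: quot_homog quot_zero)
    show "C \<oplus>\<^bsub>Q\<^esub> D \<in> homog Q d" if "C \<in> homog Q d" "D \<in> homog Q d" for C D d
      using that by (auto simp: quot_homog quot_add homog_carrier homog_add)
    show "c \<odot>\<^bsub>Q\<^esub> C \<in> homog Q d" if "C \<in> homog Q d" for C c d
      using that by (auto simp: quot_homog quot_smult homog_carrier homog_smult)
    show "p C d \<in> homog Q d" if "C \<in> carrier Q" for C d
      using that by (auto elim!: quot_carrierE simp: p quot_homog component_homog)
    show "finite {d. p C d \<noteq> \<zero>\<^bsub>Q\<^esub>}" if "C \<in> carrier Q" for C
      using that finite_subset[OF sub component_finite] by (auto elim!: quot_carrierE simp: p)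
    show "p (C \<oplus>\<^bsub>Q\<^esub> D) d = p C d \<oplus>\<^bsub>Q\<^esub> p D d" if "C \<in> carrier Q" "D \<in> carrier Q" for C D d
      using that by (auto elim!: quot_carrierE simp: p quot_add component_add component_carrier)
    show "p C e = (if e = d then C else \<zero>\<^bsub>Q\<^esub>)" if "C \<in> homog Q d" for C d e
      using that by (auto simp: quot_homog quot_zero p homog_carrier component_homog_eq)
    fix C assume "C \<in> carrier Q"
    then obtain a where a: "a \<in> carrier A" "C = I +> a"
      by (rule quot_carrierE)
    interpret Q: module ring_of_type_algebra Q by (rule module_quot)
    have "(\<Oplus>\<^bsub>Q\<^esub>d\<in>{d. p C d \<noteq> \<zero>\<^bsub>Q\<^esub>}. p C d) = (\<Oplus>\<^bsub>Q\<^esub>d\<in>{d. component A a d \<noteq> \<zero>}. I +> component A a d)"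
      by (rule Q.add.finprod_mono_neutral_cong_left)
        (use a sub in \<open>auto simp: p component_finite quot_carrier component_carrier\<close>)
    also have "\<dots> = I +> (\<Oplus>d\<in>{d. component A a d \<noteq> \<zero>}. component A a d)"
      by (rule finsum_quot) (use a component_carrier in auto)
    also have "\<dots> = C"
      using a by (simp add: component_sum)
    finally show "C = (\<Oplus>\<^bsub>Q\<^esub>d\<in>{d. p C d \<noteq> \<zero>\<^bsub>Q\<^esub>}. p C d)" by simp
  qed
qed

lemma pre_am_algebra_quot: "pre_am_algebra m Q"
proof (intro pre_am_algebra.intro[OF graded_space_quot] pre_am_algebra_axioms.intro)
  show "\<one>\<^bsub>Q\<^esub> \<in> homog Q 0"
    by (auto simp: quot_one quot_homog one_degree)
  show "graded_operations m Q (mu Q)"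
    unfolding graded_operations_def
  proof (intro conjI allI impI; (elim conjE)?)
    fix Cs assume "set Cs \<subseteq> carrier Q" "arity m (length Cs)"
    then show "mu Q Cs \<in> carrier Q"
      by (elim quot_list) (auto simp: quot_mu quot_carrier mu_carrier)
  next
    fix Cs C D Ds assume *: "set Cs \<union> {C, D} \<union> set Ds \<subseteq> carrier Q" "arity m (length Cs + 1 + length Ds)"
    then obtain as a b bs where "Cs = map (\<lambda>a. I +> a) as" "set as \<subseteq> carrier A"
      "Ds = map (\<lambda>a. I +> a) bs" "set bs \<subseteq> carrier A" "C = I +> a" "a \<in> carrier A"
      "D = I +> b" "b \<in> carrier A"
      by (auto elim!: quot_list quot_carrierE)
    with * quot_mu[of "as @ a # bs"] quot_mu[of "as @ b # bs"] quot_mu[of "as @ (a \<oplus> b) # bs"]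
    show "mu Q (Cs @ (C \<oplus>\<^bsub>Q\<^esub> D) # Ds) = mu Q (Cs @ C # Ds) \<oplus>\<^bsub>Q\<^esub> mu Q (Cs @ D # Ds)"
      by (simp add: quot_add mu_add mu_carrier)
  next
    fix Cs c C Ds assume *: "set Cs \<union> {C} \<union> set Ds \<subseteq> carrier Q" "arity m (length Cs + 1 + length Ds)"
    then obtain as a bs where "Cs = map (\<lambda>a. I +> a) as" "set as \<subseteq> carrier A"
      "Ds = map (\<lambda>a. I +> a) bs" "set bs \<subseteq> carrier A" "C = I +> a" "a \<in> carrier A"
      by (auto elim!: quot_list quot_carrierE)
    with * quot_mu[of "as @ a # bs"] quot_mu[of "as @ (c \<odot> a) # bs"]
    show "mu Q (Cs @ (c \<odot>\<^bsub>Q\<^esub> C) # Ds) = c \<odot>\<^bsub>Q\<^esub> mu Q (Cs @ C # Ds)"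
      by (simp add: quot_smult mu_smult mu_carrier)
  next
    fix ds Cs assume *: "has_degs Q ds Cs" "arity m (length Cs)"
    then obtain as where "Cs = map (\<lambda>a. I +> a) as" "has_degs A ds as"
      by (elim quot_has_degs)
    with * show "mu Q Cs \<in> homog Q (sum_list ds + int (length Cs) - 2)"
      using mu_homog[of ds as] has_degs_carrier[of ds as] by (auto simp: quot_mu quot_homog)
  qed
qed

lemma pre_am_hom_quot: "pre_am_hom m A Q (\<lambda>a\<in>carrier A. I +> a)"
proof -
  interpret Q: pre_am_algebra m Q by (rule pre_am_algebra_quot)
  have l: "linear0 A Q (\<lambda>a\<in>carrier A. I +> a)"
    by (rule linear0I) (auto simp: quot_carrier quot_add quot_smult quot_homog homog_carrier)
  show ?thesis
  proof (unfold_locales; (rule l)?)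
    show "(\<lambda>a\<in>carrier A. I +> a) \<one> = \<one>\<^bsub>Q\<^esub>"
      by (simp add: quot_one)
    fix as assume as: "set as \<subseteq> carrier A" "arity m (length as)"
    then have "map (\<lambda>a\<in>carrier A. I +> a) as = map (\<lambda>a. I +> a) as"
      by auto
    with as show "(\<lambda>a\<in>carrier A. I +> a) (mu A as) = mu Q (map (\<lambda>a\<in>carrier A. I +> a) as)"
      by (simp only: quot_mu restrict_apply mu_carrier) simp
  qed
qed

text \<open>h is defined through a chosen representative; two representatives differ by an element
  of I, on which f vanishes.\<close>

lemma pre_am_hom_factor:
  assumes f: "pre_am_hom m A B f" and ker: "\<And>x. x \<in> I \<Longrightarrow> f x = \<zero>\<^bsub>B\<^esub>"
  obtains h where "pre_am_hom m Q B h" "\<And>a. a \<in> carrier A \<Longrightarrow> h (I +> a) = f a"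
proof -
  interpret f: pre_am_hom m A B f by fact
  interpret Q: pre_am_algebra m Q by (rule pre_am_algebra_quot)
  define h where "h = (\<lambda>C\<in>carrier Q. f (SOME a. a \<in> carrier A \<and> C = I +> a))"
  have h: "h (I +> a) = f a" if a: "a \<in> carrier A" for a
  proof -
    let ?b = "SOME b. b \<in> carrier A \<and> I +> a = I +> b"
    have "?b \<in> carrier A \<and> I +> a = I +> ?b"
      by (rule someI[of _ a]) (use a in simp)
    then have b: "?b \<in> carrier A" "?b \<ominus> a \<in> I"
      using coset_eq_iff[of ?b a] a by auto
    then have "f ?b \<ominus>\<^bsub>B\<^esub> f a = \<zero>\<^bsub>B\<^esub>"
      using ker[OF b(2)] f.diff a by simp
    then have "f ?b = f a"
      using a b(1) by (simp add: f.B.diff_eq_zero_iff)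
    then show ?thesis
      using a by (simp add: h_def quot_carrier)
  qed
  have l: "linear0 Q B h"
  proof (rule linear0I)
    show "h C \<in> carrier B" if "C \<in> carrier Q" for C
      using that by (elim quot_carrierE) (simp add: h)
    show "h (C \<oplus>\<^bsub>Q\<^esub> D) = h C \<oplus>\<^bsub>B\<^esub> h D" if "C \<in> carrier Q" "D \<in> carrier Q" for C D
      using that by (elim quot_carrierE) (simp add: h f.add quot_add)
    show "h (c \<odot>\<^bsub>Q\<^esub> C) = c \<odot>\<^bsub>B\<^esub> h C" if "C \<in> carrier Q" for c C
      using that by (elim quot_carrierE) (simp add: h f.smult quot_smult)
    show "h C \<in> homog B d" if "C \<in> homog Q d" for d C
      using that by (auto simp: quot_homog h f.homog homog_carrier)
  qed (simp add: h_def)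
  have "pre_am_hom m Q B h"
  proof (unfold_locales; (rule l)?)
    show "h \<one>\<^bsub>Q\<^esub> = \<one>\<^bsub>B\<^esub>"
      unfolding quot_one using h[of \<one>] f.one by simp
    fix Cs assume Cs: "set Cs \<subseteq> carrier Q" "arity m (length Cs)"
    then obtain as where as: "Cs = map (\<lambda>a. I +> a) as" "set as \<subseteq> carrier A"
      by (elim quot_list)
    then have "map h Cs = map f as"
      using h by auto
    moreover have "h (mu Q Cs) = f (mu A as)"
      using as Cs quot_mu[of as] h[OF mu_carrier[of as]] by simp
    moreover have "f (mu A as) = mu B (map f as)"
      using as Cs by (simp add: f.mu)
    ultimately show "h (mu Q Cs) = mu B (map h Cs)"
      by (simp only:)
  qed
  then show thesis
    using h by (rule that)
qed

text \<open>The axioms are stated as membership in I so that the lemma serves twice: for the tree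
  algebra, where the generators of I include these very elements, and for presented algebras, where
  the identities hold before passing to the quotient and membership amounts to I containing
  zero.\<close>

lemma unital_am_algebra_quot:
  assumes "\<And>ds as. has_degs A ds as \<Longrightarrow> arity m (length as) \<Longrightarrow> stasheff A ds as \<in> I"
    and l: "\<And>a. arity m 2 \<Longrightarrow> a \<in> carrier A \<Longrightarrow> mu A [\<one>, a] \<ominus> a \<in> I"
    and r: "\<And>a. arity m 2 \<Longrightarrow> a \<in> carrier A \<Longrightarrow> mu A [a, \<one>] \<ominus> a \<in> I"
    and o: "\<And>xs ys. arity m (length xs + 1 + length ys) \<Longrightarrow> length xs + length ys \<noteq> 1 \<Longrightarrow>
      set xs \<union> set ys \<subseteq> carrier A \<Longrightarrow> mu A (xs @ \<one> # ys) \<in> I"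
  shows "unital_am_algebra m Q"
proof -
  interpret Q: pre_am_algebra m Q by (rule pre_am_algebra_quot)
  interpret q: pre_am_hom m A Q "\<lambda>a\<in>carrier A. I +> a" by (rule pre_am_hom_quot)
  have q0: "I +> a = \<zero>\<^bsub>Q\<^esub>" if "a \<in> I" for a
    using that ideal_carrier[OF that] coset_eq_iff[of a \<zero>]
    by (simp add: quot_zero a_minus_def minus_eq_smult)
  show ?thesis
  proof (intro unital_am_algebra.intro[OF graded_space_quot] unital_am_algebra_axioms.intro)
    fix ds Cs assume *: "has_degs Q ds Cs" "arity m (length Cs)"
    then obtain as where as: "Cs = map (\<lambda>a. I +> a) as" "has_degs A ds as"
      by (elim quot_has_degs)
    note c = has_degs_carrier[OF as(2)]
    have "Cs = map (\<lambda>a\<in>carrier A. I +> a) as"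
      using as c by auto
    with q.stasheff[of as ds] assms(1)[OF as(2)] q0 c * stasheff_carrier[of as ds]
    show "stasheff Q ds Cs = \<zero>\<^bsub>Q\<^esub>"
      by simp
  next
    fix C assume *: "arity m 2" "C \<in> carrier Q"
    then obtain a where a: "a \<in> carrier A" "C = I +> a"
      by (elim quot_carrierE)
    have c: "mu A [\<one>, a] \<in> carrier A" "mu A [a, \<one>] \<in> carrier A"
      using a * by (auto intro!: mu_carrier simp: numeral_2_eq_2)
    show "mu Q [\<one>\<^bsub>Q\<^esub>, C] = C"
      using quot_mu[of "[\<one>, a]"] l[of a] a * c coset_eq_iff[of "mu A [\<one>, a]" a]
      by (simp add: quot_one numeral_2_eq_2)
    show "mu Q [C, \<one>\<^bsub>Q\<^esub>] = C"
      using quot_mu[of "[a, \<one>]"] r[of a] a * c coset_eq_iff[of "mu A [a, \<one>]" a]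
      by (simp add: quot_one numeral_2_eq_2)
  next
    fix Cs assume *: "arity m (length Cs)" "length Cs \<noteq> 2" "set Cs \<subseteq> carrier Q" "\<one>\<^bsub>Q\<^esub> \<in> set Cs"
    \<comment> \<open>Splitting at the unit lets the lifted list have \<one> itself in that slot,
      and not some other element of its coset.\<close>
    obtain Cs1 Cs2 where Cs: "Cs = Cs1 @ \<one>\<^bsub>Q\<^esub> # Cs2"
      using split_list[OF *(4)] by auto
    obtain as bs where as: "Cs1 = map (\<lambda>a. I +> a) as" "set as \<subseteq> carrier A"
      "Cs2 = map (\<lambda>a. I +> a) bs" "set bs \<subseteq> carrier A"
      using *(3) Cs by (auto elim!: quot_list)
    have "mu Q Cs = I +> mu A (as @ \<one> # bs)"
      using quot_mu[of "as @ \<one> # bs"] * as Cs by (simp add: quot_one)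
    then show "mu Q Cs = \<zero>\<^bsub>Q\<^esub>"
      using o[of as bs] q0 * as Cs by simp
  qed (rule Q.operations Q.one_degree)+
qed

end

lemma (in pre_am_algebra) am_quotient_genideal: "S \<subseteq> carrier A \<Longrightarrow> am_quotient m A (am_genideal m A S)"
  by (intro am_quotient.intro pre_am_algebra_axioms am_quotient_axioms.intro am_ideal_genideal)

section \<open>The tree algebra\<close>

lemma tree_algebra_simps [simp]:
  "carrier (tree_algebra m V) = {p. Poly_Mapping.keys p \<subseteq> trees m V}"
  "\<one>\<^bsub>tree_algebra m V\<^esub> = Poly_Mapping.single Unit 1"
  "\<zero>\<^bsub>tree_algebra m V\<^esub> = 0"
  "p \<oplus>\<^bsub>tree_algebra m V\<^esub> q = p + q"
  "homog (tree_algebra m V) d = {p. Poly_Mapping.keys p \<subseteq> {t \<in> trees m V. tree_degree t = d}}"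
  by (auto simp: tree_algebra_def)

lemma lookup_tree_smult [simp]:
  "Poly_Mapping.lookup (c \<odot>\<^bsub>tree_algebra m V\<^esub> p) t = c * Poly_Mapping.lookup p t"
  by (simp add: tree_algebra_def Poly_Mapping.map.rep_eq when_def)

lemma keys_tree_smult: "Poly_Mapping.keys (c \<odot>\<^bsub>tree_algebra m V\<^esub> p) \<subseteq> Poly_Mapping.keys p"
  by (auto simp: in_keys_iff)

lemma module_tree_algebra: "module ring_of_type_algebra (tree_algebra m V)"
proof (rule module_ring_of_typeI)
  show "p \<oplus>\<^bsub>tree_algebra m V\<^esub> q \<in> carrier (tree_algebra m V)"
    if "p \<in> carrier (tree_algebra m V)" "q \<in> carrier (tree_algebra m V)" for p q
    using that Poly_Mapping.keys_add[of p q] by auto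
  show "c \<odot>\<^bsub>tree_algebra m V\<^esub> p \<in> carrier (tree_algebra m V)"
    if "p \<in> carrier (tree_algebra m V)" for c p
    using that keys_tree_smult[of m V c p] by auto
qed (auto intro!: poly_mapping_eqI simp: lookup_add algebra_simps)

lemma finsum_tree_algebra:
  assumes "\<And>i. i \<in> D \<Longrightarrow> Poly_Mapping.keys (f i) \<subseteq> trees m V"
  shows "finsum (tree_algebra m V) f D = sum f D"
proof -
  interpret module ring_of_type_algebra "tree_algebra m V"
    by (rule module_tree_algebra)
  show ?thesis
    by (rule finsum_eq_sum) (use assms in \<open>auto intro: abelian_monoid_axioms\<close>)
qed

lemma finite_listset: "(\<And>A. A \<in> set As \<Longrightarrow> finite A) \<Longrightarrow> finite (listset As)"
proof (induction As)
  case (Cons A As)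
  have "listset (A # As) = (\<lambda>(x, xs). x # xs) ` (A \<times> listset As)"
    by (auto simp: set_Cons_def)
  then show ?case
    using Cons by (simp del: listset.simps)
qed auto

lemma prod_list_map2_lookup_eq_0:
  assumes "length ts = length ps" "ts \<notin> listset (map Poly_Mapping.keys ps)"
  shows "prod_list (map2 Poly_Mapping.lookup ps ts) = (0 :: 'k::field_char_0)"
proof -
  obtain i where "i < length ps" "ts ! i \<notin> Poly_Mapping.keys (ps ! i)"
    using assms by (auto simp: in_listset_iff list_all2_conv_all_nth)
  then have "i < length (map2 Poly_Mapping.lookup ps ts)" "map2 Poly_Mapping.lookup ps ts ! i = 0"
    using assms(1) by (auto simp: in_keys_iff)
  then have "0 \<in> set (map2 Poly_Mapping.lookup ps ts)"
    by (metis nth_mem)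
  then show ?thesis
    by (simp add: prod_list_zero_iff)
qed

text \<open>The sum defining \<open>mu\<close> runs over lists drawn from the supports of the
  arguments, and supports change under addition. Read coefficient by coefficient, the operation is a
  product of coefficients without reference to supports, and linearity becomes visible.\<close>

lemma lookup_tree_mu:
  fixes ps :: "('x tree \<Rightarrow>\<^sub>0 'k::field_char_0) list"
  shows "Poly_Mapping.lookup (mu (tree_algebra m V) ps) (Node ts) =
    (if length ts = length ps then prod_list (map2 Poly_Mapping.lookup ps ts) else 0)"
    and "Poly_Mapping.lookup (mu (tree_algebra m V) ps) (Leaf d x) = 0"
    and "Poly_Mapping.lookup (mu (tree_algebra m V) ps) Unit = 0"
proof -
  let ?L = "listset (map Poly_Mapping.keys ps)"
  let ?c = "\<lambda>ts. prod_list (map2 Poly_Mapping.lookup ps ts)"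
  have fin: "finite ?L"
    by (rule finite_listset) auto
  have l: "Poly_Mapping.lookup (mu (tree_algebra m V) ps) t = (\<Sum>ts\<in>?L. if Node ts = t then ?c ts else 0)" for t
    by (simp add: tree_algebra_def lookup_sum lookup_single when_def)
  show "Poly_Mapping.lookup (mu (tree_algebra m V) ps) (Leaf d x) = 0"
    "Poly_Mapping.lookup (mu (tree_algebra m V) ps) Unit = 0"
    by (simp_all add: l)
  have "length ts = length ps" if "ts \<in> ?L"
    using that list_all2_lengthD by (fastforce simp: in_listset_iff)
  then show "Poly_Mapping.lookup (mu (tree_algebra m V) ps) (Node ts) =
      (if length ts = length ps then ?c ts else 0)"
    using fin prod_list_map2_lookup_eq_0[of ts ps] by (auto simp: l)
qed

lemma keys_tree_mu:
  assumes "t \<in> Poly_Mapping.keys (mu (tree_algebra m V) ps)"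
  obtains ts where "t = Node ts" "list_all2 (\<lambda>t p. t \<in> Poly_Mapping.keys p) ts ps"
proof (cases t)
  case (Node ts)
  have n: "length ts = length ps" "prod_list (map2 Poly_Mapping.lookup ps ts) \<noteq> 0"
    using assms unfolding Node in_keys_iff lookup_tree_mu by (auto split: if_splits)
  then have "ts \<in> listset (map Poly_Mapping.keys ps)"
    using prod_list_map2_lookup_eq_0 by blast
  then show thesis
    using that Node by (simp add: in_listset_iff list_all2_map2)
qed (use assms in \<open>auto simp: in_keys_iff lookup_tree_mu\<close>)

text \<open>Here c is the product of the coefficients in the other slots, or 0 if the number of
  subtrees is wrong; in both cases it is independent of x.\<close>

lemma lookup_tree_mu_slot:
  "\<exists>c. \<forall>x. Poly_Mapping.lookup (mu (tree_algebra m V) (xs @ x # zs)) (Node ts) =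
    (c :: 'k::field_char_0) * Poly_Mapping.lookup x (ts ! length xs)"
proof (cases "length ts = length xs + 1 + length zs")
  case True
  let ?n = "length xs"
  have ts: "ts = take ?n ts @ ts ! ?n # drop (Suc ?n) ts"
    using True by (intro id_take_nth_drop) auto
  have "Poly_Mapping.lookup (mu (tree_algebra m V) (xs @ x # zs)) (Node ts) =
    (prod_list (map2 Poly_Mapping.lookup xs (take ?n ts)) *
      prod_list (map2 Poly_Mapping.lookup zs (drop (Suc ?n) ts))) * Poly_Mapping.lookup x (ts ! ?n)" for x
  proof -
    have "map2 Poly_Mapping.lookup (xs @ x # zs) ts =
      map2 Poly_Mapping.lookup xs (take ?n ts) @ Poly_Mapping.lookup x (ts ! ?n) #
      map2 Poly_Mapping.lookup zs (drop (Suc ?n) ts)"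
      by (subst ts) (use True in \<open>simp add: zip_append\<close>)
    then show ?thesis
      using True by (simp add: lookup_tree_mu)
  qed
  then show ?thesis by blast
next
  case False
  then show ?thesis
    by (intro exI[of _ 0]) (simp add: lookup_tree_mu)
qed

lemma pre_am_algebra_tree:
  fixes V :: "('k::field_char_0, 'a) gspace"
  shows "pre_am_algebra m (tree_algebra m V)"
proof -
  let ?T = "tree_algebra m V"
  \<comment> \<open>The part of v supported on the trees of degree d; these are the projections
    required by \<open>graded_spaceI\<close>.\<close>
  define p :: "('a tree \<Rightarrow>\<^sub>0 'k) \<Rightarrow> int \<Rightarrow> ('a tree \<Rightarrow>\<^sub>0 'k)" where
    "p v d = (\<Sum>t\<in>{t \<in> Poly_Mapping.keys v. tree_degree t = d}. Poly_Mapping.single t (Poly_Mapping.lookup v t))"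
    for v d
  have p: "Poly_Mapping.lookup (p v d) t = (if tree_degree t = d then Poly_Mapping.lookup v t else 0)" for v d t
    by (auto simp: p_def lookup_sum lookup_single when_def in_keys_iff)
  have pk: "Poly_Mapping.keys (p v d) = {t \<in> Poly_Mapping.keys v. tree_degree t = d}" for v d
    by (auto simp: in_keys_iff p split: if_splits)
  interpret module ring_of_type_algebra ?T
    by (rule module_tree_algebra)
  have sub: "{d. p v d \<noteq> 0} \<subseteq> tree_degree ` Poly_Mapping.keys v" for v
  proof
    fix d assume "d \<in> {d. p v d \<noteq> 0}"
    then have "Poly_Mapping.keys (p v d) \<noteq> {}"
      by simp
    then show "d \<in> tree_degree ` Poly_Mapping.keys v"
      unfolding pk by auto
  qed
  have g: "graded_space ?T"
  proof (rule graded_spaceI[OF module_tree_algebra, where p = p])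
    fix v assume v: "v \<in> carrier ?T"
    show fin: "finite {d. p v d \<noteq> \<zero>\<^bsub>?T\<^esub>}"
      using finite_subset[OF sub[of v]] by simp
    have "(\<Oplus>\<^bsub>?T\<^esub>d\<in>{d. p v d \<noteq> \<zero>\<^bsub>?T\<^esub>}. p v d) = (\<Sum>d\<in>{d. p v d \<noteq> 0}. p v d)"
      using v by (subst finsum_tree_algebra) (auto simp: pk)
    also have "\<dots> = v"
    proof (rule poly_mapping_eqI)
      fix t
      have "Poly_Mapping.lookup (\<Sum>d\<in>{d. p v d \<noteq> 0}. p v d) t =
        (if tree_degree t \<in> {d. p v d \<noteq> 0} then Poly_Mapping.lookup v t else 0)"
        using fin by (simp add: lookup_sum p)
      also have "\<dots> = Poly_Mapping.lookup v t"
        using p[of v "tree_degree t" t] by (auto simp del: lookup_not_eq_zero_eq_in_keys)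
      finally show "Poly_Mapping.lookup (\<Sum>d\<in>{d. p v d \<noteq> 0}. p v d) t = Poly_Mapping.lookup v t" .
    qed
    finally show "v = (\<Oplus>\<^bsub>?T\<^esub>d\<in>{d. p v d \<noteq> \<zero>\<^bsub>?T\<^esub>}. p v d)" by simp
  next
    fix v d e assume v: "v \<in> homog ?T d"
    then have "Poly_Mapping.lookup v t = 0" if "tree_degree t \<noteq> d" for t
      using that by (auto simp: in_keys_iff)
    then show "p v e = (if e = d then v else \<zero>\<^bsub>?T\<^esub>)"
      by (auto intro!: poly_mapping_eqI simp: p)
  next
    show "v \<oplus>\<^bsub>?T\<^esub> w \<in> homog ?T d" if "v \<in> homog ?T d" "w \<in> homog ?T d" for d v w
      using that Poly_Mapping.keys_add[of v w] by auto
    show "c \<odot>\<^bsub>?T\<^esub> w \<in> homog ?T d" if "w \<in> homog ?T d" for c d w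
      using that keys_tree_smult[of m V c w] by auto
  qed (auto simp: pk p lookup_add intro!: poly_mapping_eqI)
  then interpret graded_space ?T .
  show ?thesis
  proof (intro pre_am_algebra.intro[OF g] pre_am_algebra_axioms.intro)
    show "\<one>\<^bsub>?T\<^esub> \<in> homog ?T 0"
      by (auto intro: trees.Unit)
    show "graded_operations m ?T (mu ?T)"
      unfolding graded_operations_def
    proof (intro conjI allI impI; (elim conjE)?)
      fix ps assume ps: "set ps \<subseteq> carrier ?T" "arity m (length ps)"
      show "mu ?T ps \<in> carrier ?T"
      proof (simp, rule subsetI)
        fix t assume "t \<in> Poly_Mapping.keys (mu ?T ps)"
        then show "t \<in> trees m V"
          by (elim keys_tree_mu)
            (use ps in \<open>fastforce intro!: trees.Node simp: list_all2_conv_all_nth in_set_conv_nth subset_iff\<close>)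
      qed
    next
      fix ds ps assume ps: "has_degs ?T ds ps" "arity m (length ps)"
      show "mu ?T ps \<in> homog ?T (sum_list ds + int (length ps) - 2)"
      proof (simp, rule subsetI)
        fix t assume "t \<in> Poly_Mapping.keys (mu ?T ps)"
        then obtain ts where ts: "t = Node ts" "list_all2 (\<lambda>t p. t \<in> Poly_Mapping.keys p) ts ps"
          by (elim keys_tree_mu)
        have l: "length ts = length ps" "length ds = length ps"
          using ts(2) ps(1) list_all2_lengthD has_degs_length by auto
        have d: "ts ! i \<in> trees m V" "tree_degree (ts ! i) = ds ! i" if "i < length ps" for i
          using ts(2) ps(1) that l unfolding has_degs_def list_all2_conv_all_nth by auto
        have "map tree_degree ts = ds"
          using d l by (intro nth_equalityI) auto
        then show "t \<in> {t \<in> trees m V. tree_degree t = sum_list ds + int (length ps) - 2}"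
          using d(1) l ps(2) ts(1) by (auto intro!: trees.Node simp: in_set_conv_nth)
      qed
    next
      fix xs x y zs
      have "Poly_Mapping.lookup (mu ?T (xs @ (x + y) # zs)) t =
        Poly_Mapping.lookup (mu ?T (xs @ x # zs) + mu ?T (xs @ y # zs)) t" for t
      proof (cases t)
        case (Node ts)
        obtain c where "Poly_Mapping.lookup (mu ?T (xs @ x # zs)) (Node ts) = c * Poly_Mapping.lookup x (ts ! length xs)" for x
          using lookup_tree_mu_slot by blast
        then show ?thesis
          by (simp add: Node lookup_add algebra_simps)
      qed (auto simp: lookup_add lookup_tree_mu)
      then show "mu ?T (xs @ (x \<oplus>\<^bsub>?T\<^esub> y) # zs) = mu ?T (xs @ x # zs) \<oplus>\<^bsub>?T\<^esub> mu ?T (xs @ y # zs)"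
        by (auto intro!: poly_mapping_eqI)
    next
      fix xs a x zs
      have "Poly_Mapping.lookup (mu ?T (xs @ (a \<odot>\<^bsub>?T\<^esub> x) # zs)) t =
        Poly_Mapping.lookup (a \<odot>\<^bsub>?T\<^esub> mu ?T (xs @ x # zs)) t" for t
      proof (cases t)
        case (Node ts)
        obtain c where "Poly_Mapping.lookup (mu ?T (xs @ x # zs)) (Node ts) = c * Poly_Mapping.lookup x (ts ! length xs)" for x
          using lookup_tree_mu_slot by blast
        then show ?thesis
          by (simp add: Node algebra_simps)
      qed (auto simp: lookup_tree_mu)
      then show "mu ?T (xs @ (a \<odot>\<^bsub>?T\<^esub> x) # zs) = a \<odot>\<^bsub>?T\<^esub> mu ?T (xs @ x # zs)"
        by (auto intro!: poly_mapping_eqI)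
    qed
  qed
qed

lemma tree_algebra_induct [consumes 1, case_names single add smult]:
  assumes p: "p \<in> carrier (tree_algebra m V)"
    and single: "\<And>t. t \<in> trees m V \<Longrightarrow> P (Poly_Mapping.single t 1)"
    and add: "\<And>p q. p \<in> carrier (tree_algebra m V) \<Longrightarrow> q \<in> carrier (tree_algebra m V) \<Longrightarrow>
      P p \<Longrightarrow> P q \<Longrightarrow> P (p \<oplus>\<^bsub>tree_algebra m V\<^esub> q)"
    and smult: "\<And>c p. p \<in> carrier (tree_algebra m V) \<Longrightarrow> P p \<Longrightarrow> P (c \<odot>\<^bsub>tree_algebra m V\<^esub> p)"
  shows "P p"
proof -
  let ?T = "tree_algebra m V"
  have s: "Poly_Mapping.single t c = c \<odot>\<^bsub>?T\<^esub> Poly_Mapping.single t 1" for t c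
    by (rule poly_mapping_eqI) (simp add: lookup_single when_def)
  have Ps: "P (Poly_Mapping.single t c)" if "t \<in> trees m V" for t c
    unfolding s[of t c] by (rule smult) (use that single in auto)
  have "P (\<Sum>t\<in>K. Poly_Mapping.single t (Poly_Mapping.lookup p t))" if "finite K" "K \<subseteq> trees m V" for K
    using that
  proof (induction K)
    case empty
    \<comment> \<open>The empty sum is reached as 0 times the tree \<open>Unit\<close>, which lies
      in \<open>trees m V\<close> for every V.\<close>
    then show ?case using Ps[OF trees.Unit, of 0] by simp
  next
    case (insert t K)
    have "Poly_Mapping.keys (\<Sum>t\<in>K. Poly_Mapping.single t (Poly_Mapping.lookup p t)) \<subseteq> trees m V"
      using insert.prems by (intro order_trans[OF Poly_Mapping.keys_sum]) auto
    then show ?case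
      using add[OF _ _ Ps insert.IH, of t "Poly_Mapping.lookup p t"] insert.hyps insert.prems by simp
  qed
  moreover have "(\<Sum>t\<in>Poly_Mapping.keys p. Poly_Mapping.single t (Poly_Mapping.lookup p t)) = p"
    by (rule poly_mapping_eqI) (auto simp: lookup_sum lookup_single when_def in_keys_iff)
  ultimately show ?thesis
    using p by (metis finite_keys mem_Collect_eq tree_algebra_simps(1))
qed

lemma tree_mu_singles:
  "mu (tree_algebra m V) (map (\<lambda>t. Poly_Mapping.single t 1) ts) = Poly_Mapping.single (Node ts) (1::'k::field_char_0)"
proof (rule poly_mapping_eqI)
  fix t
  have "prod_list (map2 Poly_Mapping.lookup (map (\<lambda>t. Poly_Mapping.single t (1::'k)) ts) us) =
    (if ts = us then 1 else 0)" if "length us = length ts" for us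
    using that by (induction us ts rule: list_induct2) (auto simp: lookup_single when_def)
  then show "Poly_Mapping.lookup (mu (tree_algebra m V) (map (\<lambda>t. Poly_Mapping.single t 1) ts)) t =
    Poly_Mapping.lookup (Poly_Mapping.single (Node ts) (1::'k)) t"
    by (cases t) (auto simp: lookup_tree_mu lookup_single when_def)
qed

section \<open>Evaluation of trees in an algebra\<close>

text \<open>In the uses below \<phi> x has the degree written at the leaf. The label is there
  because zero is homogeneous of every degree, so that \<open>tree_degree\<close> could not be read
  off from x.\<close>

primrec tree_eval :: "('k::field_char_0, 'b) amalg \<Rightarrow> ('x \<Rightarrow> 'b) \<Rightarrow> 'x tree \<Rightarrow> 'b" where
  "tree_eval B \<phi> (Leaf d x) = \<phi> x"
| "tree_eval B \<phi> Unit = \<one>\<^bsub>B\<^esub>"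
| "tree_eval B \<phi> (Node ts) = mu B (map (tree_eval B \<phi>) ts)"

text \<open>The trees form a basis, so evaluation extends linearly. Both sides of the compatibility
  with \<open>mu\<close> are multilinear, hence it suffices to compare them on lists of single
  trees, where the equation is the recursion of \<open>tree_eval\<close>.\<close>

lemma tree_algebra_extend:
  fixes V :: "('k::field_char_0, 'x) gspace"
  assumes B: "pre_am_algebra m B" and \<phi>: "\<And>d x. x \<in> homog V d \<Longrightarrow> \<phi> x \<in> homog B d"
  obtains f where "pre_am_hom m (tree_algebra m V) B f"
    "\<And>d x. x \<in> homog V d \<Longrightarrow> f (leaf d x) = \<phi> x"
proof -
  interpret B: pre_am_algebra m B by fact
  let ?T = "tree_algebra m V"
  interpret T: pre_am_algebra m ?T by (rule pre_am_algebra_tree)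
  let ?ev = "tree_eval B \<phi>"
  have ev_homog: "?ev t \<in> homog B (tree_degree t)" if "t \<in> trees m V" for t
    using that
  proof (induction rule: trees.induct)
    case (Node ts)
    have "has_degs B (map tree_degree ts) (map ?ev ts)"
      using Node.IH unfolding has_degs_def by (auto simp: list_all2_conv_all_nth)
    from B.mu_homog[OF this] Node.hyps show ?case by simp
  qed (auto simp: \<phi> B.one_degree)
  note ev = B.homog_carrier[OF ev_homog]
  define f where "f = (\<lambda>p\<in>carrier ?T. \<Oplus>\<^bsub>B\<^esub>t\<in>Poly_Mapping.keys p. Poly_Mapping.lookup p t \<odot>\<^bsub>B\<^esub> ?ev t)"
  \<comment> \<open>The sum may be taken over any finite set of trees containing the support, which
    gives p, q and p + q a common index set.\<close>
  have f: "f p = (\<Oplus>\<^bsub>B\<^esub>t\<in>K. Poly_Mapping.lookup p t \<odot>\<^bsub>B\<^esub> ?ev t)"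
    if "finite K" "Poly_Mapping.keys p \<subseteq> K" "K \<subseteq> trees m V" for p K
  proof -
    have "(\<Oplus>\<^bsub>B\<^esub>t\<in>Poly_Mapping.keys p. Poly_Mapping.lookup p t \<odot>\<^bsub>B\<^esub> ?ev t) =
      (\<Oplus>\<^bsub>B\<^esub>t\<in>K. Poly_Mapping.lookup p t \<odot>\<^bsub>B\<^esub> ?ev t)"
      by (rule B.add.finprod_mono_neutral_cong_left) (use that ev in \<open>auto simp: in_keys_iff subset_iff\<close>)
    then show ?thesis
      using that by (simp add: f_def subset_trans[OF that(2,3)])
  qed
  have f_single: "f (Poly_Mapping.single t 1) = ?ev t" if "t \<in> trees m V" for t
    using f[of "{t}" "Poly_Mapping.single t 1"] that ev by simp
  have l: "linear0 ?T B f"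
  proof (rule linear0I)
    show "f p \<in> carrier B" if "p \<in> carrier ?T" for p
      using that ev f[of "Poly_Mapping.keys p" p] by (auto intro!: B.finsum_closed)
    show "f \<in> extensional (carrier ?T)"
      by (simp add: f_def)
    show "f (p \<oplus>\<^bsub>?T\<^esub> q) = f p \<oplus>\<^bsub>B\<^esub> f q" if pq: "p \<in> carrier ?T" "q \<in> carrier ?T" for p q
    proof -
      let ?K = "Poly_Mapping.keys p \<union> Poly_Mapping.keys q"
      have e: "?ev t \<in> carrier B" if "t \<in> ?K" for t
        using that pq ev by auto
      have "f p = (\<Oplus>\<^bsub>B\<^esub>t\<in>?K. Poly_Mapping.lookup p t \<odot>\<^bsub>B\<^esub> ?ev t)"
        "f q = (\<Oplus>\<^bsub>B\<^esub>t\<in>?K. Poly_Mapping.lookup q t \<odot>\<^bsub>B\<^esub> ?ev t)"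
        "f (p + q) = (\<Oplus>\<^bsub>B\<^esub>t\<in>?K. Poly_Mapping.lookup (p + q) t \<odot>\<^bsub>B\<^esub> ?ev t)"
        using pq Poly_Mapping.keys_add[of p q] by (auto intro!: f)
      moreover have "(\<Oplus>\<^bsub>B\<^esub>t\<in>?K. Poly_Mapping.lookup (p + q) t \<odot>\<^bsub>B\<^esub> ?ev t) =
        (\<Oplus>\<^bsub>B\<^esub>t\<in>?K. Poly_Mapping.lookup p t \<odot>\<^bsub>B\<^esub> ?ev t \<oplus>\<^bsub>B\<^esub> Poly_Mapping.lookup q t \<odot>\<^bsub>B\<^esub> ?ev t)"
        by (rule B.finsum_cong') (use e in \<open>auto simp: lookup_add B.smult_add_left\<close>)
      ultimately show ?thesis
        using e by (simp add: B.finsum_addf)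
    qed
    show "f (c \<odot>\<^bsub>?T\<^esub> p) = c \<odot>\<^bsub>B\<^esub> f p" if p: "p \<in> carrier ?T" for c p
    proof -
      let ?K = "Poly_Mapping.keys p"
      have e: "?ev t \<in> carrier B" if "t \<in> ?K" for t
        using that p ev by auto
      have "f (c \<odot>\<^bsub>?T\<^esub> p) = (\<Oplus>\<^bsub>B\<^esub>t\<in>?K. Poly_Mapping.lookup (c \<odot>\<^bsub>?T\<^esub> p) t \<odot>\<^bsub>B\<^esub> ?ev t)"
        by (rule f) (use p keys_tree_smult[of m V c p] in auto)
      also have "\<dots> = (\<Oplus>\<^bsub>B\<^esub>t\<in>?K. c \<odot>\<^bsub>B\<^esub> (Poly_Mapping.lookup p t \<odot>\<^bsub>B\<^esub> ?ev t))"
        by (rule B.finsum_cong') (use e in \<open>auto simp: B.smult_smult\<close>)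
      also have "\<dots> = c \<odot>\<^bsub>B\<^esub> f p"
        using f[of ?K p] p e by (subst B.finsum_smult[symmetric]) auto
      finally show ?thesis .
    qed
    show "f p \<in> homog B d" if p: "p \<in> homog ?T d" for d p
    proof -
      have "Poly_Mapping.keys p \<subseteq> trees m V" "\<And>t. t \<in> Poly_Mapping.keys p \<Longrightarrow> ?ev t \<in> homog B d"
        using p ev_homog by auto
      then show ?thesis
        using f[of "Poly_Mapping.keys p" p] by (auto intro!: B.homog_finsum B.homog_smult)
    qed
  qed
  then interpret f: graded_map ?T B f
    by (intro graded_map.intro graded_map_axioms.intro T.graded_space_axioms B.graded_space_axioms)
  have f_mu: "f (mu ?T ps) = mu B (map f ps)" if "set ps \<subseteq> carrier ?T" "arity m (length ps)" for ps
  proof (rule slotwise_induct[where S = "(\<lambda>t. Poly_Mapping.single t 1) ` trees m V" and C = "carrier ?T"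
        and n = "length ps"])
    fix xs :: "('x tree \<Rightarrow>\<^sub>0 'k) list"
    assume xs: "set xs \<subseteq> (\<lambda>t. Poly_Mapping.single t 1) ` trees m V" "length xs = length ps"
    then have "xs \<in> lists ((\<lambda>t. Poly_Mapping.single t 1) ` trees m V)"
      by auto
    then obtain ts where ts: "xs = map (\<lambda>t. Poly_Mapping.single t 1) ts" "set ts \<subseteq> trees m V"
      unfolding lists_image by auto
    have n: "Node ts \<in> trees m V"
      using ts xs that(2) by (intro trees.Node) auto
    have "map f xs = map ?ev ts"
      using ts f_single by auto
    moreover have "f (mu ?T xs) = ?ev (Node ts)"
      unfolding ts(1) tree_mu_singles by (rule f_single[OF n])
    ultimately show "f (mu ?T xs) = mu B (map f xs)"
      by simp
  next
    fix xs x ys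
    let ?S = "(\<lambda>t. Poly_Mapping.single t (1::'k)) ` trees m V"
    assume xs: "set xs \<subseteq> carrier ?T" and x: "x \<in> carrier ?T" and ys: "set ys \<subseteq> ?S"
      and n: "length xs + 1 + length ys = length ps"
      and base: "\<And>s. s \<in> ?S \<Longrightarrow> f (mu ?T (xs @ s # ys)) = mu B (map f (xs @ s # ys))"
    have ys': "set ys \<subseteq> carrier ?T"
      using ys by auto
    have fc: "set (map f xs) \<subseteq> carrier B" "set (map f ys) \<subseteq> carrier B"
      using xs ys' f.map_carrier by blast+
    have a: "arity m (length xs + 1 + length ys)" "arity m (length (map f xs) + 1 + length (map f ys))"
      using n that(2) by auto
    note c = T.mu_carrier[of "xs @ p # ys" for p]
    show "f (mu ?T (xs @ x # ys)) = mu B (map f (xs @ x # ys))"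
      using x
    proof (induction rule: tree_algebra_induct)
      case (single t)
      then show ?case using base by blast
    next
      case (add p q)
      have "mu ?T (xs @ p # ys) \<in> carrier ?T" "mu ?T (xs @ q # ys) \<in> carrier ?T"
        using add xs ys' a by (auto intro!: c simp del: tree_algebra_simps)
      then show ?case
        using T.mu_add[OF xs ys' add(1,2) a(1)]
          B.mu_add[OF fc f.closed[OF add(1)] f.closed[OF add(2)] a(2)] f.add add
        by (simp del: tree_algebra_simps)
    next
      case (smult k p)
      have "mu ?T (xs @ p # ys) \<in> carrier ?T"
        using smult xs ys' a by (auto intro!: c simp del: tree_algebra_simps)
      then show ?case
        using T.mu_smult[OF xs ys' smult(1) a(1)] B.mu_smult[OF fc f.closed[OF smult(1)] a(2)]
          f.smult smult
        by (simp del: tree_algebra_simps)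
    qed
  qed (use that in auto)
  have "pre_am_hom m ?T B f"
    by unfold_locales (use f_single[OF trees.Unit] f_mu in auto)
  moreover have "f (leaf d x) = \<phi> x" if "x \<in> homog V d" for d x
    using f_single[OF trees.Leaf[OF that]] by (simp add: leaf_def)
  ultimately show thesis
    by (rule that)
qed


section \<open>Free algebras\<close>

lemma free_relations_carrier:
  fixes V :: "('k::field_char_0, 'x) gspace"
  assumes "graded_space V"
  shows "free_relations m V \<subseteq> carrier (tree_algebra m V)"
proof -
  interpret V: graded_space V by fact
  let ?T = "tree_algebra m V"
  interpret T: pre_am_algebra m ?T by (rule pre_am_algebra_tree)
  have leaf: "leaf d x \<in> carrier ?T" if "x \<in> homog V d" for d x
    using that by (auto simp: leaf_def intro: trees.Leaf)
  have diff: "p - q \<in> carrier ?T" if "p \<in> carrier ?T" "q \<in> carrier ?T" for p q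
    using that Poly_Mapping.keys_diff[of p q] by auto
  have two: "mu ?T [p, q] \<in> carrier ?T" if "p \<in> carrier ?T" "q \<in> carrier ?T" "arity m 2" for p q
    by (rule T.mu_carrier) (use that in \<open>auto simp: numeral_2_eq_2\<close>)
  show ?thesis
    unfolding free_relations_def Let_def
    using T.stasheff_carrier T.has_degs_carrier T.mu_carrier
    by (auto intro!: diff two leaf V.homog_add V.homog_smult T.smult_carrier T.one_carrier
        simp del: tree_algebra_simps)
qed

context
  fixes m :: enat and V :: "('k::field_char_0, 'x) gspace"
  assumes V: "graded_space V"
begin

interpretation V: graded_space V by (rule V)
interpretation T: pre_am_algebra m "tree_algebra m V" by (rule pre_am_algebra_tree)

lemma am_quotient_free: "am_quotient m (tree_algebra m V) (free_ideal m V)"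
  unfolding free_ideal_def by (rule T.am_quotient_genideal) (rule free_relations_carrier[OF V])

interpretation Q: am_quotient m "tree_algebra m V" "free_ideal m V"
  rewrites "am_quot (tree_algebra m V) (free_ideal m V) = free_am m V"
  by (rule am_quotient_free) (simp add: free_am_def)

lemma free_relations_ideal: "free_relations m V \<subseteq> free_ideal m V"
  unfolding free_ideal_def by (rule genideal_superset)

text \<open>\<open>free_relations\<close> subtracts in the type of finitely supported functions,
  ideals and cosets in the record.\<close>

lemma tree_diff: "q \<in> carrier (tree_algebra m V) \<Longrightarrow> p \<ominus>\<^bsub>tree_algebra m V\<^esub> q = p - q"
  unfolding a_minus_def by (subst T.minus_eq_smult) (auto intro!: poly_mapping_eqI simp: lookup_add lookup_minus)

lemma unital_am_algebra_free: "unital_am_algebra m (free_am m V)"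
proof (rule Q.unital_am_algebra_quot)
  let ?T = "tree_algebra m V"
  note R = subsetD[OF free_relations_ideal, unfolded free_relations_def Let_def]
  show "stasheff ?T ds as \<in> free_ideal m V" if "has_degs ?T ds as" "arity m (length as)" for ds as
    by (rule R) (use that in blast)
  show "mu ?T [\<one>\<^bsub>?T\<^esub>, a] \<ominus>\<^bsub>?T\<^esub> a \<in> free_ideal m V" if "arity m 2" "a \<in> carrier ?T" for a
    unfolding tree_diff[OF that(2)] by (rule R) (use that in blast)
  show "mu ?T [a, \<one>\<^bsub>?T\<^esub>] \<ominus>\<^bsub>?T\<^esub> a \<in> free_ideal m V" if "arity m 2" "a \<in> carrier ?T" for a
    unfolding tree_diff[OF that(2)] by (rule R) (use that in blast)
  show "mu ?T (xs @ \<one>\<^bsub>?T\<^esub> # ys) \<in> free_ideal m V"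
    if "arity m (length xs + 1 + length ys)" "length xs + length ys \<noteq> 1" "set xs \<union> set ys \<subseteq> carrier ?T"
    for xs ys
  proof (rule R, rule UnI2, rule CollectI, intro exI conjI)
    show "arity m (length (xs @ \<one>\<^bsub>?T\<^esub> # ys))"
      using that by simp
    show "length (xs @ \<one>\<^bsub>?T\<^esub> # ys) \<noteq> 2"
      using that by simp
    show "set (xs @ \<one>\<^bsub>?T\<^esub> # ys) \<subseteq> carrier ?T"
      using that T.one_carrier by (simp del: tree_algebra_simps)
  qed simp_all
qed

interpretation F: pre_am_algebra m "free_am m V"
  by (rule unital_am_algebra_pre[OF unital_am_algebra_free])

text \<open>A general element enters \<open>free_gen\<close> through its components. For a fixed
  degree the class of a leaf is linear in its label, so linearity of \<open>free_gen\<close> is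
  checked one degree at a time.\<close>

definition free_leaf :: "int \<Rightarrow> 'x \<Rightarrow> ('k, 'x) free" where
  "free_leaf d x = free_ideal m V +>\<^bsub>tree_algebra m V\<^esub> leaf d x"

lemma leaf_homog: "x \<in> homog V d \<Longrightarrow> leaf d x \<in> homog (tree_algebra m V) d"
  by (auto simp: leaf_def intro: trees.Leaf)

lemma leaf_carrier: "x \<in> homog V d \<Longrightarrow> leaf d x \<in> carrier (tree_algebra m V)"
  using T.homog_carrier[OF leaf_homog] .

lemma free_leaf_homog: "x \<in> homog V d \<Longrightarrow> free_leaf d x \<in> homog (free_am m V) d"
  using leaf_homog by (auto simp: free_leaf_def Q.quot_homog)

lemma free_leaf_add:
  assumes "x \<in> homog V d" "y \<in> homog V d"
  shows "free_leaf d (x \<oplus>\<^bsub>V\<^esub> y) = free_leaf d x \<oplus>\<^bsub>free_am m V\<^esub> free_leaf d y"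
proof -
  have "leaf d (x \<oplus>\<^bsub>V\<^esub> y) - leaf d x - leaf d y \<in> free_ideal m V"
    by (rule subsetD[OF free_relations_ideal]) (use assms in \<open>unfold free_relations_def Let_def, blast\<close>)
  then have "leaf d (x \<oplus>\<^bsub>V\<^esub> y) \<ominus>\<^bsub>tree_algebra m V\<^esub> (leaf d x \<oplus>\<^bsub>tree_algebra m V\<^esub> leaf d y) \<in> free_ideal m V"
    using assms leaf_carrier T.a_closed by (subst tree_diff) (auto simp: diff_diff_eq simp del: tree_algebra_simps(1))
  then show ?thesis
    using Q.coset_eq_iff[of "leaf d (x \<oplus>\<^bsub>V\<^esub> y)" "leaf d x \<oplus>\<^bsub>tree_algebra m V\<^esub> leaf d y"] assms
    unfolding free_leaf_def
    by (simp add: Q.quot_add leaf_carrier V.homog_add T.a_closed del: tree_algebra_simps)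
qed

lemma free_leaf_smult:
  assumes "x \<in> homog V d"
  shows "free_leaf d (c \<odot>\<^bsub>V\<^esub> x) = c \<odot>\<^bsub>free_am m V\<^esub> free_leaf d x"
proof -
  have "leaf d (c \<odot>\<^bsub>V\<^esub> x) - c \<odot>\<^bsub>tree_algebra m V\<^esub> leaf d x \<in> free_ideal m V"
    by (rule subsetD[OF free_relations_ideal]) (use assms in \<open>unfold free_relations_def Let_def, blast\<close>)
  then show ?thesis
    using Q.coset_eq_iff[of "leaf d (c \<odot>\<^bsub>V\<^esub> x)" "c \<odot>\<^bsub>tree_algebra m V\<^esub> leaf d x"] assms
    unfolding free_leaf_def
    by (simp add: Q.quot_smult leaf_carrier V.homog_smult T.smult_carrier tree_diff
        del: tree_algebra_simps)
qed

lemma free_leaf_zero: "free_leaf d \<zero>\<^bsub>V\<^esub> = \<zero>\<^bsub>free_am m V\<^esub>"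
  using free_leaf_smult[of "\<zero>\<^bsub>V\<^esub>" d 0] F.homog_carrier[OF free_leaf_homog] by simp

text \<open>A leaf labelled by zero is a basis vector of the tree algebra and vanishes only in the
  quotient; because it does, the index set may exceed the support.\<close>

lemma free_gen_eq:
  assumes "x \<in> carrier V" "finite D" "{d. component V x d \<noteq> \<zero>\<^bsub>V\<^esub>} \<subseteq> D"
  shows "free_gen m V x = (\<Oplus>\<^bsub>free_am m V\<^esub>d\<in>D. free_leaf d (component V x d))"
  unfolding free_gen_def free_leaf_def[symmetric]
  by (rule F.add.finprod_mono_neutral_cong_left)
    (use assms F.homog_carrier[OF free_leaf_homog] V.component_homog in \<open>auto simp: free_leaf_zero\<close>)

lemma free_gen_homog_eq:
  assumes "x \<in> homog V d"
  shows "free_gen m V x = free_leaf d x"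
proof -
  have "x \<in> carrier V" using assms V.homog_carrier by blast
  then have "free_gen m V x = (\<Oplus>\<^bsub>free_am m V\<^esub>e\<in>{d}. free_leaf e (component V x e))"
    by (rule free_gen_eq) (use assms in \<open>auto simp: V.component_homog_eq\<close>)
  then show ?thesis
    using assms F.homog_carrier[OF free_leaf_homog] by (simp add: V.component_homog_eq)
qed

lemma linear0_free_gen: "linear0 V (free_am m V) (restrict (free_gen m V) (carrier V))"
proof -
  note c = F.homog_carrier[OF free_leaf_homog[OF V.component_homog]]
  have closed: "free_gen m V x \<in> carrier (free_am m V)" if "x \<in> carrier V" for x
    using free_gen_eq[OF that V.component_finite[OF that] order_refl] c that
    by (auto intro!: F.finsum_closed)
  have add: "free_gen m V (x \<oplus>\<^bsub>V\<^esub> y) = free_gen m V x \<oplus>\<^bsub>free_am m V\<^esub> free_gen m V y"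
    if "x \<in> carrier V" "y \<in> carrier V" for x y
  proof -
    let ?D = "{d. component V x d \<noteq> \<zero>\<^bsub>V\<^esub>} \<union> {d. component V y d \<noteq> \<zero>\<^bsub>V\<^esub>}"
    have D: "finite ?D" using that V.component_finite by auto
    have "free_gen m V (x \<oplus>\<^bsub>V\<^esub> y) = (\<Oplus>\<^bsub>free_am m V\<^esub>d\<in>?D. free_leaf d (component V (x \<oplus>\<^bsub>V\<^esub> y) d))"
      by (rule free_gen_eq[OF _ D]) (use that in \<open>auto simp: V.component_add\<close>)
    also have "\<dots> = (\<Oplus>\<^bsub>free_am m V\<^esub>d\<in>?D. free_leaf d (component V x d) \<oplus>\<^bsub>free_am m V\<^esub> free_leaf d (component V y d))"
      by (rule F.finsum_cong') (use that c in \<open>auto simp: V.component_add free_leaf_add V.component_homog\<close>)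
    also have "\<dots> = free_gen m V x \<oplus>\<^bsub>free_am m V\<^esub> free_gen m V y"
      using free_gen_eq[OF that(1) D] free_gen_eq[OF that(2) D] that c by (subst F.finsum_addf) auto
    finally show ?thesis .
  qed
  have smult: "free_gen m V (a \<odot>\<^bsub>V\<^esub> x) = a \<odot>\<^bsub>free_am m V\<^esub> free_gen m V x" if "x \<in> carrier V" for a x
  proof -
    let ?D = "{d. component V x d \<noteq> \<zero>\<^bsub>V\<^esub>}"
    have D: "finite ?D" using that V.component_finite by auto
    have "free_gen m V (a \<odot>\<^bsub>V\<^esub> x) = (\<Oplus>\<^bsub>free_am m V\<^esub>d\<in>?D. free_leaf d (component V (a \<odot>\<^bsub>V\<^esub> x) d))"
      by (rule free_gen_eq[OF _ D]) (use that in \<open>auto simp: V.component_smult\<close>)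
    also have "\<dots> = (\<Oplus>\<^bsub>free_am m V\<^esub>d\<in>?D. a \<odot>\<^bsub>free_am m V\<^esub> free_leaf d (component V x d))"
      by (rule F.finsum_cong') (use that c in \<open>auto simp: V.component_smult free_leaf_smult V.component_homog\<close>)
    also have "\<dots> = a \<odot>\<^bsub>free_am m V\<^esub> free_gen m V x"
      using free_gen_eq[OF that D order_refl] that c by (subst F.finsum_smult[symmetric]) auto
    finally show ?thesis .
  qed
  show ?thesis
    by (rule linear0I) (auto simp: closed add smult V.homog_carrier free_gen_homog_eq free_leaf_homog)
qed

lemma graded_map_free_gen: "graded_map V (free_am m V) (restrict (free_gen m V) (carrier V))"
  by (intro graded_map.intro graded_map_axioms.intro V F.graded_space_axioms linear0_free_gen)

section \<open>Induction, universal property and functoriality of free algebras\<close>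

text \<open>Linearity reduces the claim to classes of single trees, and a tree is built from leaves
  and units by grafting, which becomes \<open>mu\<close> in the quotient.\<close>

lemma free_induct [consumes 1, case_names gen one add smult mu]:
  assumes a: "a \<in> carrier (free_am m V)"
    and gen: "\<And>x. x \<in> carrier V \<Longrightarrow> P (free_gen m V x)"
    and one: "P \<one>\<^bsub>free_am m V\<^esub>"
    and add: "\<And>a b. a \<in> carrier (free_am m V) \<Longrightarrow> b \<in> carrier (free_am m V) \<Longrightarrow> P a \<Longrightarrow> P b \<Longrightarrow>
      P (a \<oplus>\<^bsub>free_am m V\<^esub> b)"
    and smult: "\<And>c a. a \<in> carrier (free_am m V) \<Longrightarrow> P a \<Longrightarrow> P (c \<odot>\<^bsub>free_am m V\<^esub> a)"
    and mu: "\<And>as. set as \<subseteq> carrier (free_am m V) \<Longrightarrow> arity m (length as) \<Longrightarrow> (\<And>a. a \<in> set as \<Longrightarrow> P a) \<Longrightarrow>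
      P (mu (free_am m V) as)"
  shows "P a"
proof -
  let ?q = "\<lambda>p. free_ideal m V +>\<^bsub>tree_algebra m V\<^esub> p"
  have tree: "P (?q (Poly_Mapping.single t 1))" if "t \<in> trees m V" for t
    using that
  proof (induction rule: trees.induct)
    case (Leaf x d)
    then show ?case
      using gen[OF V.homog_carrier[OF Leaf]] free_gen_homog_eq[OF Leaf] by (simp add: free_leaf_def leaf_def)
  next
    case Unit
    then show ?case using one by (simp add: Q.quot_one)
  next
    case (Node ts)
    let ?ps = "map (\<lambda>t. Poly_Mapping.single t (1::'k)) ts"
    have ps: "set ?ps \<subseteq> carrier (tree_algebra m V)" "arity m (length ?ps)"
      using Node by auto
    have "P (mu (free_am m V) (map ?q ?ps))"
      by (rule mu) (use Node ps in \<open>auto simp: Q.quot_carrier\<close>)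
    then show ?case
      unfolding Q.quot_mu[OF ps] tree_mu_singles .
  qed
  obtain p where p: "p \<in> carrier (tree_algebra m V)" "a = ?q p"
    using a by (rule Q.quot_carrierE)
  have qc: "?q p \<in> carrier (free_am m V)" if "p \<in> carrier (tree_algebra m V)" for p
    using that by (auto simp: Q.quot_carrier)
  show ?thesis
    unfolding p(2) using p(1)
  proof (induction rule: tree_algebra_induct)
    case (single t)
    then show ?case by (rule tree)
  next
    case (add p q)
    then show ?case
      using assms(4)[OF qc qc, of p q] Q.quot_add[of p q] by (simp del: tree_algebra_simps)
  next
    case (smult c p)
    then show ?case
      using assms(5)[OF qc, of p c] Q.quot_smult[of p c] by (simp del: tree_algebra_simps)
  qed
qed

text \<open>Evaluation in B kills each family of relations for its own reason: those on labels
  because \<phi> is linear, the others because B satisfies the axioms of a unital A(m)-algebra.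
  Hence it descends to the quotient.\<close>

lemma free_extend:
  assumes B: "unital_am_algebra m B" and \<phi>: "linear0 V B \<phi>"
  obtains h where "am_hom m (free_am m V) B h" "\<And>x. x \<in> carrier V \<Longrightarrow> h (free_gen m V x) = \<phi> x"
proof -
  let ?T = "tree_algebra m V"
  interpret B: unital_am_algebra m B by fact
  interpret B: pre_am_algebra m B by (rule unital_am_algebra_pre[OF B])
  interpret \<phi>: graded_map V B \<phi>
    by (intro graded_map.intro graded_map_axioms.intro V B.graded_space_axioms \<phi>)
  obtain f where f: "pre_am_hom m ?T B f" and fl: "\<And>d x. x \<in> homog V d \<Longrightarrow> f (leaf d x) = \<phi> x"
    by (rule tree_algebra_extend[OF B.pre_am_algebra_axioms \<phi>.homog]) auto
  interpret f: pre_am_hom m ?T B f by (rule f)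
  have diff: "f (p - q) = f p \<ominus>\<^bsub>B\<^esub> f q" "p - q \<in> carrier ?T" if "p \<in> carrier ?T" "q \<in> carrier ?T" for p q
    using f.diff[OF that] tree_diff[OF that(2), of p] that T.minus_closed[OF that]
    by (simp_all del: tree_algebra_simps)
  have zeroB: "b \<ominus>\<^bsub>B\<^esub> b = \<zero>\<^bsub>B\<^esub>" if "b \<in> carrier B" for b
    using that B.diff_eq_zero_iff by simp
  have two: "mu ?T [p, q] \<in> carrier ?T" "f (mu ?T [p, q]) = mu B [f p, f q]"
    if "p \<in> carrier ?T" "q \<in> carrier ?T" "arity m 2" for p q
    using that T.mu_carrier[of "[p, q]"] f.mu[of "[p, q]"]
    by (auto simp: numeral_2_eq_2 simp del: tree_algebra_simps)
  have "f r = \<zero>\<^bsub>B\<^esub>" if "r \<in> free_relations m V" for r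
    using that unfolding free_relations_def Let_def
  proof (elim UnE; elim CollectE exE conjE)
    fix d x y assume r: "r = leaf d (x \<oplus>\<^bsub>V\<^esub> y) - leaf d x - leaf d y" and xy: "x \<in> homog V d" "y \<in> homog V d"
    have "f r = \<phi> (x \<oplus>\<^bsub>V\<^esub> y) \<ominus>\<^bsub>B\<^esub> \<phi> x \<ominus>\<^bsub>B\<^esub> \<phi> y"
      using xy V.homog_add[OF xy] by (simp add: r diff fl leaf_carrier del: tree_algebra_simps)
    also have "\<dots> = (\<phi> x \<oplus>\<^bsub>B\<^esub> \<phi> y) \<ominus>\<^bsub>B\<^esub> (\<phi> x \<oplus>\<^bsub>B\<^esub> \<phi> y)"
      using xy V.homog_carrier by (simp add: \<phi>.add a_minus_def B.minus_add B.a_assoc)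
    finally show ?thesis
      using xy V.homog_carrier zeroB by simp
  next
    fix c d x assume r: "r = leaf d (c \<odot>\<^bsub>V\<^esub> x) - c \<odot>\<^bsub>?T\<^esub> leaf d x" and x: "x \<in> homog V d"
    have "f r = \<phi> (c \<odot>\<^bsub>V\<^esub> x) \<ominus>\<^bsub>B\<^esub> c \<odot>\<^bsub>B\<^esub> \<phi> x"
      using x V.homog_smult[OF x]
      by (simp add: r diff fl leaf_carrier T.smult_carrier f.smult del: tree_algebra_simps)
    then show ?thesis
      using x V.homog_carrier zeroB by (simp add: \<phi>.smult)
  next
    fix ds ps assume "r = stasheff ?T ds ps" "has_degs ?T ds ps" "arity m (length ps)"
    then show ?thesis
      using f.stasheff[of ps ds] B.stasheff_identity[of ds "map f ps"] f.has_degs T.has_degs_carrier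
      by (simp del: tree_algebra_simps)
  next
    fix p assume "r = mu ?T [\<one>\<^bsub>?T\<^esub>, p] - p" "p \<in> carrier ?T" "arity m 2"
    then show ?thesis
      using f.one by (simp add: diff two B.one_left zeroB T.one_carrier del: tree_algebra_simps)
  next
    fix p assume "r = mu ?T [p, \<one>\<^bsub>?T\<^esub>] - p" "p \<in> carrier ?T" "arity m 2"
    then show ?thesis
      using f.one by (simp add: diff two B.one_right zeroB T.one_carrier del: tree_algebra_simps)
  next
    fix ps assume r: "r = mu ?T ps" and ps: "arity m (length ps)" "length ps \<noteq> 2" "set ps \<subseteq> carrier ?T"
      "\<one>\<^bsub>?T\<^esub> \<in> set ps"
    have "\<one>\<^bsub>B\<^esub> \<in> set (map f ps)"
      using ps(4) f.one by force
    then have "mu B (map f ps) = \<zero>\<^bsub>B\<^esub>"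
      using B.one_other[of "map f ps"] f.map_carrier ps by simp
    then show ?thesis
      using f.mu[of ps] ps r by simp
  qed
  then have "f ` free_ideal m V \<subseteq> {\<zero>\<^bsub>B\<^esub>}"
    unfolding free_ideal_def
    by (intro f.image_genideal_subset B.am_ideal_zero free_relations_carrier[OF V]) auto
  then have "f x = \<zero>\<^bsub>B\<^esub>" if "x \<in> free_ideal m V" for x
    using that by auto
  then obtain h where h: "pre_am_hom m (free_am m V) B h"
    and hq: "\<And>a. a \<in> carrier ?T \<Longrightarrow> h (free_ideal m V +>\<^bsub>?T\<^esub> a) = f a"
    using Q.pre_am_hom_factor[OF f] by blast
  interpret h: pre_am_hom m "free_am m V" B h by (rule h)
  have "h (free_gen m V x) = \<phi> x" if x: "x \<in> carrier V" for x
  proof -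
    let ?D = "{d. component V x d \<noteq> \<zero>\<^bsub>V\<^esub>}"
    have hl: "h (free_leaf d (component V x d)) = \<phi> (component V x d)" for d
      using V.component_homog[OF x] by (simp add: free_leaf_def hq leaf_carrier fl del: tree_algebra_simps)
    have "h (free_gen m V x) = (\<Oplus>\<^bsub>B\<^esub>d\<in>?D. h (free_leaf d (component V x d)))"
      unfolding free_gen_eq[OF x V.component_finite[OF x] order_refl]
      by (rule h.finsum) (use F.homog_carrier[OF free_leaf_homog[OF V.component_homog[OF x]]] in auto)
    also have "\<dots> = \<phi> (\<Oplus>\<^bsub>V\<^esub>d\<in>?D. component V x d)"
      unfolding hl by (rule \<phi>.finsum[symmetric]) (use V.component_carrier[OF x] in auto)
    finally show ?thesis
      using V.component_sum[OF x] by simp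
  qed
  moreover have "am_hom m (free_am m V) B h"
    unfolding am_hom_iff using unital_am_algebra_free B h by blast
  ultimately show thesis
    using that by blast
qed

lemma free_hom_eqI:
  assumes f: "am_hom m (free_am m V) B f" and g: "am_hom m (free_am m V) B g"
    and eq: "\<And>x. x \<in> carrier V \<Longrightarrow> f (free_gen m V x) = g (free_gen m V x)"
  shows "f = g"
proof (rule am_hom_eqI[OF f g])
  interpret f: pre_am_hom m "free_am m V" B f using f by (simp add: am_hom_iff)
  interpret g: pre_am_hom m "free_am m V" B g using g by (simp add: am_hom_iff)
  fix a assume "a \<in> carrier (free_am m V)"
  then show "f a = g a"
  proof (induction rule: free_induct)
    case (mu as)
    then have "map f as = map g as" by simp
    then have "mu B (map f as) = mu B (map g as)" by (simp only:)
    then show ?case using mu f.mu g.mu by simp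
  qed (auto simp: eq f.one g.one f.add g.add f.smult g.smult)
qed

end

text \<open>\<open>free_map\<close> is a definite description. Existence is
  \<open>free_extend\<close> for the composite of \<phi> with the generator map of the target,
  uniqueness is \<open>free_hom_eqI\<close>.\<close>

lemma free_map:
  fixes V :: "('k::field_char_0, 'x) gspace" and W :: "('k, 'y) gspace"
  assumes V: "graded_space V" and W: "graded_space W" and \<phi>: "linear0 V W (restrict \<phi> (carrier V))"
  shows "am_hom m (free_am m V) (free_am m W) (free_map m V W \<phi>)"
    and "\<And>x. x \<in> carrier V \<Longrightarrow> free_map m V W \<phi> (free_gen m V x) = free_gen m W (\<phi> x)"
proof -
  have cl: "\<phi> x \<in> carrier W" if "x \<in> carrier V" for x
    using \<phi> that by (auto simp: linear0_def)
  have l: "linear0 V (free_am m W) (compose (carrier V) (restrict (free_gen m W) (carrier W)) (restrict \<phi> (carrier V)))"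
    by (rule linear0_compose[OF V \<phi> linear0_free_gen[OF W]])
  obtain h where h: "am_hom m (free_am m V) (free_am m W) h"
    "\<And>x. x \<in> carrier V \<Longrightarrow> h (free_gen m V x) = free_gen m W (\<phi> x)"
    using free_extend[OF V unital_am_algebra_free[OF W] l] cl by (auto simp: compose_eq)
  have "\<exists>!h. am_hom m (free_am m V) (free_am m W) h \<and>
    (\<forall>x\<in>carrier V. h (free_gen m V x) = free_gen m W (\<phi> x))"
  proof (rule ex1I[of _ h])
    show "g = h" if "am_hom m (free_am m V) (free_am m W) g \<and>
      (\<forall>x\<in>carrier V. g (free_gen m V x) = free_gen m W (\<phi> x))" for g
      using that h by (intro free_hom_eqI[OF V]) auto
  qed (use h in blast)
  from theI'[OF this] show "am_hom m (free_am m V) (free_am m W) (free_map m V W \<phi>)"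
    "\<And>x. x \<in> carrier V \<Longrightarrow> free_map m V W \<phi> (free_gen m V x) = free_gen m W (\<phi> x)"
    unfolding free_map_def by auto
qed

section \<open>Presentations\<close>

text \<open>A \<open>presentation\<close> record carries no axioms. If a relation lay outside the
  free algebra, no ideal would contain it and the intersection defining \<open>rel_ideal\<close>
  would be the whole type.\<close>

definition well_formed :: "enat \<Rightarrow> ('k::field_char_0, 'x) presentation \<Rightarrow> bool" where
  "well_formed m P \<longleftrightarrow> graded_space (gens P) \<and> rels P \<subseteq> carrier (free_am m (gens P))"

context
  fixes m :: enat and P :: "('k::field_char_0, 'x) presentation"
  assumes P: "well_formed m P"
begin

lemma graded_space_gens: "graded_space (gens P)" and rels_carrier: "rels P \<subseteq> carrier (free_am m (gens P))"
  using P by (auto simp: well_formed_def)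

interpretation V: graded_space "gens P" by (rule graded_space_gens)
interpretation F: unital_am_algebra m "free_am m (gens P)"
  by (rule unital_am_algebra_free[OF graded_space_gens])
interpretation F: pre_am_algebra m "free_am m (gens P)"
  by (rule unital_am_algebra_pre[OF F.unital_am_algebra_axioms])

lemma am_quotient_alg: "am_quotient m (free_am m (gens P)) (rel_ideal m P)"
  unfolding rel_ideal_def by (rule F.am_quotient_genideal[OF rels_carrier])

interpretation Q: am_quotient m "free_am m (gens P)" "rel_ideal m P"
  rewrites "am_quot (free_am m (gens P)) (rel_ideal m P) = alg m P"
  by (rule am_quotient_alg) (simp add: alg_def)

lemma am_ideal_rel_ideal: "am_ideal m (free_am m (gens P)) (rel_ideal m P)"
  by (rule Q.ideal)

lemma rels_rel_ideal: "rels P \<subseteq> rel_ideal m P"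
  unfolding rel_ideal_def by (rule genideal_superset)

lemma unital_am_algebra_alg: "unital_am_algebra m (alg m P)"
proof (rule Q.unital_am_algebra_quot)
  show "mu (free_am m (gens P)) (xs @ \<one>\<^bsub>free_am m (gens P)\<^esub> # ys) \<in> rel_ideal m P"
    if "arity m (length xs + 1 + length ys)" "length xs + length ys \<noteq> 1"
      "set xs \<union> set ys \<subseteq> carrier (free_am m (gens P))" for xs ys
    using F.one_other[of "xs @ \<one>\<^bsub>free_am m (gens P)\<^esub> # ys"] that Q.subspace(2) by simp
  have "a \<ominus>\<^bsub>free_am m (gens P)\<^esub> a \<in> rel_ideal m P" if "a \<in> carrier (free_am m (gens P))" for a
    using F.diff_eq_zero_iff[OF that that] Q.subspace(2) by simp
  then show "arity m 2 \<Longrightarrow> a \<in> carrier (free_am m (gens P)) \<Longrightarrow>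
      mu (free_am m (gens P)) [\<one>\<^bsub>free_am m (gens P)\<^esub>, a] \<ominus>\<^bsub>free_am m (gens P)\<^esub> a \<in> rel_ideal m P"
    "arity m 2 \<Longrightarrow> a \<in> carrier (free_am m (gens P)) \<Longrightarrow>
      mu (free_am m (gens P)) [a, \<one>\<^bsub>free_am m (gens P)\<^esub>] \<ominus>\<^bsub>free_am m (gens P)\<^esub> a \<in> rel_ideal m P" for a
    by (simp_all add: F.one_left F.one_right)
qed (use F.stasheff_identity Q.subspace(2) in auto)

interpretation A: pre_am_algebra m "alg m P"
  by (rule unital_am_algebra_pre[OF unital_am_algebra_alg])

definition alg_proj where
  "alg_proj = (\<lambda>a\<in>carrier (free_am m (gens P)). rel_ideal m P +>\<^bsub>free_am m (gens P)\<^esub> a)"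

lemma am_hom_alg_proj: "am_hom m (free_am m (gens P)) (alg m P) alg_proj"
  unfolding am_hom_iff alg_proj_def
  using Q.pre_am_hom_quot F.unital_am_algebra_axioms unital_am_algebra_alg by blast

interpretation q: pre_am_hom m "free_am m (gens P)" "alg m P" alg_proj
  using am_hom_alg_proj by (simp add: am_hom_iff)

lemma alg_proj_eq_zero: "r \<in> rel_ideal m P \<Longrightarrow> alg_proj r = \<zero>\<^bsub>alg m P\<^esub>"
  using Q.ideal_carrier[of r] Q.coset_eq_iff[of r "\<zero>\<^bsub>free_am m (gens P)\<^esub>"]
  by (simp add: alg_proj_def Q.quot_zero a_minus_def F.minus_eq_smult)

lemma free_gen_carrier: "x \<in> carrier (gens P) \<Longrightarrow> free_gen m (gens P) x \<in> carrier (free_am m (gens P))"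
  using linear0_free_gen[OF graded_space_gens, of m] by (auto simp: linear0_def PiE_iff)

lemma alg_proj_free_gen: "x \<in> carrier (gens P) \<Longrightarrow> alg_proj (free_gen m (gens P) x) = gen m P x"
  by (simp add: alg_proj_def gen_def free_gen_carrier)

lemma linear0_gen: "linear0 (gens P) (alg m P) (restrict (gen m P) (carrier (gens P)))"
proof -
  have "compose (carrier (gens P)) alg_proj (restrict (free_gen m (gens P)) (carrier (gens P))) =
    restrict (gen m P) (carrier (gens P))"
    by (auto simp: fun_eq_iff compose_def alg_proj_free_gen)
  then show ?thesis
    using linear0_compose[OF graded_space_gens linear0_free_gen[OF graded_space_gens] q.linear0] by simp
qed

lemma gen_carrier: "x \<in> carrier (gens P) \<Longrightarrow> gen m P x \<in> carrier (alg m P)"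
  and gen_add: "x \<in> carrier (gens P) \<Longrightarrow> y \<in> carrier (gens P) \<Longrightarrow>
    gen m P (x \<oplus>\<^bsub>gens P\<^esub> y) = gen m P x \<oplus>\<^bsub>alg m P\<^esub> gen m P y"
  using linear0_gen by (auto simp: linear0_def PiE_iff)

lemma alg_induct [consumes 1, case_names gen one add smult mu]:
  assumes a: "a \<in> carrier (alg m P)"
    and gen: "\<And>x. x \<in> carrier (gens P) \<Longrightarrow> R (gen m P x)"
    and one: "R \<one>\<^bsub>alg m P\<^esub>"
    and add: "\<And>a b. a \<in> carrier (alg m P) \<Longrightarrow> b \<in> carrier (alg m P) \<Longrightarrow> R a \<Longrightarrow> R b \<Longrightarrow>
      R (a \<oplus>\<^bsub>alg m P\<^esub> b)"
    and smult: "\<And>c a. a \<in> carrier (alg m P) \<Longrightarrow> R a \<Longrightarrow> R (c \<odot>\<^bsub>alg m P\<^esub> a)"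
    and mu: "\<And>as. set as \<subseteq> carrier (alg m P) \<Longrightarrow> arity m (length as) \<Longrightarrow> (\<And>a. a \<in> set as \<Longrightarrow> R a) \<Longrightarrow>
      R (mu (alg m P) as)"
  shows "R a"
proof -
  let ?q = "\<lambda>p. rel_ideal m P +>\<^bsub>free_am m (gens P)\<^esub> p"
  obtain p where p: "p \<in> carrier (free_am m (gens P))" "a = ?q p"
    using a by (rule Q.quot_carrierE)
  have qc: "?q p \<in> carrier (alg m P)" if "p \<in> carrier (free_am m (gens P))" for p
    using that by (auto simp: Q.quot_carrier)
  show ?thesis
    unfolding p(2) using p(1)
  proof (induction rule: free_induct[OF graded_space_gens, consumes 1, case_names gen one add smult mu])
    case (gen x)
    then show ?case using assms(2) by (simp add: gen_def)
  next
    case one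
    then show ?case using assms(3) by (simp add: Q.quot_one)
  next
    case (add p q)
    then show ?case using assms(4)[OF qc qc, of p q] Q.quot_add[of p q] by simp
  next
    case (smult c p)
    then show ?case using assms(5)[OF qc, of p c] Q.quot_smult[of p c] by simp
  next
    case (mu ps)
    have "R (amalg.mu (alg m P) (map ?q ps))"
      by (rule assms(6)) (use mu qc in auto)
    then show ?case using Q.quot_mu[OF mu(1,2)] by simp
  qed
qed

lemma alg_extend:
  assumes h: "am_hom m (free_am m (gens P)) B h" and rels: "\<And>r. r \<in> rels P \<Longrightarrow> h r = \<zero>\<^bsub>B\<^esub>"
  obtains g where "am_hom m (alg m P) B g"
    "\<And>x. x \<in> carrier (gens P) \<Longrightarrow> g (gen m P x) = h (free_gen m (gens P) x)"
proof -
  interpret h: pre_am_hom m "free_am m (gens P)" B h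
    using h by (simp add: am_hom_iff)
  have "h ` rel_ideal m P \<subseteq> {\<zero>\<^bsub>B\<^esub>}"
    unfolding rel_ideal_def
    by (intro h.image_genideal_subset h.B.am_ideal_zero rels_carrier) (use rels in auto)
  then have "h x = \<zero>\<^bsub>B\<^esub>" if "x \<in> rel_ideal m P" for x
    using that by auto
  then obtain g where g: "pre_am_hom m (alg m P) B g"
    "\<And>a. a \<in> carrier (free_am m (gens P)) \<Longrightarrow> g (rel_ideal m P +>\<^bsub>free_am m (gens P)\<^esub> a) = h a"
    using Q.pre_am_hom_factor[OF h.pre_am_hom_axioms] by blast
  have "am_hom m (alg m P) B g"
    using g(1) h unital_am_algebra_alg by (simp add: am_hom_iff)
  moreover have "g (gen m P x) = h (free_gen m (gens P) x)" if "x \<in> carrier (gens P)" for x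
    using g(2) free_gen_carrier that by (auto simp: gen_def)
  ultimately show thesis by (rule that)
qed

lemma alg_hom_eqI:
  assumes f: "am_hom m (alg m P) B f" and g: "am_hom m (alg m P) B g"
    and eq: "\<And>x. x \<in> carrier (gens P) \<Longrightarrow> f (gen m P x) = g (gen m P x)"
  shows "f = g"
proof (rule am_hom_eqI[OF f g])
  interpret f: pre_am_hom m "alg m P" B f using f by (simp add: am_hom_iff)
  interpret g: pre_am_hom m "alg m P" B g using g by (simp add: am_hom_iff)
  fix a assume "a \<in> carrier (alg m P)"
  then show "f a = g a"
  proof (induction rule: alg_induct)
    case (mu as)
    then have "map f as = map g as" by simp
    then have "amalg.mu B (map f as) = amalg.mu B (map g as)" by (simp only:)
    then show ?case using mu f.mu g.mu by simp
  qed (auto simp: eq f.one g.one f.add g.add f.smult g.smult)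
qed

text \<open>Both are determined by their values on generators. Each coalgebra identity is proved
  through this: its two sides are exhibited as morphisms induced by one map of generators.\<close>

lemma is_induced_unique: "is_induced m P Q \<phi> f \<Longrightarrow> is_induced m P Q \<phi> g \<Longrightarrow> f = g"
  unfolding is_induced_def by (rule alg_hom_eqI) auto

lemma is_induced_imp:
  assumes "is_induced m P Q \<phi> f"
  shows "induces m P Q \<phi>" "induced m P Q \<phi> = f"
  unfolding induces_def induced_def using assms is_induced_unique by (blast intro: the_equality)+

end

text \<open>\<open>free_map\<close> followed by the projection onto the target algebra kills the
  relations of P, so it factors through the algebra presented by P.\<close>

lemma inducesI:
  assumes P: "well_formed m P" and Q: "well_formed m Q"
    and \<phi>: "linear0 (gens P) (gens Q) (restrict \<phi> (carrier (gens P)))"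
    and rels: "free_map m (gens P) (gens Q) \<phi> ` rels P \<subseteq> rel_ideal m Q"
  shows "\<exists>f. is_induced m P Q \<phi> f"
proof -
  let ?F = "free_am m (gens P)"
  note fm = free_map[OF graded_space_gens[OF P] graded_space_gens[OF Q] \<phi>, where m = m]
  let ?h = "compose (carrier ?F) (alg_proj m Q) (free_map m (gens P) (gens Q) \<phi>)"
  have h: "am_hom m ?F (alg m Q) ?h"
    by (rule am_hom_compose[OF fm(1) am_hom_alg_proj[OF Q]])
  have cl: "\<phi> x \<in> carrier (gens Q)" if "x \<in> carrier (gens P)" for x
    using \<phi> that by (auto simp: linear0_def)
  have "?h r = \<zero>\<^bsub>alg m Q\<^esub>" if "r \<in> rels P" for r
    using that rels rels_carrier[OF P] alg_proj_eq_zero[OF Q] by (auto simp: compose_def)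
  then obtain g where g: "am_hom m (alg m P) (alg m Q) g"
    "\<And>x. x \<in> carrier (gens P) \<Longrightarrow> g (gen m P x) = ?h (free_gen m (gens P) x)"
    using alg_extend[OF P h] by blast
  have "is_induced m P Q \<phi> g"
    unfolding is_induced_def using g fm(2) free_gen_carrier[OF P] cl
    by (auto simp: compose_eq alg_proj_free_gen[OF Q])
  then show ?thesis by blast
qed

lemma is_induced_compose:
  assumes P: "well_formed m P" and f: "is_induced m P Q \<phi> f" and g: "is_induced m Q R \<psi> g"
    and \<phi>: "\<And>x. x \<in> carrier (gens P) \<Longrightarrow> \<phi> x \<in> carrier (gens Q)"
  shows "is_induced m P R (\<lambda>x. \<psi> (\<phi> x)) (compose (carrier (alg m P)) g f)"
  using assms am_hom_compose gen_carrier[OF P] unfolding is_induced_def by (auto simp: compose_eq)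

lemma is_induced_id:
  assumes P: "well_formed m P" and "\<And>x. x \<in> carrier (gens P) \<Longrightarrow> \<phi> x = x"
  shows "is_induced m P P \<phi> (\<lambda>a\<in>carrier (alg m P). a)"
  unfolding is_induced_def using am_hom_id[OF unital_am_algebra_alg[OF P]] gen_carrier[OF P] assms
  by simp


section \<open>\<open>L(m)\<close>-algebras and their enveloping algebras\<close>

text \<open>Morphisms are extensional, while \<open>fst\<close>, pairings and composites written as
  lambda terms are not. Restricting inside the definition lets such terms stand for morphisms; only
  their values on the carrier count.\<close>

definition lm_map ::
  "enat \<Rightarrow> ('k::field_char_0, 'v) lalg \<Rightarrow> ('k, 'w) lalg \<Rightarrow> ('v \<Rightarrow> 'w) \<Rightarrow> bool" where
  "lm_map m L L' f \<longleftrightarrow> lm_hom m L L' (restrict f (carrier L))"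

lemma lm_map_iff:
  "lm_map m L L' f \<longleftrightarrow> lm_algebra m L \<and> lm_algebra m L' \<and>
     (\<forall>x\<in>carrier L. f x \<in> carrier L') \<and>
     (\<forall>x\<in>carrier L. \<forall>y\<in>carrier L. f (x \<oplus>\<^bsub>L\<^esub> y) = f x \<oplus>\<^bsub>L'\<^esub> f y) \<and>
     (\<forall>a. \<forall>x\<in>carrier L. f (a \<odot>\<^bsub>L\<^esub> x) = a \<odot>\<^bsub>L'\<^esub> f x) \<and>
     (\<forall>d. \<forall>x\<in>homog L d. f x \<in> homog L' d) \<and>
     (\<forall>xs. set xs \<subseteq> carrier L \<and> arity m (length xs) \<longrightarrow> f (br L xs) = br L' (map f xs))"
proof (cases "lm_algebra m L")
  case True
  then interpret lm_algebra m L .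
  have "map (restrict f (carrier L)) xs = map f xs" if "set xs \<subseteq> carrier L" for xs
    using that by auto
  then have "(\<forall>xs. set xs \<subseteq> carrier L \<and> arity m (length xs) \<longrightarrow>
      restrict f (carrier L) (br L xs) = br L' (map (restrict f (carrier L)) xs)) \<longleftrightarrow>
    (\<forall>xs. set xs \<subseteq> carrier L \<and> arity m (length xs) \<longrightarrow> f (br L xs) = br L' (map f xs))"
    using operations_closed[OF operations] by (metis restrict_apply')
  then show ?thesis
    unfolding lm_map_def lm_hom_def linear0_def
    using homog_carrier by (auto simp: PiE_iff image_subset_iff)
qed (simp add: lm_map_def lm_hom_def)

lemma map_carrier_subset:
  "set xs \<subseteq> carrier K \<Longrightarrow> (\<And>x. x \<in> carrier K \<Longrightarrow> f x \<in> carrier L) \<Longrightarrow> set (map f xs) \<subseteq> carrier L"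
  by auto

lemma lm_map_compose:
  "lm_map m K L f \<Longrightarrow> lm_map m L M g \<Longrightarrow> lm_map m K M (\<lambda>x. g (f x))"
proof -
  assume f: "lm_map m K L f" and g: "lm_map m L M g"
  have "g (f (br K xs)) = br M (map (\<lambda>x. g (f x)) xs)" if "set xs \<subseteq> carrier K" "arity m (length xs)" for xs
  proof -
    have "f (br K xs) = br L (map f xs)" "g (br L (map f xs)) = br M (map g (map f xs))"
      using f g that map_carrier_subset[of xs K f L] unfolding lm_map_iff by simp_all
    then show ?thesis by (simp add: comp_def)
  qed
  then show ?thesis
    using f g unfolding lm_map_iff by auto
qed

lemma lm_map_id: "lm_algebra m L \<Longrightarrow> lm_map m L L (\<lambda>x. x)"
  by (simp add: lm_map_iff)

lemma lm_map_zero: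
  fixes K :: "('k::field_char_0, 'v) lalg" and L :: "('k, 'w) lalg"
  assumes "lm_algebra m K" "lm_algebra m L"
  shows "lm_map m K L (\<lambda>x. \<zero>\<^bsub>L\<^esub>)"
proof -
  interpret L: lm_algebra m L by fact
  \<comment> \<open>An arity is at least 1, so the list is nonempty and does contain zero.\<close>
  have "br L (map (\<lambda>x. \<zero>\<^bsub>L\<^esub>) xs) = \<zero>\<^bsub>L\<^esub>" if "arity m (length xs)" for xs :: "'v list"
    by (rule L.operations_zero[OF L.operations]) (use that in \<open>auto simp: arity_def image_constant_conv\<close>)
  then show ?thesis
    using assms by (simp add: lm_map_iff)
qed

section \<open>Direct products and the zero algebra\<close>

lemma lprod_simps [simp]:
  "carrier (lprod L L') = carrier L \<times> carrier L'" "\<zero>\<^bsub>lprod L L'\<^esub> = (\<zero>\<^bsub>L\<^esub>, \<zero>\<^bsub>L'\<^esub>)"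
  "z \<oplus>\<^bsub>lprod L L'\<^esub> z' = (fst z \<oplus>\<^bsub>L\<^esub> fst z', snd z \<oplus>\<^bsub>L'\<^esub> snd z')"
  "c \<odot>\<^bsub>lprod L L'\<^esub> z = (c \<odot>\<^bsub>L\<^esub> fst z, c \<odot>\<^bsub>L'\<^esub> snd z)"
  "homog (lprod L L') d = homog L d \<times> homog L' d"
  "br (lprod L L') zs = (br L (map fst zs), br L' (map snd zs))"
  by (auto simp: lprod_def gspace.extend_def gsum_def split_beta)

lemma truncate_lprod: "gspace.truncate (lprod L L') = gsum (gspace.truncate L) (gspace.truncate L')"
  by (simp add: lprod_def gspace.extend_def gspace.truncate_def gsum_def)

lemma graded_space_truncate: "graded_space L \<Longrightarrow> graded_space (gspace.truncate L)"
  by (rule graded_space_cong_structure) auto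

lemma graded_space_lprod:
  assumes "graded_space L" "graded_space L'"
  shows "graded_space (lprod L L')"
proof (rule graded_space_cong_structure)
  show "graded_space (gsum (gspace.truncate L) (gspace.truncate L'))"
    using assms by (intro graded_space_gsum graded_space_truncate)
qed (auto simp: fun_eq_iff)

definition jacobi_sum :: "('k::field_char_0, 'v) lalg \<Rightarrow> int list \<Rightarrow> 'v list \<Rightarrow> 'v" where
  "jacobi_sum L ds xs =
     (\<Oplus>\<^bsub>L\<^esub>i\<in>{1..length xs}. \<Oplus>\<^bsub>L\<^esub>s\<in>unshuffles i (length xs).
        (antisym_sign s ds * (-1) ^ (i * (length xs - i))) \<odot>\<^bsub>L\<^esub>
        br L (br L (take i (permute_list s xs)) # drop i (permute_list s xs)))"

text \<open>The source is assumed to have graded operations but not to satisfy the Jacobi identity,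
  so the lemma applies to the two projections of a product not yet known to be an L(m)-algebra and
  reduces its Jacobi identity to the factors.\<close>

lemma graded_map_jacobi_sum:
  fixes L :: "('k::field_char_0, 'v) lalg" and L' :: "('k, 'w) lalg"
  assumes "graded_map L L' f" and L: "graded_operations m L (br L)"
    and br: "\<And>xs. set xs \<subseteq> carrier L \<Longrightarrow> arity m (length xs) \<Longrightarrow> f (br L xs) = br L' (map f xs)"
    and xs: "set xs \<subseteq> carrier L" "arity m (length xs)"
  shows "jacobi_sum L ds xs \<in> carrier L" "f (jacobi_sum L ds xs) = jacobi_sum L' ds (map f xs)"
proof -
  interpret f: graded_map L L' f by fact
  let ?n = "length xs"
  let ?e = "\<lambda>i s. antisym_sign s ds * (-1) ^ (i * (?n - i)) :: 'k"
  let ?t = "\<lambda>i s. ?e i s \<odot>\<^bsub>L\<^esub> br L (br L (take i (permute_list s xs)) # drop i (permute_list s xs))"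
  let ?t' = "\<lambda>i s. ?e i s \<odot>\<^bsub>L'\<^esub>
    br L' (br L' (take i (permute_list s (map f xs))) # drop i (permute_list s (map f xs)))"
  have t: "?t i s \<in> carrier L" "f (?t i s) = ?t' i s" "?t' i s \<in> carrier L'"
    if "1 \<le> i" "i \<le> ?n" "s \<in> unshuffles i ?n" for i s
  proof -
    have s: "s permutes {..<?n}"
      using that by (auto simp: unshuffles_def)
    let ?ys = "permute_list s xs"
    have ys: "set ?ys \<subseteq> carrier L"
      using s xs by simp
    have y: "set (take i ?ys) \<subseteq> carrier L" "arity m (length (take i ?ys))"
      using that xs ys by (auto dest: in_set_takeD intro: arity_mono)
    have z: "set (br L (take i ?ys) # drop i ?ys) \<subseteq> carrier L" "arity m (length (br L (take i ?ys) # drop i ?ys))"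
      using that xs ys f.V.operations_closed[OF L y] by (auto dest: in_set_dropD intro: arity_mono)
    show "?t i s \<in> carrier L"
      by (rule f.V.smult_carrier[OF f.V.operations_closed[OF L z]])
    then show "f (?t i s) = ?t' i s"
      using f.V.operations_closed[OF L z] br[OF z] br[OF y] s
      by (simp add: f.smult permute_list_map take_map drop_map)
    then show "?t' i s \<in> carrier L'"
      using f.closed[OF \<open>?t i s \<in> carrier L\<close>] by simp
  qed
  show "jacobi_sum L ds xs \<in> carrier L"
    unfolding jacobi_sum_def using t(1) by (auto intro!: f.V.finsum_closed)
  have "f (jacobi_sum L ds xs) = (\<Oplus>\<^bsub>L'\<^esub>i\<in>{1..?n}. f (\<Oplus>\<^bsub>L\<^esub>s\<in>unshuffles i ?n. ?t i s))"
    unfolding jacobi_sum_def by (rule f.finsum) (use t(1) in \<open>auto intro!: f.V.finsum_closed\<close>)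
  also have "\<dots> = (\<Oplus>\<^bsub>L'\<^esub>i\<in>{1..?n}. \<Oplus>\<^bsub>L'\<^esub>s\<in>unshuffles i ?n. f (?t i s))"
    by (rule f.W.finsum_cong') (use t(1) in \<open>auto intro!: f.W.finsum_closed f.finsum f.closed\<close>)
  also have "\<dots> = (\<Oplus>\<^bsub>L'\<^esub>i\<in>{1..?n}. \<Oplus>\<^bsub>L'\<^esub>s\<in>unshuffles i ?n. ?t' i s)"
    by (intro f.W.finsum_cong' refl) (use t in \<open>auto intro!: f.W.finsum_closed\<close>)
  finally show "f (jacobi_sum L ds xs) = jacobi_sum L' ds (map f xs)"
    by (simp add: jacobi_sum_def)
qed

lemma has_degs_lprod:
  "has_degs (lprod L L') ds zs \<longleftrightarrow> has_degs L ds (map fst zs) \<and> has_degs L' ds (map snd zs)"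
  unfolding has_degs_def by (auto simp: list_all2_conv_all_nth mem_Times_iff)

lemma lm_algebra_lprod:
  assumes "lm_algebra m L" "lm_algebra m L'"
  shows "lm_algebra m (lprod L L')"
proof -
  interpret L: lm_algebra m L by fact
  interpret L': lm_algebra m L' by fact
  interpret P: graded_space "lprod L L'"
    by (rule graded_space_lprod) unfold_locales
  have sub: "set (map fst zs) \<subseteq> carrier L" "set (map snd zs) \<subseteq> carrier L'"
    if "set zs \<subseteq> carrier L \<times> carrier L'" for zs
    using that by auto
  have ops: "graded_operations m (lprod L L') (br (lprod L L'))"
    unfolding graded_operations_def
  proof (intro conjI allI impI; (elim conjE)?)
    fix zs assume "set zs \<subseteq> carrier (lprod L L')" "arity m (length zs)"
    then show "br (lprod L L') zs \<in> carrier (lprod L L')"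
      using L.operations_closed[OF L.operations sub(1)[of zs]]
        L'.operations_closed[OF L'.operations sub(2)[of zs]] by simp
  next
    fix xs x y zs
    assume "set xs \<union> {x, y} \<union> set zs \<subseteq> carrier (lprod L L')" "arity m (length xs + 1 + length zs)"
    then show "br (lprod L L') (xs @ (x \<oplus>\<^bsub>lprod L L'\<^esub> y) # zs) =
        br (lprod L L') (xs @ x # zs) \<oplus>\<^bsub>lprod L L'\<^esub> br (lprod L L') (xs @ y # zs)"
      using L.operations_add[OF L.operations sub(1) sub(1), of xs zs "fst x" "fst y"]
        L'.operations_add[OF L'.operations sub(2) sub(2), of xs zs "snd x" "snd y"] by auto
  next
    fix xs a x zs
    assume "set xs \<union> {x} \<union> set zs \<subseteq> carrier (lprod L L')" "arity m (length xs + 1 + length zs)"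
    then show "br (lprod L L') (xs @ (a \<odot>\<^bsub>lprod L L'\<^esub> x) # zs) =
        a \<odot>\<^bsub>lprod L L'\<^esub> br (lprod L L') (xs @ x # zs)"
      using L.operations_smult[OF L.operations sub(1) sub(1), of xs zs "fst x" a]
        L'.operations_smult[OF L'.operations sub(2) sub(2), of xs zs "snd x" a] by auto
  next
    fix ds zs assume "has_degs (lprod L L') ds zs" "arity m (length zs)"
    then show "br (lprod L L') zs \<in> homog (lprod L L') (sum_list ds + int (length zs) - 2)"
      using L.operations_homog[OF L.operations, of ds "map fst zs"]
        L'.operations_homog[OF L'.operations, of ds "map snd zs"] by (auto simp: has_degs_lprod)
  qed
  have g1: "graded_map (lprod L L') L (restrict fst (carrier (lprod L L')))"
    by (intro graded_map.intro graded_map_axioms.intro P.graded_space_axioms L.graded_space_axioms linear0I)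
      (auto simp: L.homog_carrier L'.homog_carrier)
  have g2: "graded_map (lprod L L') L' (restrict snd (carrier (lprod L L')))"
    by (intro graded_map.intro graded_map_axioms.intro P.graded_space_axioms L'.graded_space_axioms linear0I)
      (auto simp: L.homog_carrier L'.homog_carrier)
  have r: "map (restrict fst (carrier (lprod L L'))) zs = map fst zs"
    "map (restrict snd (carrier (lprod L L'))) zs = map snd zs" if "set zs \<subseteq> carrier (lprod L L')" for zs
    using that by auto
  have cl: "br (lprod L L') zs \<in> carrier (lprod L L')"
    if "set zs \<subseteq> carrier (lprod L L')" "arity m (length zs)" for zs
    by (rule P.operations_closed[OF ops that])
  let ?C = "carrier (lprod L L')"
  have b1: "restrict fst ?C (br (lprod L L') zs) = br L (map (restrict fst ?C) zs)"
    and b2: "restrict snd ?C (br (lprod L L') zs) = br L' (map (restrict snd ?C) zs)"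
    if zs: "set zs \<subseteq> ?C" "arity m (length zs)" for zs
    unfolding r[OF zs(1)] restrict_apply'[OF cl[OF zs]] by simp_all
  show ?thesis
  proof (intro lm_algebra.intro P.graded_space_axioms lm_algebra_axioms.intro ops)
    fix ds zs s assume "has_degs (lprod L L') ds zs" "arity m (length zs)" "s permutes {..<length zs}"
    then show "br (lprod L L') (permute_list s zs) = antisym_sign s ds \<odot>\<^bsub>lprod L L'\<^esub> br (lprod L L') zs"
      using L.antisymmetric[of ds "map fst zs" s] L'.antisymmetric[of ds "map snd zs" s]
      by (simp add: has_degs_lprod permute_list_map)
  next
    fix ds zs n assume zs: "has_degs (lprod L L') ds zs" "n = length zs" "arity m n"
    note c = P.has_degs_carrier[OF zs(1)]
    note a = zs(3)[unfolded zs(2)]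
    \<comment> \<open>Each projection carries the Jacobi sum of the product to the Jacobi sum of a
      factor, which is zero.\<close>
    note j1 = graded_map_jacobi_sum[OF g1 ops b1 c a, of ds]
    note j2 = graded_map_jacobi_sum[OF g2 ops b2 c a, of ds]
    note J = j1(1)
    moreover have "fst (jacobi_sum (lprod L L') ds zs) = \<zero>\<^bsub>L\<^esub>"
      using j1(2) L.jacobi[of ds "map fst zs" n] zs
      using J unfolding r[OF c] by (simp add: has_degs_lprod jacobi_sum_def[of L])
    moreover have "snd (jacobi_sum (lprod L L') ds zs) = \<zero>\<^bsub>L'\<^esub>"
      using j2(2) L'.jacobi[of ds "map snd zs" n] zs
      using J unfolding r[OF c] by (simp add: has_degs_lprod jacobi_sum_def[of L'])
    ultimately show "(\<Oplus>\<^bsub>lprod L L'\<^esub>i\<in>{1..n}. \<Oplus>\<^bsub>lprod L L'\<^esub>s\<in>unshuffles i n.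
        (antisym_sign s ds * (- 1) ^ (i * (n - i))) \<odot>\<^bsub>lprod L L'\<^esub>
        br (lprod L L') (br (lprod L L') (take i (permute_list s zs)) # drop i (permute_list s zs))) =
      \<zero>\<^bsub>lprod L L'\<^esub>"
      using zs(2) unfolding jacobi_sum_def by (simp add: prod_eq_iff)
  qed
qed

lemma lm_algebra_lzero: "lm_algebra m (lzero :: ('k::field_char_0, unit) lalg)"
proof -
  have "graded_space (lzero :: ('k, unit) lalg)"
    by (rule graded_spaceI[where p = "\<lambda>_ _. ()"], rule module_ring_of_typeI) (auto simp: lzero_def)
  then show ?thesis
    by (intro lm_algebra.intro lm_algebra_axioms.intro) (auto simp: graded_operations_def lzero_def)
qed

lemma lm_map_lzero: "lm_algebra m L \<Longrightarrow> lm_map m L lzero (\<lambda>x. ())"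
  using lm_algebra_lzero by (auto simp: lm_map_iff lzero_def)

lemma lm_map_fst: "lm_algebra m L \<Longrightarrow> lm_algebra m L' \<Longrightarrow> lm_map m (lprod L L') L fst"
  and lm_map_snd: "lm_algebra m L \<Longrightarrow> lm_algebra m L' \<Longrightarrow> lm_map m (lprod L L') L' snd"
  using lm_algebra_lprod by (auto simp: lm_map_iff)

lemma lm_map_pair:
  assumes "lm_map m K L f" "lm_map m K L' g"
  shows "lm_map m K (lprod L L') (\<lambda>x. (f x, g x))"
  using assms lm_algebra_lprod[of m L L'] unfolding lm_map_iff by (auto simp: comp_def)

section \<open>Relations and functoriality of the enveloping algebra\<close>

lemma uea_simps:
  "gens (uea m L) = gspace.truncate L"
  "rels (uea m L) = {antisymmetrization (free_am m (gspace.truncate L)) ds (map (free_gen m (gspace.truncate L)) xs)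
      \<ominus>\<^bsub>free_am m (gspace.truncate L)\<^esub> free_gen m (gspace.truncate L) (br L xs) | ds xs.
    has_degs L ds xs \<and> arity m (length xs)}"
  by (simp_all add: uea_def Let_def)

lemma carrier_gens_uea [simp]: "carrier (gens (uea m L)) = carrier L"
  by (simp add: uea_simps)

text \<open>The degrees \<open>ds\<close> and the entries \<open>xs\<close> are independent
  arguments: the signs see only \<open>ds\<close>, so for fixed \<open>ds\<close> the expression is
  additive in every slot, also for entries that do not have these degrees.\<close>

definition uea_rel :: "enat \<Rightarrow> ('k::field_char_0, 'v) lalg \<Rightarrow> int list \<Rightarrow> 'v list \<Rightarrow> ('k, 'v) free" where
  "uea_rel m L ds xs =
    antisymmetrization (free_am m (gspace.truncate L)) ds (map (free_gen m (gspace.truncate L)) xs)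
      \<ominus>\<^bsub>free_am m (gspace.truncate L)\<^esub> free_gen m (gspace.truncate L) (br L xs)"

lemma rels_uea: "rels (uea m L) = {uea_rel m L ds xs | ds xs. has_degs L ds xs \<and> arity m (length xs)}"
  by (simp add: uea_simps uea_rel_def)

lemma uea_rel_carrier:
  assumes "lm_algebra m L" "set xs \<subseteq> carrier L" "arity m (length xs)"
  shows "uea_rel m L ds xs \<in> carrier (free_am m (gspace.truncate L))"
proof -
  interpret L: lm_algebra m L by fact
  have V: "graded_space (gspace.truncate L)"
    by (rule graded_space_truncate[OF L.graded_space_axioms])
  interpret F: pre_am_algebra m "free_am m (gspace.truncate L)"
    by (intro unital_am_algebra_pre unital_am_algebra_free V)
  have g: "free_gen m (gspace.truncate L) x \<in> carrier (free_am m (gspace.truncate L))" if "x \<in> carrier L" for x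
    using linear0_free_gen[OF V, of m] that by (auto simp: linear0_def PiE_iff)
  show ?thesis
    unfolding uea_rel_def using assms(2,3) g L.operations_closed[OF L.operations assms(2,3)]
    by (intro F.minus_closed F.antisymmetrization_carrier) auto
qed

lemma well_formed_uea:
  assumes "lm_algebra m L" shows "well_formed m (uea m L)"
proof -
  interpret L: lm_algebra m L by fact
  show ?thesis
    unfolding well_formed_def rels_uea
    using uea_rel_carrier[OF assms] L.has_degs_carrier graded_space_truncate[OF L.graded_space_axioms]
    by (auto simp: uea_simps(1))
qed

lemma linear0_lm_map:
  assumes "lm_map m L L' \<phi>"
  shows "linear0 (gspace.truncate L) (gspace.truncate L') (restrict \<phi> (carrier L))"
  using assms by (auto simp: lm_map_def lm_hom_def linear0_def)

text \<open>For a fixed degree list \<open>free_map\<close> commutes with antisymmetrization, and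
  \<phi> commutes with brackets. As \<phi> preserves degrees, relations are thus carried to
  relations.\<close>

lemma free_map_uea_rel:
  assumes \<phi>: "lm_map m L L' \<phi>" and xs: "set xs \<subseteq> carrier L" "arity m (length xs)"
  shows "free_map m (gspace.truncate L) (gspace.truncate L') \<phi> (uea_rel m L ds xs) = uea_rel m L' ds (map \<phi> xs)"
proof -
  interpret L: lm_algebra m L using \<phi> by (simp add: lm_map_iff)
  interpret L': lm_algebra m L' using \<phi> by (simp add: lm_map_iff)
  let ?V = "gspace.truncate L" and ?W = "gspace.truncate L'"
  have V: "graded_space ?V" "graded_space ?W"
    by (simp_all add: graded_space_truncate L.graded_space_axioms L'.graded_space_axioms)
  note fm = free_map[OF V, where \<phi> = \<phi> and m = m]
  have l: "linear0 ?V ?W (restrict \<phi> (carrier ?V))"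
    using linear0_lm_map[OF \<phi>] by simp
  interpret h: pre_am_hom m "free_am m ?V" "free_am m ?W" "free_map m ?V ?W \<phi>"
    using fm(1)[OF l] by (simp add: am_hom_iff)
  have g: "free_gen m ?V x \<in> carrier (free_am m ?V)" if "x \<in> carrier L" for x
    using linear0_free_gen[OF V(1), of m] that by (auto simp: linear0_def PiE_iff)
  have b: "br L xs \<in> carrier L" "\<phi> (br L xs) = br L' (map \<phi> xs)"
    using L.operations_closed[OF L.operations xs] \<phi> xs by (auto simp: lm_map_iff)
  have "map (free_map m ?V ?W \<phi>) (map (free_gen m ?V) xs) = map (free_gen m ?W) (map \<phi> xs)"
    using fm(2)[OF l] xs by auto
  moreover have gs: "set (map (free_gen m ?V) xs) \<subseteq> carrier (free_am m ?V)"
    using g xs by auto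
  ultimately show ?thesis
    unfolding uea_rel_def using fm(2)[OF l, of "br L xs"] b xs g
    by (simp add: h.diff h.antisymmetrization h.A.antisymmetrization_carrier del: map_map)
qed

lemma is_induced_uea:
  assumes \<phi>: "lm_map m L L' \<phi>"
  shows "is_induced m (uea m L) (uea m L') \<phi> (uea_map m L L' \<phi>)"
proof -
  have L: "lm_algebra m L" "lm_algebra m L'"
    using \<phi> by (auto simp: lm_map_iff)
  interpret L: lm_algebra m L by fact
  note wf = well_formed_uea[OF L(1)] well_formed_uea[OF L(2)]
  have "has_degs L' ds (map \<phi> xs)" if "has_degs L ds xs" for ds xs
    using that \<phi> by (auto simp: has_degs_def list_all2_conv_all_nth lm_map_iff)
  then have "free_map m (gspace.truncate L) (gspace.truncate L') \<phi> ` rels (uea m L) \<subseteq> rels (uea m L')"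
    unfolding rels_uea using free_map_uea_rel[OF \<phi> L.has_degs_carrier] by fastforce
  then have "\<exists>f. is_induced m (uea m L) (uea m L') \<phi> f"
    using rels_rel_ideal[OF wf(2)] linear0_lm_map[OF \<phi>]
    by (intro inducesI wf) (auto simp: uea_simps(1))
  then show ?thesis
    unfolding uea_map_def using is_induced_imp(2)[OF wf(1)] by metis
qed

section \<open>Presentations with the same ideal of relations\<close>

text \<open>Equal ideals give equal quotients, not merely isomorphic ones, so a morphism for one
  presentation is a morphism for the other without any transport.\<close>

definition same_alg :: "enat \<Rightarrow> ('k::field_char_0, 'x) presentation \<Rightarrow> ('k, 'x) presentation \<Rightarrow> bool" where
  "same_alg m P P' \<longleftrightarrow> gens P = gens P' \<and> rel_ideal m P = rel_ideal m P'"

lemma same_alg_alg: "same_alg m P P' \<Longrightarrow> alg m P = alg m P'"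
  and same_alg_gen: "same_alg m P P' \<Longrightarrow> gen m P = gen m P'"
  by (auto simp: same_alg_def alg_def gen_def)

lemma is_induced_same_alg:
  assumes "same_alg m P P'" "same_alg m Q Q'"
  shows "is_induced m P Q \<phi> h \<longleftrightarrow> is_induced m P' Q' \<phi> h"
  using assms by (simp add: is_induced_def same_alg_alg same_alg_gen) (simp add: same_alg_def)

lemma is_induced_cong:
  "(\<And>x. x \<in> carrier (gens P) \<Longrightarrow> \<phi> x = \<psi> x) \<Longrightarrow> is_induced m P Q \<phi> h \<longleftrightarrow> is_induced m P Q \<psi> h"
  by (simp add: is_induced_def)


section \<open>The operation \<open>\<box>\<close> and direct products\<close>

lemma box_simps:
  "gens (box m P Q) = gsum (gens P) (gens Q)"
  "rels (box m P Q) =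
     free_map m (gens P) (gsum (gens P) (gens Q)) (inl (gens P) (gens Q)) ` rels P \<union>
     mixed_relations m (gens P) (gens Q) \<union>
     free_map m (gens Q) (gsum (gens P) (gens Q)) (inr (gens P) (gens Q)) ` rels Q"
  by (simp_all add: box_def Let_def)

lemma linear0_inl:
  assumes "graded_space V" "graded_space W"
  shows "linear0 V (gsum V W) (restrict (inl V W) (carrier V))"
    and linear0_inr: "linear0 W (gsum V W) (restrict (inr V W) (carrier W))"
proof -
  interpret V: graded_space V by fact
  interpret W: graded_space W by fact
  show "linear0 V (gsum V W) (restrict (inl V W) (carrier V))"
    "linear0 W (gsum V W) (restrict (inr V W) (carrier W))"
    by (rule linear0I; auto simp: inl_def inr_def V.homog_carrier W.homog_carrier)+
qed

lemma mixed_relations_carrier: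
  assumes "graded_space V" "graded_space W"
  shows "mixed_relations m V W \<subseteq> carrier (free_am m (gsum V W))"
proof -
  interpret VW: graded_space "gsum V W"
    by (rule graded_space_gsum) fact+
  interpret F: pre_am_algebra m "free_am m (gsum V W)"
    by (intro unital_am_algebra_pre unital_am_algebra_free VW.graded_space_axioms)
  have g: "free_gen m (gsum V W) z \<in> carrier (free_am m (gsum V W))" if "z \<in> carrier (gsum V W)" for z
    using linear0_free_gen[OF VW.graded_space_axioms, of m] that
    by (auto simp: linear0_def PiE_iff simp del: gsum_simps)
  show ?thesis
    unfolding mixed_relations_def Let_def
    using g VW.has_degs_carrier by (auto intro!: F.antisymmetrization_carrier simp del: gsum_simps) blast+
qed

context
  fixes m :: enat and P :: "('k::field_char_0, 'x) presentation" and Q :: "('k, 'y) presentation"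
  assumes P: "well_formed m P" and Q: "well_formed m Q"
begin

lemma
  shows free_map_inl: "am_hom m (free_am m (gens P)) (free_am m (gens (box m P Q)))
      (free_map m (gens P) (gens (box m P Q)) (inl (gens P) (gens Q)))"
    and free_map_inr: "am_hom m (free_am m (gens Q)) (free_am m (gens (box m P Q)))
      (free_map m (gens Q) (gens (box m P Q)) (inr (gens P) (gens Q)))"
  using graded_space_gens[OF P] graded_space_gens[OF Q]
  by (auto simp: box_simps intro!: free_map graded_space_gsum linear0_inl linear0_inr)

lemma well_formed_box: "well_formed m (box m P Q)"
proof -
  have "free_map m (gens P) (gsum (gens P) (gens Q)) (inl (gens P) (gens Q)) ` rels P
      \<subseteq> carrier (free_am m (gsum (gens P) (gens Q)))"
    "free_map m (gens Q) (gsum (gens P) (gens Q)) (inr (gens P) (gens Q)) ` rels Q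
      \<subseteq> carrier (free_am m (gsum (gens P) (gens Q)))"
    using am_hom_mapsto[OF free_map_inl] am_hom_mapsto[OF free_map_inr] rels_carrier[OF P] rels_carrier[OF Q]
    by (auto simp: box_simps)
  then show ?thesis
    unfolding well_formed_def box_simps
    using graded_space_gens[OF P] graded_space_gens[OF Q]
      mixed_relations_carrier[OF graded_space_gens[OF P] graded_space_gens[OF Q], of m]
      graded_space_gsum by auto
qed

text \<open>Each inclusion carries relations to relations of the box, and minimality extends this to
  the generated ideals. Relations of P and Q can then be exchanged for others with the same
  ideals.\<close>

lemma
  shows free_map_inl_rel_ideal: "free_map m (gens P) (gens (box m P Q)) (inl (gens P) (gens Q)) `
      rel_ideal m P \<subseteq> rel_ideal m (box m P Q)"
    and free_map_inr_rel_ideal: "free_map m (gens Q) (gens (box m P Q)) (inr (gens P) (gens Q)) `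
      rel_ideal m Q \<subseteq> rel_ideal m (box m P Q)"
proof -
  interpret l: pre_am_hom m "free_am m (gens P)" "free_am m (gens (box m P Q))"
    "free_map m (gens P) (gens (box m P Q)) (inl (gens P) (gens Q))"
    using free_map_inl by (simp add: am_hom_iff)
  interpret r: pre_am_hom m "free_am m (gens Q)" "free_am m (gens (box m P Q))"
    "free_map m (gens Q) (gens (box m P Q)) (inr (gens P) (gens Q))"
    using free_map_inr by (simp add: am_hom_iff)
  note B = rels_rel_ideal[OF well_formed_box] am_ideal_rel_ideal[OF well_formed_box]
  show "free_map m (gens P) (gens (box m P Q)) (inl (gens P) (gens Q)) `
      rel_ideal m P \<subseteq> rel_ideal m (box m P Q)"
    unfolding rel_ideal_def[of m P]
    by (rule l.image_genideal_subset[OF B(2) rels_carrier[OF P]]) (use B(1) in \<open>auto simp: box_simps\<close>)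
  show "free_map m (gens Q) (gens (box m P Q)) (inr (gens P) (gens Q)) `
      rel_ideal m Q \<subseteq> rel_ideal m (box m P Q)"
    unfolding rel_ideal_def[of m Q]
    by (rule r.image_genideal_subset[OF B(2) rels_carrier[OF Q]]) (use B(1) in \<open>auto simp: box_simps\<close>)
qed

lemma is_induced_box_inl: "is_induced m P (box m P Q) (inl (gens P) (gens Q)) (box_inl m P Q)"
proof -
  have "\<exists>f. is_induced m P (box m P Q) (inl (gens P) (gens Q)) f"
    by (rule inducesI[OF P well_formed_box])
      (use rels_rel_ideal[OF P] free_map_inl_rel_ideal linear0_inl graded_space_gens[OF P]
        graded_space_gens[OF Q] in \<open>auto simp: box_simps(1)\<close>)
  then show ?thesis
    unfolding box_inl_def using is_induced_imp(2)[OF P] by metis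
qed

lemma is_induced_box_inr: "is_induced m Q (box m P Q) (inr (gens P) (gens Q)) (box_inr m P Q)"
proof -
  have "\<exists>f. is_induced m Q (box m P Q) (inr (gens P) (gens Q)) f"
    by (rule inducesI[OF Q well_formed_box])
      (use rels_rel_ideal[OF Q] free_map_inr_rel_ideal linear0_inr graded_space_gens[OF P]
        graded_space_gens[OF Q] in \<open>auto simp: box_simps(1)\<close>)
  then show ?thesis
    unfolding box_inr_def using is_induced_imp(2)[OF Q] by metis
qed

end

text \<open>Mixed relations depend on the generators alone. The other two families come from
  relations lying in the ideals of P' and Q', and the inclusions carry these ideals into the ideal
  of the box.\<close>

lemma rels_box_subset:
  assumes wf: "well_formed m P" "well_formed m P'" "well_formed m Q" "well_formed m Q'"
    and "same_alg m P P'" "same_alg m Q Q'"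
  shows "rels (box m P Q) \<subseteq> rel_ideal m (box m P' Q')"
proof -
  have g: "gens P' = gens P" "gens Q' = gens Q" "rels P \<subseteq> rel_ideal m P'" "rels Q \<subseteq> rel_ideal m Q'"
    using rels_rel_ideal[OF wf(1)] rels_rel_ideal[OF wf(3)] assms(5,6) by (auto simp: same_alg_def)
  have "mixed_relations m (gens P) (gens Q) \<subseteq> rel_ideal m (box m P' Q')"
    using rels_rel_ideal[OF well_formed_box[OF wf(2,4)]] by (auto simp: box_simps g)
  moreover have "free_map m (gens P) (gsum (gens P) (gens Q)) (inl (gens P) (gens Q)) ` rels P
      \<subseteq> rel_ideal m (box m P' Q')"
    by (rule order_trans[OF image_mono[OF g(3)]])
      (use free_map_inl_rel_ideal[OF wf(2,4)] in \<open>simp add: box_simps(1) g\<close>)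
  moreover have "free_map m (gens Q) (gsum (gens P) (gens Q)) (inr (gens P) (gens Q)) ` rels Q
      \<subseteq> rel_ideal m (box m P' Q')"
    by (rule order_trans[OF image_mono[OF g(4)]])
      (use free_map_inr_rel_ideal[OF wf(2,4)] in \<open>simp add: box_simps(1) g\<close>)
  ultimately show ?thesis
    unfolding box_simps(2) by blast
qed

lemma same_alg_box:
  assumes wf: "well_formed m P" "well_formed m P'" "well_formed m Q" "well_formed m Q'"
    and s: "same_alg m P P'" "same_alg m Q Q'"
  shows "same_alg m (box m P Q) (box m P' Q')"
proof -
  have gs: "gens (box m P Q) = gens (box m P' Q')"
    using s by (simp add: same_alg_def box_simps)
  have s': "same_alg m P' P" "same_alg m Q' Q"
    using s by (auto simp: same_alg_def)
  note w = well_formed_box[OF wf(1,3)] well_formed_box[OF wf(2,4)]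
  interpret F: pre_am_algebra m "free_am m (gens (box m P Q))"
    by (intro unital_am_algebra_pre unital_am_algebra_free graded_space_gens[OF w(1)])
  have "rel_ideal m (box m P Q) = rel_ideal m (box m P' Q')"
    unfolding rel_ideal_def gs[symmetric]
    using rels_box_subset[OF wf s] rels_box_subset[OF wf(2,1,4,3) s'] rels_carrier[OF w(1)] rels_carrier[OF w(2)]
    by (intro F.genideal_eqI) (auto simp: rel_ideal_def gs)
  with gs show ?thesis by (simp add: same_alg_def)
qed

section \<open>Expansion of the relations of a product\<close>

text \<open>The signs depend on \<open>ds\<close> only, and each permuted list has the active entry
  in a single slot, so every summand is additive in it.\<close>

lemma (in pre_am_algebra) antisymmetrization_add:
  assumes "set xs \<subseteq> carrier A" "set zs \<subseteq> carrier A" "x \<in> carrier A" "y \<in> carrier A"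
    "arity m (length xs + 1 + length zs)"
  shows "antisymmetrization A ds (xs @ (x \<oplus> y) # zs) =
    antisymmetrization A ds (xs @ x # zs) \<oplus> antisymmetrization A ds (xs @ y # zs)"
proof -
  let ?S = "{s. s permutes {..<length xs + 1 + length zs}}"
  let ?m = "\<lambda>s w. antisym_sign s ds \<odot> mu A (permute_list s (xs @ w # zs))"
  have c: "?m s w \<in> carrier A" if "s \<in> ?S" "w \<in> carrier A" for s w
    using that assms by (intro smult_carrier mu_permute_carrier) auto
  have "?m s (x \<oplus> y) = ?m s x \<oplus> ?m s y" if "s \<in> ?S" for s
  proof -
    obtain us vs where s: "\<And>w. permute_list s (xs @ w # zs) = us @ w # vs"
      "set us \<union> set vs \<subseteq> set xs \<union> set zs" "length us + 1 + length vs = length xs + 1 + length zs"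
      using permute_list_slot[of s xs zs] \<open>s \<in> ?S\<close> by blast
    have uv: "set us \<subseteq> carrier A" "set vs \<subseteq> carrier A" "arity m (length us + 1 + length vs)"
      using s(2,3) assms by auto
    have "mu A (us @ x # vs) \<in> carrier A" "mu A (us @ y # vs) \<in> carrier A"
      using uv assms by (auto intro!: mu_carrier)
    then show ?thesis
      using mu_add[OF uv(1,2) assms(3,4) uv(3)] by (simp add: s(1) smult_add_right)
  qed
  moreover have "antisymmetrization A ds (xs @ w # zs) = (\<Oplus>s\<in>?S. ?m s w)" for w
    by (simp add: antisymmetrization_def)
  moreover have "(\<Oplus>s\<in>?S. ?m s (x \<oplus> y)) = (\<Oplus>s\<in>?S. ?m s x \<oplus> ?m s y)"
    by (rule finsum_cong') (use c assms calculation(1) in auto)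
  ultimately show ?thesis
    using c assms by (simp add: finsum_addf)
qed

context
  fixes m :: enat and L :: "('k::field_char_0, 'v) lalg"
  assumes L: "lm_algebra m L"
begin

interpretation L: lm_algebra m L by (rule L)
interpretation V: graded_space "gspace.truncate L"
  by (rule graded_space_truncate[OF L.graded_space_axioms])
interpretation F: pre_am_algebra m "free_am m (gspace.truncate L)"
  by (intro unital_am_algebra_pre unital_am_algebra_free V.graded_space_axioms)
interpretation g: graded_map "gspace.truncate L" "free_am m (gspace.truncate L)"
  "restrict (free_gen m (gspace.truncate L)) (carrier (gspace.truncate L))"
  by (rule graded_map_free_gen[OF V.graded_space_axioms])

lemma free_gen_truncate_carrier:
  "x \<in> carrier L \<Longrightarrow> free_gen m (gspace.truncate L) x \<in> carrier (free_am m (gspace.truncate L))"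
  using g.closed[of x] by simp

lemma uea_rel_add:
  assumes "set xs \<subseteq> carrier L" "set zs \<subseteq> carrier L" "x \<in> carrier L" "y \<in> carrier L"
    "arity m (length xs + 1 + length zs)"
  shows "uea_rel m L ds (xs @ (x \<oplus>\<^bsub>L\<^esub> y) # zs) =
    uea_rel m L ds (xs @ x # zs) \<oplus>\<^bsub>free_am m (gspace.truncate L)\<^esub> uea_rel m L ds (xs @ y # zs)"
proof -
  let ?F = "free_am m (gspace.truncate L)" and ?g = "free_gen m (gspace.truncate L)"
  have gadd: "?g (u \<oplus>\<^bsub>L\<^esub> v) = ?g u \<oplus>\<^bsub>?F\<^esub> ?g v" if "u \<in> carrier L" "v \<in> carrier L" for u v
    using g.add[of u v] that by simp
  have b: "br L (xs @ x # zs) \<in> carrier L" "br L (xs @ y # zs) \<in> carrier L"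
    using assms by (auto intro!: L.operations_closed[OF L.operations])
  have gs: "set (map ?g xs) \<subseteq> carrier ?F" "set (map ?g zs) \<subseteq> carrier ?F"
    using assms free_gen_truncate_carrier by auto
  have a: "antisymmetrization ?F ds (map ?g (xs @ w # zs)) \<in> carrier ?F" if "w \<in> carrier L" for w
    by (rule F.antisymmetrization_carrier) (use that assms free_gen_truncate_carrier in auto)
  have four: "(p \<oplus>\<^bsub>?F\<^esub> q) \<ominus>\<^bsub>?F\<^esub> (r \<oplus>\<^bsub>?F\<^esub> t) = (p \<ominus>\<^bsub>?F\<^esub> r) \<oplus>\<^bsub>?F\<^esub> (q \<ominus>\<^bsub>?F\<^esub> t)"
    if "p \<in> carrier ?F" "q \<in> carrier ?F" "r \<in> carrier ?F" "t \<in> carrier ?F" for p q r t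
    using that by (simp add: a_minus_def F.minus_add F.a_ac)
  show ?thesis
    using F.antisymmetrization_add[OF gs, of "?g x" "?g y" ds] a[of x] a[of y] assms b gadd
      L.operations_add[OF L.operations assms] free_gen_truncate_carrier
    by (simp add: uea_rel_def four)
qed

text \<open>When both summands occur among the entries, the bracket of the product vanishes; this is
  how an enveloping relation of the product becomes a mixed relation.\<close>

lemma uea_rel_br_zero:
  assumes "set xs \<subseteq> carrier L" "arity m (length xs)" "br L xs = \<zero>\<^bsub>L\<^esub>"
  shows "uea_rel m L ds xs =
    antisymmetrization (free_am m (gspace.truncate L)) ds (map (free_gen m (gspace.truncate L)) xs)"
proof -
  have "antisymmetrization (free_am m (gspace.truncate L)) ds (map (free_gen m (gspace.truncate L)) xs)
      \<in> carrier (free_am m (gspace.truncate L))"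
    by (rule F.antisymmetrization_carrier) (use assms free_gen_truncate_carrier in auto)
  moreover have "free_gen m (gspace.truncate L) \<zero>\<^bsub>L\<^esub> = \<zero>\<^bsub>free_am m (gspace.truncate L)\<^esub>"
    using g.zero by simp
  ultimately show ?thesis
    using assms by (simp add: uea_rel_def a_minus_def F.minus_eq_smult)
qed

end

lemma
  assumes "lm_algebra m L" "lm_algebra m L'"
  shows lm_map_inl: "lm_map m L (lprod L L') (inl (gspace.truncate L) (gspace.truncate L'))"
    and lm_map_inr: "lm_map m L' (lprod L L') (inr (gspace.truncate L) (gspace.truncate L'))"
  using assms unfolding inl_def[abs_def] inr_def[abs_def] truncate_simps
  by (auto intro!: lm_map_pair lm_map_id lm_map_zero)

text \<open>The two inclusions differ in kind. Every relation of the box is itself a relation of the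
  enveloping algebra of the product. Conversely, a product relation may have entries outside both
  summands, and it is shown to lie in the ideal of the box, not among its relations.\<close>

lemma same_alg_box_uea:
  fixes L :: "('k::field_char_0, 'v) lalg" and L' :: "('k, 'w) lalg"
  assumes L: "lm_algebra m L" and L': "lm_algebra m L'"
  shows "same_alg m (box m (uea m L) (uea m L')) (uea m (lprod L L'))"
proof -
  interpret L: lm_algebra m L by fact
  interpret L': lm_algebra m L' by fact
  let ?V = "gspace.truncate L" and ?W = "gspace.truncate L'"
  let ?B = "box m (uea m L) (uea m L')" and ?U = "uea m (lprod L L')"
  let ?VW = "gsum ?V ?W"
  let ?F = "free_am m ?VW"
  let ?Vl = "inl ?V ?W ` carrier ?V" and ?Wr = "inr ?V ?W ` carrier ?W"
  note LL = lm_algebra_lprod[OF L L']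
  interpret LL: lm_algebra m "lprod L L'" by (rule LL)
  note wB = well_formed_box[OF well_formed_uea[OF L] well_formed_uea[OF L']]
  note wU = well_formed_uea[OF LL]
  have gs: "gens ?B = ?VW" "gens ?U = ?VW"
    by (simp_all add: box_simps uea_simps(1) truncate_lprod)
  interpret VW: graded_space ?VW
    using graded_space_gens[OF wB] by (simp add: gs)
  interpret F: pre_am_algebra m ?F
    by (intro unital_am_algebra_pre unital_am_algebra_free VW.graded_space_axioms)
  have hd: "has_degs ?VW = has_degs (lprod L L')"
    by (rule has_degs_cong_structure) (auto simp: fun_eq_iff)
  note li = lm_map_inl[OF L L'] and ri = lm_map_inr[OF L L']
  have flip: "free_map m ?V ?VW (inl ?V ?W) (uea_rel m L ds xs) = uea_rel m (lprod L L') ds (map (inl ?V ?W) xs)"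
    if "set xs \<subseteq> carrier L" "arity m (length xs)" for ds xs
    using free_map_uea_rel[OF li that] by (simp add: truncate_lprod)
  have flir: "free_map m ?W ?VW (inr ?V ?W) (uea_rel m L' ds ys) = uea_rel m (lprod L L') ds (map (inr ?V ?W) ys)"
    if "set ys \<subseteq> carrier L'" "arity m (length ys)" for ds ys
    using free_map_uea_rel[OF ri that] by (simp add: truncate_lprod)
  have dl: "has_degs (lprod L L') ds (map (inl ?V ?W) xs)" if "has_degs L ds xs" for ds xs
    using that by (auto simp: has_degs_def list_all2_conv_all_nth inl_def)
  have dr: "has_degs (lprod L L') ds (map (inr ?V ?W) ys)" if "has_degs L' ds ys" for ds ys
    using that by (auto simp: has_degs_def list_all2_conv_all_nth inr_def)
  \<comment> \<open>An entry from the second summand has first component zero and one from the first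
    has second component zero, so both component brackets vanish.\<close>
  have mixed: "uea_rel m (lprod L L') ds zs = antisymmetrization ?F ds (map (free_gen m ?VW) zs)"
    if "has_degs (lprod L L') ds zs" "arity m (length zs)" "set zs \<inter> ?Vl \<noteq> {}" "set zs \<inter> ?Wr \<noteq> {}" for ds zs
  proof -
    note c = LL.has_degs_carrier[OF that(1)]
    have "br L (map fst zs) = \<zero>\<^bsub>L\<^esub>"
      by (rule L.operations_zero[OF L.operations]) (use that c in \<open>force simp: inr_def\<close>)+
    moreover have "br L' (map snd zs) = \<zero>\<^bsub>L'\<^esub>"
      by (rule L'.operations_zero[OF L'.operations]) (use that c in \<open>force simp: inl_def\<close>)+
    ultimately have "br (lprod L L') zs = \<zero>\<^bsub>lprod L L'\<^esub>"
      by simp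
    from uea_rel_br_zero[OF LL c that(2) this] show ?thesis
      by (simp add: truncate_lprod)
  qed
  have sub1: "rels ?B \<subseteq> rels ?U"
  proof
    fix r assume "r \<in> rels ?B"
    then consider ds xs where "has_degs L ds xs" "arity m (length xs)" "r = free_map m ?V ?VW (inl ?V ?W) (uea_rel m L ds xs)"
      | ds xs where "has_degs L' ds xs" "arity m (length xs)" "r = free_map m ?W ?VW (inr ?V ?W) (uea_rel m L' ds xs)"
      | "r \<in> mixed_relations m ?V ?W"
      by (auto simp: box_simps rels_uea uea_simps(1))
    then show "r \<in> rels ?U"
    proof cases
      case 1
      then show ?thesis
        using flip[OF L.has_degs_carrier] dl unfolding rels_uea by (intro CollectI exI conjI) auto
    next
      case 2
      then show ?thesis
        using flir[OF L'.has_degs_carrier] dr unfolding rels_uea by (intro CollectI exI conjI) auto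
    next
      case 3
      then obtain ds zs where zs: "r = antisymmetrization ?F ds (map (free_gen m ?VW) zs)"
        "has_degs (lprod L L') ds zs" "arity m (length zs)" "set zs \<inter> ?Vl \<noteq> {}" "set zs \<inter> ?Wr \<noteq> {}"
        unfolding mixed_relations_def Let_def hd by blast
      then show ?thesis
        using mixed[of ds zs] unfolding rels_uea by (intro CollectI exI conjI) auto
    qed
  qed
  let ?K = "rel_ideal m ?B"
  note K = rels_rel_ideal[OF wB] 
  have K_add: "r \<oplus>\<^bsub>?F\<^esub> t \<in> ?K" if "r \<in> ?K" "t \<in> ?K" for r t
    using F.graded_subspaceD(3)[OF am_idealD(1)] am_ideal_rel_ideal[OF wB] that by (simp add: gs)
  have base: "uea_rel m (lprod L L') ds zs \<in> ?K"
    if zs: "has_degs (lprod L L') ds zs" "arity m (length zs)" "set zs \<subseteq> ?Vl \<union> ?Wr" for ds zs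
  proof -
    note c = LL.has_degs_carrier[OF zs(1)]
    \<comment> \<open>The cases overlap because zero lies in both summands. A list containing zero
      counts as mixed, consistently with its bracket being zero.\<close>
    consider "set zs \<subseteq> ?Vl" | "set zs \<subseteq> ?Wr" | "set zs \<inter> ?Vl \<noteq> {}" "set zs \<inter> ?Wr \<noteq> {}"
      using zs(3) by blast
    then show ?thesis
    proof cases
      case 1
      then have "map (inl ?V ?W) (map fst zs) = zs"
        by (auto simp: inl_def intro!: map_idI)
      moreover have "uea_rel m L ds (map fst zs) \<in> rels (uea m L)"
        using zs unfolding rels_uea has_degs_lprod by (intro CollectI exI conjI refl) auto
      moreover have "free_map m ?V ?VW (inl ?V ?W) (uea_rel m L ds (map fst zs)) =
          uea_rel m (lprod L L') ds (map (inl ?V ?W) (map fst zs))"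
        by (rule flip) (use c zs(2) in auto)
      ultimately have "uea_rel m (lprod L L') ds zs \<in> free_map m ?V ?VW (inl ?V ?W) ` rels (uea m L)"
        by (metis imageI)
      then show ?thesis
        using K by (auto simp: box_simps uea_simps(1))
    next
      case 2
      then have "map (inr ?V ?W) (map snd zs) = zs"
        by (auto simp: inr_def intro!: map_idI)
      moreover have "uea_rel m L' ds (map snd zs) \<in> rels (uea m L')"
        using zs unfolding rels_uea has_degs_lprod by (intro CollectI exI conjI refl) auto
      moreover have "free_map m ?W ?VW (inr ?V ?W) (uea_rel m L' ds (map snd zs)) =
          uea_rel m (lprod L L') ds (map (inr ?V ?W) (map snd zs))"
        by (rule flir) (use c zs(2) in auto)
      ultimately have "uea_rel m (lprod L L') ds zs \<in> free_map m ?W ?VW (inr ?V ?W) ` rels (uea m L')"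
        by (metis imageI)
      then show ?thesis
        using K by (auto simp: box_simps uea_simps(1))
    next
      case 3
      have "antisymmetrization ?F ds (map (free_gen m ?VW) zs) \<in> mixed_relations m ?V ?W"
        unfolding mixed_relations_def Let_def hd using zs 3 by blast
      then show ?thesis
        using mixed[OF zs(1,2) 3] K by (auto simp: box_simps uea_simps(1))
    qed
  qed
  have "uea_rel m (lprod L L') ds zs \<in> ?K" if zs: "has_degs (lprod L L') ds zs" "arity m (length zs)" for ds zs
  proof -
    \<comment> \<open>Degree and element travel together: both halves of (x, y) are homogeneous of
      the degree of their slot, so splitting an entry leaves the degree list, and with it the signs,
      unchanged.\<close>
    let ?C = "{(d, z). z \<in> homog (lprod L L') d}" and ?S = "{(d, z). z \<in> homog (lprod L L') d \<and> z \<in> ?Vl \<union> ?Wr}"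
    let ?R = "\<lambda>ps. uea_rel m (lprod L L') (map fst ps) (map snd ps)"
    have hdC: "has_degs (lprod L L') (map fst ps) (map snd ps)" if "set ps \<subseteq> ?C" for ps
      using that by (induction ps) auto
    have "?R (zip ds zs) \<in> ?K"
    proof (rule slotwise_induct[where S = ?S and C = ?C and n = "length zs"])
      fix ps assume ps: "set ps \<subseteq> ?S" "length ps = length zs"
      then have "set ps \<subseteq> ?C" "set (map snd ps) \<subseteq> ?Vl \<union> ?Wr" by auto
      then show "?R ps \<in> ?K"
        using base[OF hdC] ps(2) zs(2) by simp
    next
      fix ps p qs assume ps: "set ps \<subseteq> ?C" and p: "p \<in> ?C" and qs: "set qs \<subseteq> ?S"
        and n: "length ps + 1 + length qs = length zs"
        and hyp: "\<And>s. s \<in> ?S \<Longrightarrow> ?R (ps @ s # qs) \<in> ?K"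
      obtain d x y where dxy: "p = (d, (x, y))" "x \<in> homog L d" "y \<in> homog L' d"
        using p by auto
      have "(d, (x, \<zero>\<^bsub>L'\<^esub>)) \<in> ?S" "(d, (\<zero>\<^bsub>L\<^esub>, y)) \<in> ?S"
        using dxy L.homog_carrier L'.homog_carrier by (auto simp: inl_def inr_def)
      then have "?R (ps @ (d, (x, \<zero>\<^bsub>L'\<^esub>)) # qs) \<oplus>\<^bsub>?F\<^esub> ?R (ps @ (d, (\<zero>\<^bsub>L\<^esub>, y)) # qs) \<in> ?K"
        by (intro K_add hyp)
      moreover have "set (map snd ps) \<subseteq> carrier (lprod L L')"
        by (rule LL.has_degs_carrier[OF hdC[OF ps]])
      moreover have "set (map snd qs) \<subseteq> carrier (lprod L L')"
        by (rule LL.has_degs_carrier[OF hdC]) (use qs in auto)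
      moreover have "(x, y) = (x, \<zero>\<^bsub>L'\<^esub>) \<oplus>\<^bsub>lprod L L'\<^esub> (\<zero>\<^bsub>L\<^esub>, y)"
        using dxy L.homog_carrier L'.homog_carrier by simp
      ultimately show "?R (ps @ p # qs) \<in> ?K"
        using uea_rel_add[OF LL, of "map snd ps" "map snd qs" "(x, \<zero>\<^bsub>L'\<^esub>)" "(\<zero>\<^bsub>L\<^esub>, y)"
            "map fst (ps @ p # qs)"] n zs(2) dxy L.homog_carrier L'.homog_carrier
        by (simp add: truncate_lprod del: lprod_simps(3))
    next
      show "set (zip ds zs) \<subseteq> ?C" "length (zip ds zs) = length zs"
        using zs(1) by (auto simp: has_degs_def list_all2_iff)
    qed
    then show ?thesis
      using has_degs_length[OF zs(1)] by simp
  qed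
  then have sub2: "rels ?U \<subseteq> ?K"
    by (auto simp: rels_uea)
  have "rel_ideal m ?B = rel_ideal m ?U"
    using F.genideal_eqI[of "rels ?B" "rels ?U"] rels_carrier[OF wB] rels_carrier[OF wU] sub1 sub2
      genideal_superset[of "rels ?U" m ?F]
    by (auto simp: rel_ideal_def gs)
  then show ?thesis
    by (simp add: same_alg_def gs)
qed

section \<open>Presentations with the ideal of an enveloping algebra\<close>

text \<open>An iterated box such as \<open>box m (box m C C) C\<close> is not literally of the form
  \<open>uea m L\<close>, but its ideal is that of an enveloping algebra. This weaker relation is
  stable under \<open>box\<close>.\<close>

definition presents_uea :: "enat \<Rightarrow> ('k::field_char_0, 'v) presentation \<Rightarrow> ('k, 'v) lalg \<Rightarrow> bool" where
  "presents_uea m P L \<longleftrightarrow> lm_algebra m L \<and> well_formed m P \<and> same_alg m P (uea m L)"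

lemma presents_uea_uea: "lm_algebra m L \<Longrightarrow> presents_uea m (uea m L) L"
  by (simp add: presents_uea_def well_formed_uea same_alg_def)

text \<open>The factors are replaced by enveloping algebras, which \<open>same_alg_box\<close>
  permits, and \<open>same_alg_box_uea\<close> does the rest.\<close>

lemma presents_uea_box:
  assumes "presents_uea m P L" "presents_uea m Q L'"
  shows "presents_uea m (box m P Q) (lprod L L')"
proof -
  have "same_alg m (box m P Q) (box m (uea m L) (uea m L'))"
    using assms by (intro same_alg_box) (auto simp: presents_uea_def well_formed_uea)
  moreover have "same_alg m (box m (uea m L) (uea m L')) (uea m (lprod L L'))"
    using assms by (intro same_alg_box_uea) (auto simp: presents_uea_def)
  ultimately show ?thesis
    using assms lm_algebra_lprod well_formed_box by (auto simp: presents_uea_def same_alg_def)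
qed

lemma presents_uea_gens: "presents_uea m P L \<Longrightarrow> gens P = gspace.truncate L"
  by (simp add: presents_uea_def same_alg_def uea_simps)

lemma is_induced_presents_uea:
  assumes P: "presents_uea m P L" and Q: "presents_uea m Q L'" and \<phi>: "lm_map m L L' \<phi>"
  shows "is_induced m P Q \<phi> (induced m P Q \<phi>)"
proof -
  have "is_induced m P Q \<phi> (uea_map m L L' \<phi>)"
    using is_induced_uea[OF \<phi>] P Q is_induced_same_alg unfolding presents_uea_def by blast
  then show ?thesis
    using is_induced_imp(2) P unfolding presents_uea_def by metis
qed

lemma compose_eqD: "compose A g f = h \<Longrightarrow> a \<in> A \<Longrightarrow> g (f a) = h a"
  by (auto simp: compose_eq)

text \<open>Each composite is induced by a map that is the identity on generators, hence is the
  identity.\<close>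

lemma induces_iso_presents_uea:
  assumes P: "presents_uea m P L" and Q: "presents_uea m Q L'"
    and \<phi>: "lm_map m L L' \<phi>" and \<psi>: "lm_map m L' L \<psi>"
    and inv: "\<And>x. x \<in> carrier L \<Longrightarrow> \<psi> (\<phi> x) = x" "\<And>y. y \<in> carrier L' \<Longrightarrow> \<phi> (\<psi> y) = y"
  shows "induces_iso m P Q \<phi>"
proof -
  note f = is_induced_presents_uea[OF P Q \<phi>] and g = is_induced_presents_uea[OF Q P \<psi>]
  let ?f = "induced m P Q \<phi>" and ?g = "induced m Q P \<psi>"
  have wf: "well_formed m P" "well_formed m Q"
    using P Q by (auto simp: presents_uea_def)
  note c = presents_uea_gens[OF P] presents_uea_gens[OF Q]
  have cl: "\<phi> x \<in> carrier L'" if "x \<in> carrier L" for x using \<phi> that by (simp add: lm_map_iff)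
  have cl': "\<psi> x \<in> carrier L" if "x \<in> carrier L'" for x using \<psi> that by (simp add: lm_map_iff)
  have "is_induced m P P (\<lambda>x. \<psi> (\<phi> x)) (compose (carrier (alg m P)) ?g ?f)"
    by (rule is_induced_compose[OF wf(1) f g]) (use cl c in simp)
  moreover have "is_induced m P P (\<lambda>x. \<psi> (\<phi> x)) (\<lambda>a\<in>carrier (alg m P). a)"
    by (rule is_induced_id[OF wf(1)]) (use inv c in simp)
  ultimately have gf: "compose (carrier (alg m P)) ?g ?f = (\<lambda>a\<in>carrier (alg m P). a)"
    by (rule is_induced_unique[OF wf(1)])
  have "is_induced m Q Q (\<lambda>x. \<phi> (\<psi> x)) (compose (carrier (alg m Q)) ?f ?g)"
    by (rule is_induced_compose[OF wf(2) g f]) (use cl' c in simp)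
  moreover have "is_induced m Q Q (\<lambda>x. \<phi> (\<psi> x)) (\<lambda>a\<in>carrier (alg m Q). a)"
    by (rule is_induced_id[OF wf(2)]) (use inv c in simp)
  ultimately have fg: "compose (carrier (alg m Q)) ?f ?g = (\<lambda>a\<in>carrier (alg m Q). a)"
    by (rule is_induced_unique[OF wf(2)])
  have hom: "am_hom m (alg m P) (alg m Q) ?f" "am_hom m (alg m Q) (alg m P) ?g"
    using f g by (auto simp: is_induced_def)
  have "bij_betw ?f (carrier (alg m P)) (carrier (alg m Q))"
  proof (rule bij_betw_byWitness[where f' = ?g])
    show "\<forall>a\<in>carrier (alg m P). ?g (?f a) = a"
      using compose_eqD[OF gf] by simp
    show "\<forall>a\<in>carrier (alg m Q). ?f (?g a) = a"
      using compose_eqD[OF fg] by simp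
  qed (use am_hom_mapsto[OF hom(1)] am_hom_mapsto[OF hom(2)] in auto)
  then show ?thesis
    unfolding induces_iso_def am_iso_def using is_induced_imp(1)[OF wf(1) f] hom by blast
qed

section \<open>The box of two morphisms\<close>

text \<open>A generator (x, y) is the sum of the images of x and y under the two inclusions, so the
  restrictions to the factors determine a morphism out of the box.\<close>

lemma is_box_map_unique:
  assumes P: "well_formed m P" and Q: "well_formed m Q"
    and h: "is_box_map m P P' Q Q' f g h" and h': "is_box_map m P P' Q Q' f g h'"
  shows "h = h'"
proof (rule alg_hom_eqI[OF well_formed_box[OF P Q]])
  let ?B = "box m P Q"
  note wB = well_formed_box[OF P Q]
  show hom: "am_hom m (alg m ?B) (alg m (box m P' Q')) h" "am_hom m (alg m ?B) (alg m (box m P' Q')) h'"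
    using h h' by (auto simp: is_box_map_def)
  interpret V: graded_space "gens P" by (rule graded_space_gens[OF P])
  interpret W: graded_space "gens Q" by (rule graded_space_gens[OF Q])
  interpret h: pre_am_hom m "alg m ?B" "alg m (box m P' Q')" h
    using hom by (simp add: am_hom_iff)
  interpret h': pre_am_hom m "alg m ?B" "alg m (box m P' Q')" h'
    using hom by (simp add: am_hom_iff)
  fix z assume "z \<in> carrier (gens ?B)"
  then obtain x y where z: "z = (x, y)" "x \<in> carrier (gens P)" "y \<in> carrier (gens Q)"
    by (auto simp: box_simps(1))
  let ?x = "inl (gens P) (gens Q) x" and ?y = "inr (gens P) (gens Q) y"
  have xy: "?x \<in> carrier (gens ?B)" "?y \<in> carrier (gens ?B)" "z = ?x \<oplus>\<^bsub>gens ?B\<^esub> ?y"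
    using z by (auto simp: box_simps(1) inl_def inr_def)
  have "gen m ?B ?x = box_inl m P Q (gen m P x)" "gen m ?B ?y = box_inr m P Q (gen m Q y)"
    using is_induced_box_inl[OF P Q] is_induced_box_inr[OF P Q] z by (auto simp: is_induced_def)
  then have "h (gen m ?B ?x) = h' (gen m ?B ?x)" "h (gen m ?B ?y) = h' (gen m ?B ?y)"
    using h h' gen_carrier[OF P z(2)] gen_carrier[OF Q z(3)] by (auto simp: is_box_map_def)
  then show "h (gen m ?B z) = h' (gen m ?B z)"
    using xy gen_carrier[OF wB] by (simp add: gen_add[OF wB] h.add h'.add)
qed

text \<open>The squares with the two inclusions are compared on generators. There
  \<open>map_prod\<close> respects the inclusion of one factor because the map on the other factor
  preserves zero.\<close>

lemma is_box_map_induced: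
  assumes wf: "well_formed m P" "well_formed m P'" "well_formed m Q" "well_formed m Q'"
    and f: "is_induced m P P' \<phi> f" and g: "is_induced m Q Q' \<psi> g"
    and h: "is_induced m (box m P Q) (box m P' Q') (map_prod \<phi> \<psi>) h"
    and \<phi>: "\<And>x. x \<in> carrier (gens P) \<Longrightarrow> \<phi> x \<in> carrier (gens P')" "\<phi> \<zero>\<^bsub>gens P\<^esub> = \<zero>\<^bsub>gens P'\<^esub>"
    and \<psi>: "\<And>x. x \<in> carrier (gens Q) \<Longrightarrow> \<psi> x \<in> carrier (gens Q')" "\<psi> \<zero>\<^bsub>gens Q\<^esub> = \<zero>\<^bsub>gens Q'\<^esub>"
  shows "is_box_map m P P' Q Q' f g h"
proof -
  interpret V: graded_space "gens P" by (rule graded_space_gens[OF wf(1)])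
  interpret W: graded_space "gens Q" by (rule graded_space_gens[OF wf(3)])
  let ?l = "inl (gens P) (gens Q)" and ?l' = "inl (gens P') (gens Q')"
  let ?r = "inr (gens P) (gens Q)" and ?r' = "inr (gens P') (gens Q')"
  have "is_induced m P (box m P' Q') (\<lambda>x. map_prod \<phi> \<psi> (?l x)) (compose (carrier (alg m P)) h (box_inl m P Q))"
    by (rule is_induced_compose[OF wf(1) is_induced_box_inl[OF wf(1,3)] h]) (simp add: inl_def box_simps(1))
  moreover have "is_induced m P (box m P' Q') (\<lambda>x. ?l' (\<phi> x)) (compose (carrier (alg m P)) (box_inl m P' Q') f)"
    by (rule is_induced_compose[OF wf(1) f is_induced_box_inl[OF wf(2,4)]]) (rule \<phi>(1))
  moreover have "map_prod \<phi> \<psi> (?l x) = ?l' (\<phi> x)" for x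
    by (simp add: inl_def \<psi>(2))
  ultimately have l: "compose (carrier (alg m P)) h (box_inl m P Q) = compose (carrier (alg m P)) (box_inl m P' Q') f"
    using is_induced_unique[OF wf(1)] by simp
  have "is_induced m Q (box m P' Q') (\<lambda>x. map_prod \<phi> \<psi> (?r x)) (compose (carrier (alg m Q)) h (box_inr m P Q))"
    by (rule is_induced_compose[OF wf(3) is_induced_box_inr[OF wf(1,3)] h]) (simp add: inr_def box_simps(1))
  moreover have "is_induced m Q (box m P' Q') (\<lambda>x. ?r' (\<psi> x)) (compose (carrier (alg m Q)) (box_inr m P' Q') g)"
    by (rule is_induced_compose[OF wf(3) g is_induced_box_inr[OF wf(2,4)]]) (rule \<psi>(1))
  moreover have "map_prod \<phi> \<psi> (?r x) = ?r' (\<psi> x)" for x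
    by (simp add: inr_def \<phi>(2))
  ultimately have r: "compose (carrier (alg m Q)) h (box_inr m P Q) = compose (carrier (alg m Q)) (box_inr m P' Q') g"
    using is_induced_unique[OF wf(3)] by simp
  show ?thesis
    unfolding is_box_map_def using h compose_eqD[OF l] compose_eqD[OF r]
    by (simp add: is_induced_def compose_eq)
qed

lemma lm_map_map_prod:
  assumes "lm_map m L M \<phi>" "lm_map m L' M' \<psi>"
  shows "lm_map m (lprod L L') (lprod M M') (map_prod \<phi> \<psi>)"
proof -
  have L: "lm_algebra m L" "lm_algebra m L'"
    using assms by (auto simp: lm_map_iff)
  have "lm_map m (lprod L L') (lprod M M') (\<lambda>z. (\<phi> (fst z), \<psi> (snd z)))"
    by (rule lm_map_pair[OF lm_map_compose[OF lm_map_fst[OF L] assms(1)] lm_map_compose[OF lm_map_snd[OF L] assms(2)]])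
  then show ?thesis
    by (simp add: map_prod_def case_prod_unfold)
qed

text \<open>Morphisms of L(m)-algebras supply the candidate: their product is again such a morphism,
  between the products that the boxes present, and what it induces has the right
  restrictions.\<close>

lemma box_map_presents_uea:
  assumes P: "presents_uea m P L" "presents_uea m P' M" and Q: "presents_uea m Q L'" "presents_uea m Q' M'"
    and \<phi>: "lm_map m L M \<phi>" and \<psi>: "lm_map m L' M' \<psi>"
    and f: "is_induced m P P' \<phi> f" and g: "is_induced m Q Q' \<psi> g"
  shows "box_map_exists m P P' Q Q' f g"
    and "is_induced m (box m P Q) (box m P' Q') (map_prod \<phi> \<psi>) (box_map m P P' Q Q' f g)"
proof -
  have wf: "well_formed m P" "well_formed m P'" "well_formed m Q" "well_formed m Q'"
    using P Q by (auto simp: presents_uea_def)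
  have zero: "\<chi> \<zero>\<^bsub>K\<^esub> = \<zero>\<^bsub>N\<^esub>" if "lm_map m K N \<chi>" for K :: "('a, 'z) lalg" and N :: "('a, 'w) lalg" and \<chi>
  proof -
    interpret K: lm_algebra m K using that by (simp add: lm_map_iff)
    interpret N: lm_algebra m N using that by (simp add: lm_map_iff)
    have "\<chi> (0 \<odot>\<^bsub>K\<^esub> \<zero>\<^bsub>K\<^esub>) = 0 \<odot>\<^bsub>N\<^esub> \<chi> \<zero>\<^bsub>K\<^esub>" "\<chi> \<zero>\<^bsub>K\<^esub> \<in> carrier N"
      using that K.zero_closed unfolding lm_map_iff by blast+
    then show ?thesis by simp
  qed
  note gs = P[THEN presents_uea_gens] Q[THEN presents_uea_gens]
  have h: "is_induced m (box m P Q) (box m P' Q') (map_prod \<phi> \<psi>) (induced m (box m P Q) (box m P' Q') (map_prod \<phi> \<psi>))"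
    by (rule is_induced_presents_uea[OF presents_uea_box[OF P(1) Q(1)] presents_uea_box[OF P(2) Q(2)]
        lm_map_map_prod[OF \<phi> \<psi>]])
  then have b: "is_box_map m P P' Q Q' f g (induced m (box m P Q) (box m P' Q') (map_prod \<phi> \<psi>))"
    using \<phi> \<psi> zero[OF \<phi>] zero[OF \<psi>] by (intro is_box_map_induced[OF wf f g]) (auto simp: gs lm_map_iff)
  show "box_map_exists m P P' Q Q' f g"
    unfolding box_map_exists_def using b is_box_map_unique[OF wf(1,3)] by blast
  have "box_map m P P' Q Q' f g = induced m (box m P Q) (box m P' Q') (map_prod \<phi> \<psi>)"
    unfolding box_map_def using b is_box_map_unique[OF wf(1,3)] by (blast intro: the_equality)
  then show "is_induced m (box m P Q) (box m P' Q') (map_prod \<phi> \<psi>) (box_map m P P' Q Q' f g)"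
    using h by simp
qed


section \<open>The unit object\<close>

lemma ground_simps [simp]:
  "carrier ground = UNIV" "\<one>\<^bsub>ground\<^esub> = 1" "\<zero>\<^bsub>ground\<^esub> = 0" "x \<oplus>\<^bsub>ground\<^esub> y = x + y"
  "c \<odot>\<^bsub>ground\<^esub> x = c * x" "homog ground d = (if d = 0 then UNIV else {0})"
  "mu ground as = (if length as = 2 then as ! 0 * as ! 1 else 0)"
  by (auto simp: ground_def)

lemma module_ground: "module ring_of_type_algebra (ground :: ('k::field_char_0, 'k) amalg)"
  by (rule module_ring_of_typeI) (auto simp: algebra_simps)

lemma finsum_ground: "finsum (ground :: ('k::field_char_0, 'k) amalg) f D = sum f D"
proof -
  interpret module ring_of_type_algebra "ground :: ('k::field_char_0, 'k) amalg"
    by (rule module_ground)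
  show ?thesis
    by (rule finsum_eq_sum) (auto intro: abelian_monoid_axioms)
qed

lemma graded_space_ground: "graded_space (ground :: ('k::field_char_0, 'k) amalg)"
proof (rule graded_spaceI[OF module_ground, where p = "\<lambda>v d. if d = 0 then v else 0"])
  fix v :: 'k
  have sub: "{d::int. (if d = 0 then v else 0) \<noteq> \<zero>\<^bsub>ground\<^esub>} \<subseteq> {0}"
    by auto
  then show "finite {d::int. (if d = 0 then v else 0) \<noteq> \<zero>\<^bsub>ground\<^esub>}"
    by (rule finite_subset) simp
  have "(\<Sum>d\<in>{d::int. (if d = 0 then v else 0) \<noteq> \<zero>\<^bsub>ground\<^esub>}. if d = 0 then v else 0) =
      (\<Sum>d\<in>{0::int}. if d = 0 then v else 0)"
    by (rule sum.mono_neutral_left) auto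
  then show "v = (\<Oplus>\<^bsub>ground\<^esub>d\<in>{d::int. (if d = 0 then v else 0) \<noteq> \<zero>\<^bsub>ground\<^esub>}. if d = 0 then v else 0)"
    by (simp add: finsum_ground)
qed (auto split: if_splits)

lemma two_element_list: "length as = 2 \<Longrightarrow> as = [as ! 0, as ! 1]"
  by (cases as; cases "tl as") auto

text \<open>Only the terms of arity three with \<open>k = 2\<close> survive, and these two express associativity.\<close>

lemma stasheff_ground: "stasheff ground ds as = (0 :: 'k::field_char_0)"
proof (cases "length as = 3")
  case True
  then obtain a b c where as: "as = [a, b, c]"
    by (auto simp: numeral_3_eq_3 length_Suc_conv)
  have "{0..<3::nat} = {0, 1, 2}" "{1..3::nat} = {1, 2, 3}" "{1..2::nat} = {1, 2}"
    by auto
  then show ?thesis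
    by (simp add: as stasheff_def finsum_ground power_int_add power_int_minus_one_mult_self
        power_int_mult mult.assoc)
next
  case False
  have "(\<Sum>k\<in>{1..length as - l}. c k * mu ground (take l as @ mu ground (take k (drop l as)) # drop (l + k) as)) = 0"
    if l: "l < length as" for l and c :: "nat \<Rightarrow> 'k"
  proof (intro sum.neutral ballI)
    fix k assume k: "k \<in> {1..length as - l}"
    show "c k * mu ground (take l as @ mu ground (take k (drop l as)) # drop (l + k) as) = 0"
    proof (cases "k = 2")
      case True
      then show ?thesis using k l False by auto
    next
      case k2: False
      then have inner: "mu ground (take k (drop l as)) = 0"
        using k by simp
      have outer: "mu ground (us @ (0 :: 'k) # zs) = 0" for us zs
        by (cases us; cases "tl us"; cases zs) auto
      show ?thesis
        by (simp only: inner outer mult_zero_right)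
    qed
  qed
  then show ?thesis
    by (simp add: stasheff_def Let_def finsum_ground del: ground_simps(7))
qed

lemma unital_am_algebra_ground: "unital_am_algebra m (ground :: ('k::field_char_0, 'k) amalg)"
proof (intro unital_am_algebra.intro[OF graded_space_ground] unital_am_algebra_axioms.intro)
  show "graded_operations m (ground :: ('k, 'k) amalg) (mu ground)"
    unfolding graded_operations_def
  proof (intro conjI allI impI; (elim conjE)?)
    fix xs x y and zs :: "'k list"
    show "mu ground (xs @ (x \<oplus>\<^bsub>ground\<^esub> y) # zs) = mu ground (xs @ x # zs) \<oplus>\<^bsub>ground\<^esub> mu ground (xs @ y # zs)"
      by (cases xs; cases zs; cases "tl xs") (auto simp: algebra_simps)
  next
    fix xs a x and zs :: "'k list"
    show "mu ground (xs @ (a \<odot>\<^bsub>ground\<^esub> x) # zs) = a \<odot>\<^bsub>ground\<^esub> mu ground (xs @ x # zs)"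
      by (cases xs; cases zs; cases "tl xs") (auto simp: algebra_simps)
  next
    fix ds and as :: "'k list" assume *: "has_degs ground ds as"
    show "mu ground as \<in> homog ground (sum_list ds + int (length as) - 2)"
    proof (cases "length as = 2")
      case True
      then obtain a b where "as = [a, b]"
        by (auto simp: numeral_2_eq_2 length_Suc_conv)
      moreover obtain d e where "ds = [d, e]"
        using has_degs_length[OF *] True by (auto simp: numeral_2_eq_2 length_Suc_conv)
      ultimately show ?thesis
        using * by (auto split: if_splits)
    qed auto
  qed auto
qed (auto simp: stasheff_ground simp del: ground_simps(7), auto)

text \<open>The only generator is zero, so every element is a scalar multiple of the unit. A
  morphism to the ground field sends c times the unit to c, so it is inverse to c |-> c 1.\<close>

lemma one_obj_iso_ground: "\<exists>\<phi>. am_iso m (alg m (one_obj m)) (ground :: ('k::field_char_0, 'k) amalg) \<phi>"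
proof -
  let ?Z = "lzero :: ('k, unit) lalg" and ?G = "ground :: ('k, 'k) amalg"
  let ?P = "one_obj m :: ('k, unit) presentation"
  let ?V = "gspace.truncate ?Z"
  have Z: "lm_algebra m ?Z" by (rule lm_algebra_lzero)
  interpret Z: lm_algebra m ?Z by (rule Z)
  note wf = well_formed_uea[OF Z]
  interpret G: pre_am_algebra m ?G
    by (rule unital_am_algebra_pre[OF unital_am_algebra_ground])
  interpret A: unital_am_algebra m "alg m ?P"
    by (rule unital_am_algebra_alg[OF wf])
  interpret A: pre_am_algebra m "alg m ?P"
    by (rule unital_am_algebra_pre[OF unital_am_algebra_alg[OF wf]])
  have V: "graded_space ?V"
    by (rule graded_space_truncate[OF Z.graded_space_axioms])
  have l0: "linear0 ?V ?G (restrict (\<lambda>_. 0) (carrier ?V))"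
    by (rule linear0I) (auto simp: lzero_def)
  obtain h where h: "am_hom m (free_am m ?V) ?G h"
    and hgen: "\<And>x. x \<in> carrier ?V \<Longrightarrow> h (free_gen m ?V x) = restrict (\<lambda>_. 0) (carrier ?V) x"
    using free_extend[OF V unital_am_algebra_ground l0] by blast
  have h0: "h (free_gen m ?V x) = 0" for x
    using hgen[of x] by (simp add: lzero_def)
  interpret h: pre_am_hom m "free_am m ?V" ?G h
    using h by (simp add: am_hom_iff)
  have g: "free_gen m ?V x \<in> carrier (free_am m ?V)" for x
    using free_gen_carrier[OF wf] by (simp add: uea_simps(1) lzero_def)
  have "h (uea_rel m ?Z ds xs) = 0" if "has_degs ?Z ds xs" "arity m (length xs)" for ds xs
  proof -
    have xs: "set (map (free_gen m ?V) xs) \<subseteq> carrier (free_am m ?V)" "arity m (length (map (free_gen m ?V) xs))"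
      using g that by auto
    have "map h (map (free_gen m ?V) xs) = replicate (length xs) 0"
      by (simp add: h0 comp_def map_replicate_const)
    then have "h (antisymmetrization (free_am m ?V) ds (map (free_gen m ?V) xs)) =
        antisymmetrization ?G ds (replicate (length xs) 0)"
      using h.antisymmetrization[OF xs] by simp
    also have "\<dots> = 0"
    proof -
      have "mu ?G (permute_list s (replicate (length xs) 0)) = \<zero>\<^bsub>?G\<^esub>" if "s permutes {..<length xs}" for s
        by (rule G.mu_zero) (use that \<open>arity m (length xs)\<close> in \<open>auto simp: arity_def\<close>)
      then show ?thesis
        unfolding antisymmetrization_def by (simp add: finsum_ground del: ground_simps(7))
    qed
    finally have "h (antisymmetrization (free_am m ?V) ds (map (free_gen m ?V) xs)) = 0" .
    moreover have "h (uea_rel m ?Z ds xs) =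
        h (antisymmetrization (free_am m ?V) ds (map (free_gen m ?V) xs)) \<ominus>\<^bsub>?G\<^esub> h (free_gen m ?V (br ?Z xs))"
      unfolding uea_rel_def by (rule h.diff[OF h.A.antisymmetrization_carrier[OF xs] g])
    ultimately show ?thesis
      by (simp add: h0 a_minus_def G.minus_eq_smult)
  qed
  then have "h r = \<zero>\<^bsub>?G\<^esub>" if "r \<in> rels ?P" for r
    using that by (auto simp: rels_uea)
  moreover have "am_hom m (free_am m (gens ?P)) ?G h"
    using h by (simp add: uea_simps(1))
  ultimately obtain f where f: "am_hom m (alg m ?P) ?G f"
    using alg_extend[OF wf] by blast
  interpret f: pre_am_hom m "alg m ?P" ?G f
    using f by (simp add: am_hom_iff)
  let ?s = "\<lambda>c. c \<odot>\<^bsub>alg m ?P\<^esub> \<one>\<^bsub>alg m ?P\<^esub>"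
  have fs: "f (?s c) = c" for c
    using f.one by (simp add: f.smult)
  \<comment> \<open>The multiples of the unit contain the generator and are closed under all
    operations, by the unit axioms.\<close>
  have s: "\<exists>c. a = ?s c" if "a \<in> carrier (alg m ?P)" for a
    using that
  proof (induction rule: alg_induct[OF wf, consumes 1, case_names gen one add smult mu])
    case (gen x)
    interpret gn: graded_map "gens ?P" "alg m ?P" "restrict (gen m ?P) (carrier (gens ?P))"
      by (intro graded_map.intro graded_map_axioms.intro graded_space_gens[OF wf] A.graded_space_axioms linear0_gen[OF wf])
    have "gen m ?P () = \<zero>\<^bsub>alg m ?P\<^esub>"
      using gn.zero by (simp add: uea_simps(1) lzero_def)
    then show ?case
      by (intro exI[of _ 0]) simp
  next
    case one
    then show ?case by (intro exI[of _ 1]) simp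
  next
    case (add a b)
    then show ?case by (metis A.one_carrier A.smult_add_left)
  next
    case (smult c a)
    then show ?case by (metis A.one_carrier A.smult_smult)
  next
    case (mu as)
    show ?case
    proof (cases "length as = 2")
      case True
      then obtain c d where as: "as = [?s c, ?s d]"
        using mu(3)[of "as ! 0"] mu(3)[of "as ! 1"] True two_element_list[OF True] by fastforce
      \<comment> \<open>Arity 2 is within m here because \<open>as\<close> has two entries; for m =
        1 this case does not arise.\<close>
      have ar: "arity m (length [] + 1 + length [?s d])" "arity m (length [\<one>\<^bsub>alg m ?P\<^esub>] + 1 + length [])" "arity m 2"
        using mu(2) True by (auto simp: numeral_2_eq_2)
      have "amalg.mu (alg m ?P) as = c \<odot>\<^bsub>alg m ?P\<^esub> (d \<odot>\<^bsub>alg m ?P\<^esub> \<one>\<^bsub>alg m ?P\<^esub>)"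
        using A.mu_smult[of "[]" "[?s d]" "\<one>\<^bsub>alg m ?P\<^esub>" c] A.one_left[OF ar(3), of "?s d"] ar
        by (simp add: as)
      then show ?thesis
        by (metis A.one_carrier A.smult_smult)
    next
      case False
      have "\<exists>cs. as = map ?s cs"
        unfolding ex_map_conv using mu(3) by blast
      then obtain cs where cs: "as = map ?s cs"
        by blast
      have "amalg.mu (alg m ?P) (map ?s cs) = \<zero>\<^bsub>alg m ?P\<^esub>"
      proof (cases cs)
        case Nil
        then show ?thesis using mu(2) cs by (simp add: arity_def)
      next
        case (Cons c cs')
        \<comment> \<open>Away from arity 2 it is enough to pull the scalar out of the first slot:
          the unit remains there and the operation vanishes.\<close>
        have "amalg.mu (alg m ?P) (\<one>\<^bsub>alg m ?P\<^esub> # map ?s cs') = \<zero>\<^bsub>alg m ?P\<^esub>"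
          by (rule A.one_other) (use mu(2) False cs Cons in auto)
        then show ?thesis
          using A.mu_smult[of "[]" "map ?s cs'" "\<one>\<^bsub>alg m ?P\<^esub>" c] mu(2) cs Cons
          by (simp add: image_subset_iff)
      qed
      then show ?thesis
        using cs by (intro exI[of _ 0]) simp
    qed
  qed
  have "bij_betw f (carrier (alg m ?P)) (carrier ?G)"
  proof (rule bij_betw_byWitness[where f' = ?s])
    show "\<forall>a\<in>carrier (alg m ?P). ?s (f a) = a"
      using s fs by metis
  qed (use fs in auto)
  then show ?thesis
    using f unfolding am_iso_def by blast
qed


section \<open>The coalgebra structure\<close>

lemma lm_map_diagonal: "lm_algebra m L \<Longrightarrow> lm_map m L (lprod L L) (diagonal L)"
  using lm_map_pair[OF lm_map_id lm_map_id, of m L] by (simp add: lm_map_def diagonal_def)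

lemma lm_map_to_lzero: "lm_algebra m L \<Longrightarrow> lm_map m L lzero (to_lzero L)"
  using lm_map_lzero[of m L] by (simp add: lm_map_def to_lzero_def)

lemma cocommutative_coalgebra_uea:
  fixes L :: "('k::field_char_0, 'v) lalg"
  assumes L: "lm_algebra m L"
  shows "cocommutative_coalgebra m (uea m L) (comult m L) (augmentation m L)"
proof -
  let ?C = "uea m L" and ?Z = "lzero :: ('k, unit) lalg"
  let ?C2 = "box m ?C ?C" and ?I = "one_obj m :: ('k, unit) presentation"
  let ?A = "carrier (alg m ?C)"
  let ?id = "\<lambda>a\<in>?A. a" and ?\<Delta> = "comult m L" and ?\<epsilon> = "augmentation m L"
  note Z = lm_algebra_lzero[of m, where 'k = 'k]
  note LL = lm_algebra_lprod[OF L L]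
  note pC = presents_uea_uea[OF L] and pI = presents_uea_uea[OF Z]
  note pC2 = presents_uea_box[OF pC pC]
  note wf = well_formed_uea[OF L]
  note ids = lm_map_id[OF L] and \<delta> = lm_map_diagonal[OF L] and \<zeta> = lm_map_to_lzero[OF L]
  \<comment> \<open>\<open>comult\<close> is built as a map into the enveloping algebra of the
    product; equality of the ideals allows it to be read as a map into the box.\<close>
  have \<Delta>: "is_induced m ?C ?C2 (diagonal L) ?\<Delta>"
    using is_induced_uea[OF \<delta>] is_induced_same_alg[of m ?C ?C ?C2 "uea m (lprod L L)"] pC2 pC
    unfolding comult_def presents_uea_def by blast
  have \<epsilon>: "is_induced m ?C ?I (to_lzero L) ?\<epsilon>"
    unfolding augmentation_def by (rule is_induced_uea[OF \<zeta>])
  have idC: "is_induced m ?C ?C (\<lambda>x. x) ?id"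
    by (rule is_induced_id[OF wf]) simp
  note \<Delta>1 = box_map_presents_uea[OF pC pC2 pC pC \<delta> ids \<Delta> idC]
  note \<Delta>2 = box_map_presents_uea[OF pC pC pC pC2 ids \<delta> idC \<Delta>]
  note \<epsilon>1 = box_map_presents_uea[OF pC pI pC pC \<zeta> ids \<epsilon> idC]
  note \<epsilon>2 = box_map_presents_uea[OF pC pC pC pI ids \<zeta> idC \<epsilon>]
  have lassoc: "lm_map m (lprod (lprod L L) L) (lprod L (lprod L L)) assoc_gens"
  proof -
    have "lm_map m (lprod (lprod L L) L) (lprod L (lprod L L)) (\<lambda>z. (fst (fst z), (snd (fst z), snd z)))"
      by (intro lm_map_pair lm_map_compose[OF lm_map_fst[OF LL L]] lm_map_fst lm_map_snd LL L)
    then show ?thesis by (simp add: assoc_gens_def case_prod_unfold)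
  qed
  have lassoc': "lm_map m (lprod L (lprod L L)) (lprod (lprod L L) L) (\<lambda>z. ((fst z, fst (snd z)), snd (snd z)))"
    by (intro lm_map_pair lm_map_compose[OF lm_map_snd[OF L LL]] lm_map_fst lm_map_snd LL L)
  have lswap: "lm_map m (lprod L L) (lprod L L) prod.swap"
    using lm_map_pair[OF lm_map_snd[OF L L] lm_map_fst[OF L L]] by (simp add: prod.swap_def[abs_def])
  note lunitl = lm_map_snd[OF Z L] and lunitr = lm_map_fst[OF L Z]
  \<comment> \<open>These induce the inverses of the unitors: the missing coordinate is the map to
    the zero algebra, whose only element is \<open>()\<close>.\<close>
  note lunitl' = lm_map_pair[OF lm_map_lzero[OF L] ids] and lunitr' = lm_map_pair[OF ids lm_map_lzero[OF L]]
  have as: "is_induced m (box m ?C2 ?C) (box m ?C ?C2) assoc_gens (associator m ?C ?C ?C)"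
    unfolding associator_def
    by (rule is_induced_presents_uea[OF presents_uea_box[OF pC2 pC] presents_uea_box[OF pC pC2] lassoc])
  have lu: "is_induced m (box m ?I ?C) ?C snd (left_unitor m ?C)"
    unfolding left_unitor_def by (rule is_induced_presents_uea[OF presents_uea_box[OF pI pC] pC lunitl])
  have ru: "is_induced m (box m ?C ?I) ?C fst (right_unitor m ?C)"
    unfolding right_unitor_def by (rule is_induced_presents_uea[OF presents_uea_box[OF pC pI] pC lunitr])
  have sw: "is_induced m ?C2 ?C2 prod.swap (symmetry m ?C ?C)"
    unfolding symmetry_def by (rule is_induced_presents_uea[OF pC2 pC2 lswap])
  have dg: "diagonal L x \<in> carrier (gens ?C2)" if "x \<in> carrier (gens ?C)" for x
    using that by (simp add: box_simps(1) diagonal_def)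
  have iso: "induces_iso m (box m ?C2 ?C) (box m ?C ?C2) assoc_gens" "induces_iso m (box m ?I ?C) ?C snd"
    "induces_iso m (box m ?C ?I) ?C fst" "induces_iso m ?C2 ?C2 prod.swap"
    by (rule induces_iso_presents_uea[OF presents_uea_box[OF pC2 pC] presents_uea_box[OF pC pC2] lassoc lassoc']
        induces_iso_presents_uea[OF presents_uea_box[OF pI pC] pC lunitl lunitl']
        induces_iso_presents_uea[OF presents_uea_box[OF pC pI] pC lunitr lunitr']
        induces_iso_presents_uea[OF pC2 pC2 lswap lswap]; auto simp: assoc_gens_def)+
  have coassoc: "compose ?A (associator m ?C ?C ?C) (compose ?A (box_map m ?C ?C2 ?C ?C ?\<Delta> ?id) ?\<Delta>) =
      compose ?A (box_map m ?C ?C ?C ?C2 ?id ?\<Delta>) ?\<Delta>"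
  proof (rule is_induced_unique[OF wf])
    \<comment> \<open>On a generator x both sides give (x, (x, x)).\<close>
    show "is_induced m ?C (box m ?C ?C2) (\<lambda>x. assoc_gens (map_prod (diagonal L) (\<lambda>x. x) (diagonal L x)))
        (compose ?A (associator m ?C ?C ?C) (compose ?A (box_map m ?C ?C2 ?C ?C ?\<Delta> ?id) ?\<Delta>))"
      by (rule is_induced_compose[OF wf is_induced_compose[OF wf \<Delta> \<Delta>1(2) dg] as])
        (auto simp: box_simps(1) diagonal_def)
    show "is_induced m ?C (box m ?C ?C2) (\<lambda>x. assoc_gens (map_prod (diagonal L) (\<lambda>x. x) (diagonal L x)))
        (compose ?A (box_map m ?C ?C ?C ?C2 ?id ?\<Delta>) ?\<Delta>)"
      \<comment> \<open>The two maps of generators are compared on the carrier only, where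
        \<open>diagonal L\<close> is given by its formula.\<close>
      using is_induced_compose[OF wf \<Delta> \<Delta>2(2) dg]
      by (rule iffD1[OF is_induced_cong, rotated]) (auto simp: assoc_gens_def diagonal_def)
  qed
  have counitl: "compose ?A (left_unitor m ?C) (compose ?A (box_map m ?C ?I ?C ?C ?\<epsilon> ?id) ?\<Delta>) = ?id"
  proof (rule is_induced_unique[OF wf])
    show "is_induced m ?C ?C (\<lambda>x. snd (map_prod (to_lzero L) (\<lambda>x. x) (diagonal L x)))
        (compose ?A (left_unitor m ?C) (compose ?A (box_map m ?C ?I ?C ?C ?\<epsilon> ?id) ?\<Delta>))"
      by (rule is_induced_compose[OF wf is_induced_compose[OF wf \<Delta> \<epsilon>1(2) dg] lu])
        (auto simp: box_simps(1) diagonal_def to_lzero_def lzero_def)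
    show "is_induced m ?C ?C (\<lambda>x. snd (map_prod (to_lzero L) (\<lambda>x. x) (diagonal L x))) ?id"
      by (rule is_induced_id[OF wf]) (simp add: diagonal_def)
  qed
  have counitr: "compose ?A (right_unitor m ?C) (compose ?A (box_map m ?C ?C ?C ?I ?id ?\<epsilon>) ?\<Delta>) = ?id"
  proof (rule is_induced_unique[OF wf])
    show "is_induced m ?C ?C (\<lambda>x. fst (map_prod (\<lambda>x. x) (to_lzero L) (diagonal L x)))
        (compose ?A (right_unitor m ?C) (compose ?A (box_map m ?C ?C ?C ?I ?id ?\<epsilon>) ?\<Delta>))"
      by (rule is_induced_compose[OF wf is_induced_compose[OF wf \<Delta> \<epsilon>2(2) dg] ru])
        (auto simp: box_simps(1) diagonal_def to_lzero_def lzero_def)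
    show "is_induced m ?C ?C (\<lambda>x. fst (map_prod (\<lambda>x. x) (to_lzero L) (diagonal L x))) ?id"
      by (rule is_induced_id[OF wf]) (simp add: diagonal_def)
  qed
  have cocomm: "compose ?A (symmetry m ?C ?C) ?\<Delta> = ?\<Delta>"
  proof (rule is_induced_unique[OF wf])
    show "is_induced m ?C ?C2 (\<lambda>x. prod.swap (diagonal L x)) (compose ?A (symmetry m ?C ?C) ?\<Delta>)"
      by (rule is_induced_compose[OF wf \<Delta> sw dg])
    show "is_induced m ?C ?C2 (\<lambda>x. prod.swap (diagonal L x)) ?\<Delta>"
      using \<Delta> by (rule iffD1[OF is_induced_cong, rotated]) (auto simp: diagonal_def)
  qed
  show ?thesis
    unfolding cocommutative_coalgebra_def Let_def
    using \<Delta> \<epsilon> iso \<Delta>1(1) \<Delta>2(1) \<epsilon>1(1) \<epsilon>2(1) coassoc counitl counitr cocomm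
    by (simp add: is_induced_def)
qed

text \<open>\<open>comult\<close> and \<open>augmentation\<close> rest on definite descriptions, and
  the unit object is a presented algebra. The conjuncts beside the coalgebra axioms ensure that
  these descriptions denote, that the two forms of the target of the comultiplication agree, and
  that the unit object is the ground field.\<close>

theorem proposition4p3:
  fixes m :: enat and L :: "('k::field_char_0, 'v) lalg"
  assumes "1 \<le> m" and "lm_algebra m L"
  shows "lm_hom m L (lprod L L) (diagonal L) \<and>
    alg m (uea m (lprod L L)) = alg m (box m (uea m L) (uea m L)) \<and>
    induces m (uea m L) (uea m (lprod L L)) (diagonal L) \<and>
    induces m (uea m L) (one_obj m) (to_lzero L) \<and>
    (\<exists>\<phi>. am_iso m (alg m (one_obj m)) (ground :: ('k, 'k) amalg) \<phi>) \<and>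
    cocommutative_coalgebra m (uea m L) (comult m L) (augmentation m L)"
proof (intro conjI)
  note L = assms(2)
  note wf = well_formed_uea[OF L]
  show "lm_hom m L (lprod L L) (diagonal L)"
    using lm_map_diagonal[OF L] by (simp add: lm_map_def diagonal_def)
  show "alg m (uea m (lprod L L)) = alg m (box m (uea m L) (uea m L))"
    using same_alg_alg[OF same_alg_box_uea[OF L L]] by simp
  show "induces m (uea m L) (uea m (lprod L L)) (diagonal L)"
    by (rule is_induced_imp(1)[OF wf is_induced_uea[OF lm_map_diagonal[OF L]]])
  show "induces m (uea m L) (one_obj m) (to_lzero L)"
    by (rule is_induced_imp(1)[OF wf is_induced_uea[OF lm_map_to_lzero[OF L]]])
  show "\<exists>\<phi>. am_iso m (alg m (one_obj m)) (ground :: ('k, 'k) amalg) \<phi>"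
    by (rule one_obj_iso_ground)
  show "cocommutative_coalgebra m (uea m L) (comult m L) (augmentation m L)"
    by (rule cocommutative_coalgebra_uea[OF L])
qed

end
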